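(* Let $\lambda>0$, $k>0$, $\rho>0$, $\gamma>0$, $\alpha>0$, let $y_r\in\mathbb{R}$ with $y_r\ne0$, and let $u_r\in\mathcal{L}^2(0,1)$ be arbitrary but fixed. Consider the total error system $\Sigma_{\mathrm{tot}}$ with state $(\eta,\tilde u,\tilde\chi)\in\mathcal{L}^2(0,1)\oplus\mathcal{L}^2(0,1)\oplus\mathbb{R}$, given by $$\begin{aligned} \dot\eta&=A_\eta\eta-\Psi(\tilde\chi)\eta-(k-\Psi(\tilde\chi))(\tilde u+u_r),\\ \begin{bmatrix}\dot{\tilde u}\\ \dot{\tilde\chi}\end{bmatrix}&=A_e\begin{bmatrix}\tilde u\\ \tilde\chi\end{bmatrix}, \end{aligned}$$ where $$A_\eta\eta:=\lambda\eta_{xx},\qquad D(A_\eta):=\{\eta\in\mathcal{H}^2(0,1)\colon\eta_x(0)=0,\ \eta_x(1)=-\alpha\eta(1)\},$$ $$A_e\begin{bmatrix}\tilde u\\ \tilde\chi\end{bmatrix}:=\begin{bmatrix}\lambda\tilde u_{xx}-k\tilde u\\ -\rho\,\tilde u(1)\end{bmatrix},$$ $$D(A_e):=\left\{(\tilde u,\tilde\chi)\in\mathcal{H}^2(0,1)\oplus\mathbb{R}\colon \tilde u_x(0)=0,\ \tilde u_x(1)=-\gamma\tilde u(1)+\tilde\chi\right\},$$ $$\Psi(\tilde\chi):=g_\lambda^{-1}\!\left(\max\left\{0,\frac{\tilde\chi}{y_r}+\frac{\bar\chi}{y_r}\right\}\right),\qquad \bar\chi:=g_\lambda(k)\,y_r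 .$$ Then the origin of $\Sigma_{\mathrm{tot}}$ is globally asymptotically stable (GAS) and locally exponentially stable (LES).
   Context: The function $g_\lambda\colon[0,\infty)\to[0,\infty)$ is $g_\lambda(k)=\sqrt{\tfrac{k}{\lambda}}\tanh\!\left(\sqrt{\tfrac{k}{\lambda}}\right)$; it is of class $\mathcal{K}^\infty$ and $g_\lambda^{-1}\colon[0,\infty)\to[0,\infty)$ is its inverse, so $\Psi(0)=k$. $\mathcal{H}^2(0,1):=\{f\in\mathcal{L}^2(0,1)\colon f,f'\text{ are absolutely continuous and } f''\in\mathcal{L}^2(0,1)\}$ (each up to choice of representative). Subscripts $x$, $xx$ denote first and second derivatives in $x\in[0,1]$. The total system is understood as a semilinear abstract system $\dot z=Az+f(z)$ on the Hilbert space $\mathcal{Z}=\mathcal{L}^2(0,1)\oplus\mathcal{L}^2(0,1)\oplus\mathbb{R}$ with its natural norm $\|\cdot\|$, where $z=(\eta,\tilde u,\tilde\chi)$, $A=\mathrm{diag}(A_\eta,A_e)$ with domain $D(A)=D(A_\eta)\times D(A_e)$, and $f(z)=\left(-\Psi(\tilde\chi)\eta-(k-\Psi(\tilde\chi))(\tilde u+u_r),\,0,\,0\right)$. Here $A$ generates a strongly continuous semigroup and $f$ is locally Lipschitz continuous, so that for each initial condition in $\mathcal{Z}$ there is a unique maximal solution. A solution is a continuous $\varphi\colon[0,T)\to\mathcal{Z}$, $T\in\mathbb{R}_{\ge0}\cup\{\infty\}$, such that for all $t\in[0,T)$: $\int_0^t\varphi(s)\,ds\in D(A)$ and $\varphi(t)=\varphi(0)+A\int_0^t\varphi(s)\,ds+\int_0^tf(\varphi(s))\,ds$.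 It is maximal if its domain cannot be extended; bounded maximal solutions are defined on $[0,\infty)$. The origin of such a system is: - stable if for all $\varepsilon>0$ there is $\delta>0$ such that any maximal solution with $\|\varphi(0)\|\le\delta$ satisfies $\|\varphi(t)\|\le\varepsilon$ for all $t\ge0$; - globally uniformly attractive if every solution is bounded and for any $\varepsilon,\mu>0$ there exists $T>0$ such that $t\ge T$ implies $\|\varphi(t)\|\le\varepsilon$ for every (maximal) solution with $\|\varphi(0)\|\le\mu$; - globally asymptotically stable (GAS) if both stable and globally uniformly attractive; - locally exponentially stable (LES) if there exist $r,\mu,\kappa>0$ such that any maximal solution with $\|\varphi(0)\|\le r$ satisfies $\|\varphi(t)\|\le\kappa e^{-\mu t}\|\varphi(0)\|$ for all $t\ge0$. Completeness of maximal solutions is part of these notions. Background: $\tilde u=u-\bar u$ and $\tilde\chi=\chi-\bar\chi$ are the closed-loop errors for the plant $u_t=\lambda u_{xx}-ku$, $u_x(0,t)=0$, $u_x(1,t)=v(t)$, $y(t)=u(1,t)$ with compensator $\dot\chi=-\rho(y-y_r)$, $v=\chi-\gamma(y-y_r)$ and equilibrium $(\bar u,\bar\chi)$. The variable $\eta=u-\hat u$ is the estimation error of the observer $\hat u_t=\lambda\hat u_{xx}-\hat k(t)\hat u$, $\hat u_x(0,t)=0$, $\hat u_x(1,t)=v(t)+\alpha(y(t)-\hat u(1,t))$ with $\hat k(t)=\Psi(\tilde\chi(t))$; in this application $u=\tilde u+u_r$, i.e. $u_r=\bar u$. *)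

theory Defs
  imports "HOL-Analysis.Analysis"
begin

section \<open>The Hilbert space of real square integrable functions on the unit interval\<close>

abbreviation unit_leb :: "real measure" where
  "unit_leb \<equiv> lebesgue_on {0<..<1}"

definition sq_integrable :: "(real \<Rightarrow> real) \<Rightarrow> bool" where
  "sq_integrable f \<longleftrightarrow> f \<in> borel_measurable unit_leb \<and> integrable unit_leb (\<lambda>x. (f x)\<^sup>2)"

lemma sq_integrableD:
  assumes "sq_integrable f"
  shows "f \<in> borel_measurable unit_leb" "integrable unit_leb (\<lambda>x. (f x)\<^sup>2)"
  using assms by (auto simp: sq_integrable_def)

lemma sq_integrable_mult:
  assumes "sq_integrable f" "sq_integrable g"
  shows "integrable unit_leb (\<lambda>x. f x * g x)"
proof (rule Bochner_Integration.integrable_bound)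
  show "integrable unit_leb (\<lambda>x. (f x)\<^sup>2 + (g x)\<^sup>2)"
    using assms by (auto simp: sq_integrable_def)
  show "(\<lambda>x. f x * g x) \<in> borel_measurable unit_leb"
    using assms by (auto simp: sq_integrable_def)
  have "\<bar>a * b\<bar> \<le> a\<^sup>2 + b\<^sup>2" for a b :: real
  proof -
    have "0 \<le> (\<bar>a\<bar> - \<bar>b\<bar>)\<^sup>2" by simp
    then have "2 * (\<bar>a\<bar> * \<bar>b\<bar>) \<le> a\<^sup>2 + b\<^sup>2" by (simp add: power2_diff)
    moreover have "0 \<le> \<bar>a\<bar> * \<bar>b\<bar>" by simp
    ultimately show ?thesis unfolding abs_mult by linarith
  qed
  then show "AE x in unit_leb. norm (f x * g x) \<le> norm ((f x)\<^sup>2 + (g x)\<^sup>2)"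
    by simp
qed

lemma sq_integrable_zero: "sq_integrable (\<lambda>_. 0)"
  by (simp add: sq_integrable_def)

lemma sq_integrable_scale: "sq_integrable f \<Longrightarrow> sq_integrable (\<lambda>x. c * f x)"
  by (auto simp: sq_integrable_def power_mult_distrib)

lemma sq_integrable_add:
  assumes "sq_integrable f" "sq_integrable g"
  shows "sq_integrable (\<lambda>x. f x + g x)"
proof -
  have "integrable unit_leb (\<lambda>x. (f x)\<^sup>2 + (g x)\<^sup>2 + 2 * (f x * g x))"
    using assms sq_integrable_mult[OF assms] by (auto simp: sq_integrable_def)
  then show ?thesis
    using assms by (auto simp: sq_integrable_def power2_sum mult.assoc)
qed

quotient_type L2 = "real \<Rightarrow> real" /
  partial: "\<lambda>f g. sq_integrable f \<and> sq_integrable g \<and> (AE x in unit_leb. f x = g x)"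
proof (rule part_equivpI)
  show "\<exists>f. sq_integrable f \<and> sq_integrable f \<and> (AE x in unit_leb. f x = f x)"
    using sq_integrable_zero by auto
  show "symp (\<lambda>f g. sq_integrable f \<and> sq_integrable g \<and> (AE x in unit_leb. f x = g x))"
    by (auto intro!: sympI)
  show "transp (\<lambda>f g. sq_integrable f \<and> sq_integrable g \<and> (AE x in unit_leb. f x = g x))"
    by (auto intro!: transpI)
qed

instantiation L2 :: real_inner
begin

lift_definition zero_L2 :: L2 is "\<lambda>_. 0"
  by (simp add: sq_integrable_zero)

lift_definition plus_L2 :: "L2 \<Rightarrow> L2 \<Rightarrow> L2" is "\<lambda>f g x. f x + g x"
  by (auto intro: sq_integrable_add)

lift_definition uminus_L2 :: "L2 \<Rightarrow> L2" is "\<lambda>f x. - f x"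
  using sq_integrable_scale[of _ "-1"] by auto

lift_definition minus_L2 :: "L2 \<Rightarrow> L2 \<Rightarrow> L2" is "\<lambda>f g x. f x - g x"
  using sq_integrable_add[OF _ sq_integrable_scale[of _ "-1"]] by auto

lift_definition scaleR_L2 :: "real \<Rightarrow> L2 \<Rightarrow> L2" is "\<lambda>c f x. c * f x"
  by (auto intro: sq_integrable_scale)

lift_definition inner_L2 :: "L2 \<Rightarrow> L2 \<Rightarrow> real" is
  "\<lambda>f g. integral\<^sup>L unit_leb (\<lambda>x. f x * g x)"
  by (rule integral_cong_AE) (auto simp: sq_integrable_def)

definition norm_L2 :: "L2 \<Rightarrow> real" where "norm_L2 u = sqrt (inner u u)"

definition dist_L2 :: "L2 \<Rightarrow> L2 \<Rightarrow> real" where "dist_L2 u v = norm (u - v)"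

definition sgn_L2 :: "L2 \<Rightarrow> L2" where "sgn_L2 u = inverse (norm u) *\<^sub>R u"

definition uniformity_L2 :: "(L2 \<times> L2) filter" where
  "uniformity_L2 = (INF e\<in>{0<..}. principal {(x, y). dist x y < e})"

definition open_L2 :: "L2 set \<Rightarrow> bool" where
  "open_L2 U \<longleftrightarrow> (\<forall>x\<in>U. eventually (\<lambda>(x', y). x' = x \<longrightarrow> y \<in> U) uniformity)"

instance
proof
  fix a b c :: L2 and r s :: real
  show "a + b + c = a + (b + c)"
    by transfer (auto intro!: sq_integrable_add simp: add.assoc)
  show "a + b = b + a"
    by transfer (auto intro!: sq_integrable_add simp: add.commute)
  show "0 + a = a"
    by transfer auto
  show "- a + a = 0"
    by transfer (auto intro: sq_integrable_zero)
  show "a - b = a + - b"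
    by transfer (use sq_integrable_add[OF _ sq_integrable_scale[of _ "-1"]] in auto)
  show "r *\<^sub>R (a + b) = r *\<^sub>R a + r *\<^sub>R b"
    by transfer (auto intro!: sq_integrable_add sq_integrable_scale simp: distrib_left)
  show "(r + s) *\<^sub>R a = r *\<^sub>R a + s *\<^sub>R a"
    by transfer (auto intro!: sq_integrable_add sq_integrable_scale simp: distrib_right)
  show "r *\<^sub>R s *\<^sub>R a = (r * s) *\<^sub>R a"
    by transfer (auto intro!: sq_integrable_scale simp: mult.assoc)
  show "1 *\<^sub>R a = a"
    by transfer auto
  show "dist a b = norm (a - b)" by (rule dist_L2_def)
  show "sgn a = inverse (norm a) *\<^sub>R a" by (rule sgn_L2_def)
  show "uniformity = (INF e\<in>{0<..}. principal {(x, y :: L2). dist x y < e})"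
    by (rule uniformity_L2_def)
  show "open U \<longleftrightarrow> (\<forall>x\<in>U. eventually (\<lambda>(x', y). x' = x \<longrightarrow> y \<in> U) uniformity)" for U :: "L2 set"
    by (rule open_L2_def)
  show "inner a b = inner b a"
    by transfer (simp add: mult.commute)
  show "inner (a + b) c = inner a c + inner b c"
    by transfer (auto simp: distrib_right sq_integrable_mult)
  show "inner (r *\<^sub>R a) b = r * inner a b"
    by transfer (auto simp: mult.assoc sq_integrable_mult)
  show "0 \<le> inner a a"
    by transfer simp
  show "(inner a a = 0) = (a = 0)"
  proof transfer
    fix f assume "sq_integrable f \<and> sq_integrable f \<and> (AE x in unit_leb. f x = f x)"
    then have f: "sq_integrable f" by simp
    have "(integral\<^sup>L unit_leb (\<lambda>x. f x * f x) = 0) \<longleftrightarrow> (AE x in unit_leb. f x * f x = 0)"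
      by (rule integral_nonneg_eq_0_iff_AE) (use sq_integrable_mult[OF f f] in auto)
    then show "(integral\<^sup>L unit_leb (\<lambda>x. f x * f x) = 0) \<longleftrightarrow>
        sq_integrable f \<and> sq_integrable (\<lambda>_. 0) \<and> (AE x in unit_leb. f x = 0)"
      using f sq_integrable_zero by simp
  qed
  show "norm a = sqrt (inner a a)" by (rule norm_L2_def)
qed

end

lemma L2_cases:
  obtains f where "sq_integrable f" "u = abs_L2 f"
proof -
  have "sq_integrable (rep_L2 u)" "abs_L2 (rep_L2 u) = u"
    using Quotient3_rep_reflp[OF Quotient3_L2, of u] Quotient3_abs_rep[OF Quotient3_L2, of u]
    by auto
  then show ?thesis using that by metis
qed

lemma abs_L2_eq_iff:
  assumes "sq_integrable f" "sq_integrable g"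
  shows "abs_L2 f = abs_L2 g \<longleftrightarrow> (AE x in unit_leb. f x = g x)"
  using Quotient3_rel[OF Quotient3_L2, of f g] assms by auto

lemma norm_abs_L2_sq:
  assumes "sq_integrable f"
  shows "(norm (abs_L2 f))\<^sup>2 = integral\<^sup>L unit_leb (\<lambda>x. (f x)\<^sup>2)"
  unfolding power2_norm_eq_inner using assms
  by (subst inner_L2.abs_eq) (auto simp: power2_eq_square)

lemma abs_L2_diff:
  assumes "sq_integrable f" "sq_integrable g"
  shows "abs_L2 f - abs_L2 g = abs_L2 (\<lambda>x. f x - g x)"
  using assms by (simp add: minus_L2.abs_eq)

lemma sq_integrable_diff:
  assumes "sq_integrable f" "sq_integrable g"
  shows "sq_integrable (\<lambda>x. f x - g x)"
  using sq_integrable_add[OF assms(1) sq_integrable_scale[OF assms(2), of "-1"]] by simp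

lemma sq_integrable_abs: "sq_integrable f \<Longrightarrow> sq_integrable (\<lambda>x. \<bar>f x\<bar>)"
  by (auto simp: sq_integrable_def)

lemma finite_measure_unit_leb: "finite_measure unit_leb"
  by (rule finite_measure_lebesgue_on) simp

lemma sq_integrable_const: "sq_integrable (\<lambda>_. c)"
proof -
  interpret finite_measure unit_leb by (rule finite_measure_unit_leb)
  show ?thesis by (simp add: sq_integrable_def)
qed

lemma norm_abs_L2_one: "norm (abs_L2 (\<lambda>_. 1)) = 1"
proof -
  have "(norm (abs_L2 (\<lambda>_. 1)))\<^sup>2 = 1"
    by (simp add: norm_abs_L2_sq[OF sq_integrable_const] measure_restrict_space)
  then show ?thesis
    by (metis norm_ge_zero one_power2 power2_eq_iff_nonneg zero_le_one)
qed

lemma L1_le_L2: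
  assumes f: "sq_integrable f"
  shows "integral\<^sup>L unit_leb (\<lambda>x. \<bar>f x\<bar>) \<le> norm (abs_L2 f)"
proof -
  have a: "sq_integrable (\<lambda>x. \<bar>f x\<bar>)" using f by (rule sq_integrable_abs)
  have "integral\<^sup>L unit_leb (\<lambda>x. \<bar>f x\<bar>) = inner (abs_L2 (\<lambda>x. \<bar>f x\<bar>)) (abs_L2 (\<lambda>_. 1))"
    using a sq_integrable_const[of 1] by (simp add: inner_L2.abs_eq)
  also have "\<dots> \<le> norm (abs_L2 (\<lambda>x. \<bar>f x\<bar>)) * norm (abs_L2 (\<lambda>_. 1))"
    by (rule norm_cauchy_schwarz)
  also have "\<dots> = norm (abs_L2 (\<lambda>x. \<bar>f x\<bar>))"
    by (simp add: norm_abs_L2_one)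
  also have "\<dots> = norm (abs_L2 f)"
  proof (rule power2_eq_imp_eq)
    show "(norm (abs_L2 (\<lambda>x. \<bar>f x\<bar>)))\<^sup>2 = (norm (abs_L2 f))\<^sup>2"
      unfolding norm_abs_L2_sq[OF a] norm_abs_L2_sq[OF f] by (simp only: power2_abs)
  qed (rule norm_ge_zero)+
  finally show ?thesis .
qed

instance L2 :: complete_space
proof
  fix X :: "nat \<Rightarrow> L2"
  assume X: "Cauchy X"
  have "\<exists>r::nat\<Rightarrow>nat. \<forall>n. (\<forall>m\<ge>r n. norm (X m - X (r n)) < (1/2)^n) \<and> r n < r (Suc n)"
  proof (rule dependent_nat_choice)
    show "\<exists>x. \<forall>m\<ge>x. norm (X m - X x) < (1/2)^0"
      using X[unfolded Cauchy_altdef2, rule_format, of 1] by (auto simp: dist_norm)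
  next
    fix x n
    obtain N where N: "\<forall>m\<ge>N. \<forall>k\<ge>N. dist (X m) (X k) < (1/2)^Suc n"
      using X[unfolded Cauchy_def, rule_format, of "(1/2)^Suc n"] by auto
    show "\<exists>y. (\<forall>m\<ge>y. norm (X m - X y) < (1/2)^Suc n) \<and> x < y"
      by (rule exI[of _ "max N (Suc x)"]) (use N in \<open>auto simp: dist_norm\<close>)
  qed
  then obtain r :: "nat \<Rightarrow> nat"
    where r: "\<And>n m. m \<ge> r n \<Longrightarrow> norm (X m - X (r n)) < (1/2)^n"
      and r_step: "\<And>n. r n < r (Suc n)" by blast
  have r_mono: "strict_mono r" using r_step by (simp add: strict_mono_Suc_iff)
  have "\<forall>n. \<exists>f. sq_integrable f \<and> X (r n) = abs_L2 f" by (metis L2_cases)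
  then obtain u where u: "\<And>n. sq_integrable (u n)" and Xu: "\<And>n. X (r n) = abs_L2 (u n)"
    by metis
  have [measurable]: "u n \<in> borel_measurable unit_leb" for n
    using u sq_integrableD by blast
  define d where "d n x = \<bar>u (Suc n) x - u n x\<bar>" for n x
  have d_meas [measurable]: "d n \<in> borel_measurable unit_leb" for n
    unfolding d_def by measurable
  have d_bound: "(\<integral>\<^sup>+x. ennreal (d n x) \<partial>unit_leb) \<le> ennreal ((1/2)^n)" for n
  proof -
    interpret finite_measure unit_leb by (rule finite_measure_unit_leb)
    have df: "sq_integrable (\<lambda>x. u (Suc n) x - u n x)" by (rule sq_integrable_diff[OF u u])
    have "integral\<^sup>L unit_leb (d n) \<le> norm (X (r (Suc n)) - X (r n))"
      unfolding d_def Xu abs_L2_diff[OF u u] by (rule L1_le_L2[OF df])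
    also have "\<dots> \<le> (1/2)^n" using r[of n "r (Suc n)"] r_step[of n] by simp
    finally have *: "integral\<^sup>L unit_leb (d n) \<le> (1/2)^n" .
    have "integrable unit_leb (\<lambda>x. (d n x) * 1)"
      unfolding d_def by (rule sq_integrable_mult[OF sq_integrable_abs[OF df] sq_integrable_const])
    then have "(\<integral>\<^sup>+x. ennreal (d n x) \<partial>unit_leb) = ennreal (integral\<^sup>L unit_leb (d n))"
      by (intro nn_integral_eq_integral) (auto simp: d_def)
    then show ?thesis using * by (simp add: ennreal_leI)
  qed
  have "(\<integral>\<^sup>+x. (\<Sum>n. ennreal (d n x)) \<partial>unit_leb) = (\<Sum>n. \<integral>\<^sup>+x. ennreal (d n x) \<partial>unit_leb)"
    by (rule nn_integral_suminf) auto
  also have "\<dots> \<le> (\<Sum>n. ennreal ((1/2)^n))"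
    by (intro suminf_le d_bound) auto
  also have "\<dots> = ennreal (\<Sum>n. (1/2)^n)"
    by (rule suminf_ennreal2) (auto intro: summable_geometric)
  finally have fin: "(\<integral>\<^sup>+x. (\<Sum>n. ennreal (d n x)) \<partial>unit_leb) \<noteq> \<infinity>"
    by (auto simp: top_unique)
  have "AE x in unit_leb. (\<Sum>n. ennreal (d n x)) \<noteq> \<infinity>"
    by (rule nn_integral_PInf_AE[OF _ fin]) auto
  then have conv: "AE x in unit_leb. convergent (\<lambda>n. u n x)"
  proof eventually_elim
    case (elim x)
    have "summable (\<lambda>n. d n x)"
      using elim by (intro summable_suminf_not_top) (auto simp: d_def)
    then have "summable (\<lambda>n. u (Suc n) x - u n x)"
      unfolding d_def by (rule summable_rabs_cancel)
    then have "convergent (\<lambda>n. u 0 x + (\<Sum>i<n. u (Suc i) x - u i x))"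
      by (intro convergent_add convergent_const) (simp add: summable_iff_convergent)
    moreover have "(\<lambda>n. u 0 x + (\<Sum>i<n. u (Suc i) x - u i x)) = (\<lambda>n. u n x)"
      by (subst sum_lessThan_telescope) simp
    ultimately show ?case by simp
  qed
  define v where "v x = lim (\<lambda>n. u n x)" for x
  have [measurable]: "v \<in> borel_measurable unit_leb"
    unfolding v_def by (rule borel_measurable_lim_metric) measurable
  have lim: "AE x in unit_leb. (\<lambda>n. u n x) \<longlonglongrightarrow> v x"
    using conv by eventually_elim (simp add: v_def convergent_LIMSEQ_iff)
  have bound: "(\<integral>\<^sup>+x. ennreal ((v x - u n x)\<^sup>2) \<partial>unit_leb) \<le> ennreal (((1/2)^n)\<^sup>2)" for n
  proof -
    have "(\<integral>\<^sup>+x. ennreal ((v x - u n x)\<^sup>2) \<partial>unit_leb)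
        = (\<integral>\<^sup>+x. liminf (\<lambda>m. ennreal ((u m x - u n x)\<^sup>2)) \<partial>unit_leb)"
    proof (rule nn_integral_cong_AE, use lim in eventually_elim)
      case (elim x)
      have "(\<lambda>m. ennreal ((u m x - u n x)\<^sup>2)) \<longlonglongrightarrow> ennreal ((v x - u n x)\<^sup>2)"
        by (intro tendsto_ennrealI tendsto_intros elim)
      then show ?case by (rule lim_imp_Liminf[symmetric, OF sequentially_bot])
    qed
    also have "\<dots> \<le> liminf (\<lambda>m. \<integral>\<^sup>+x. ennreal ((u m x - u n x)\<^sup>2) \<partial>unit_leb)"
      by (rule nn_integral_liminf) measurable
    also have "\<dots> \<le> ennreal (((1/2)^n)\<^sup>2)"
    proof (rule order_trans[OF Liminf_mono Liminf_const[OF sequentially_bot, THEN eq_refl]],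
        rule eventually_mono[OF eventually_ge_at_top[of n]])
      fix m assume "n \<le> m"
      then have "r n \<le> r m" using r_mono by (simp add: strict_mono_less_eq)
      then have lt: "norm (X (r m) - X (r n)) \<le> (1/2)^n" using r[of n "r m"] by simp
      have df: "sq_integrable (\<lambda>x. u m x - u n x)" by (rule sq_integrable_diff[OF u u])
      have "(\<integral>\<^sup>+x. ennreal ((u m x - u n x)\<^sup>2) \<partial>unit_leb)
          = ennreal (integral\<^sup>L unit_leb (\<lambda>x. (u m x - u n x)\<^sup>2))"
        using sq_integrableD(2)[OF df] by (intro nn_integral_eq_integral) auto
      also have "integral\<^sup>L unit_leb (\<lambda>x. (u m x - u n x)\<^sup>2) = (norm (X (r m) - X (r n)))\<^sup>2"
        unfolding Xu abs_L2_diff[OF u u] norm_abs_L2_sq[OF df] ..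
      finally show "(\<integral>\<^sup>+x. ennreal ((u m x - u n x)\<^sup>2) \<partial>unit_leb) \<le> ennreal (((1/2)^n)\<^sup>2)"
        using lt by (simp add: ennreal_leI power_mono)
    qed
    finally show ?thesis .
  qed
  have vu: "sq_integrable (\<lambda>x. v x - u n x)" for n
  proof -
    have "integrable unit_leb (\<lambda>x. (v x - u n x)\<^sup>2)"
    proof (rule integrableI_bounded)
      show "(\<integral>\<^sup>+x. ennreal (norm ((v x - u n x)\<^sup>2)) \<partial>unit_leb) < \<infinity>"
        using le_less_trans[OF bound[of n]] by simp
    qed measurable
    then show ?thesis by (simp add: sq_integrable_def)
  qed
  have v: "sq_integrable v"
    using sq_integrable_add[OF vu[of 0] u[of 0]] by simp
  have norm_vu: "norm (X (r n) - abs_L2 v) \<le> (1/2)^n" for n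
  proof -
    have "ennreal ((norm (abs_L2 v - X (r n)))\<^sup>2)
        = ennreal (integral\<^sup>L unit_leb (\<lambda>x. (v x - u n x)\<^sup>2))"
      unfolding Xu abs_L2_diff[OF v u] norm_abs_L2_sq[OF vu] ..
    also have "\<dots> = (\<integral>\<^sup>+x. ennreal ((v x - u n x)\<^sup>2) \<partial>unit_leb)"
      using sq_integrableD(2)[OF vu] by (intro nn_integral_eq_integral[symmetric]) auto
    also have "\<dots> \<le> ennreal (((1/2)^n)\<^sup>2)" by (rule bound)
    finally have "(norm (abs_L2 v - X (r n)))\<^sup>2 \<le> ((1/2)^n)\<^sup>2"
      by (subst (asm) ennreal_le_iff) auto
    then show ?thesis by (simp add: norm_minus_commute power2_le_iff_abs_le)
  qed
  have "(\<lambda>n. X (r n)) \<longlonglongrightarrow> abs_L2 v"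
  proof (rule LIM_zero_cancel, rule Lim_null_comparison)
    show "\<forall>\<^sub>F n in sequentially. norm (X (r n) - abs_L2 v) \<le> (1/2)^n" using norm_vu by simp
    show "(\<lambda>n. (1/2)^n :: real) \<longlonglongrightarrow> 0" by (rule LIMSEQ_power_zero) simp
  qed
  then have "X \<longlonglongrightarrow> abs_L2 v"
    using Cauchy_converges_subseq[OF X r_mono, of "abs_L2 v"] by (simp add: o_def)
  then show "convergent X" by (auto simp: convergent_def)
qed

instance L2 :: banach ..

section \<open>Absolute continuity, point values and derivatives\<close>

definition abs_cont_on :: "real set \<Rightarrow> (real \<Rightarrow> real) \<Rightarrow> bool" where
  "abs_cont_on S f \<longleftrightarrow> (\<forall>\<epsilon>>0. \<exists>\<delta>>0. \<forall>(n::nat) a b.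
     (\<forall>i<n. a i \<le> b i \<and> {a i..b i} \<subseteq> S) \<and>
     disjoint_family_on (\<lambda>i. {a i<..<b i}) {..<n} \<and> (\<Sum>i<n. b i - a i) < \<delta>
     \<longrightarrow> (\<Sum>i<n. \<bar>f (b i) - f (a i)\<bar>) < \<epsilon>)"

definition ac_repr :: "L2 \<Rightarrow> (real \<Rightarrow> real) \<Rightarrow> bool" where
  "ac_repr u f \<longleftrightarrow> abs_cont_on {0..1} f \<and> sq_integrable f \<and> u = abs_L2 f"

text \<open>\<open>pt_val u x\<close> is \<open>u(x)\<close> for \<open>x \<in> [0,1]\<close>, boundary points included, read off the absolutely
  continuous representative of \<open>u\<close>, whose values on \<open>[0,1]\<close> are unique.
  Junk if there is no such representative; likewise for \<open>L2_dx\<close>.\<close>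

definition pt_val :: "L2 \<Rightarrow> real \<Rightarrow> real" where
  "pt_val u = (SOME f. ac_repr u f)"

definition L2_dx :: "L2 \<Rightarrow> L2" where
  "L2_dx u = abs_L2 (deriv (pt_val u))"

text \<open>\<open>f'\<close> is the absolutely continuous representative of the derivative of \<open>f\<close>, so it is
  related to \<open>f\<close> only almost everywhere.\<close>

definition H2_jet :: "L2 \<Rightarrow> (real \<Rightarrow> real) \<Rightarrow> (real \<Rightarrow> real) \<Rightarrow> (real \<Rightarrow> real) \<Rightarrow> bool" where
  "H2_jet u f f' f'' \<longleftrightarrow> ac_repr u f \<and>
     (AE x in unit_leb. (f has_real_derivative f' x) (at x)) \<and> abs_cont_on {0..1} f' \<and>
     (AE x in unit_leb. (f' has_real_derivative f'' x) (at x)) \<and> sq_integrable f''"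

definition H2 :: "L2 set" where
  "H2 = {u. \<exists>f f' f''. H2_jet u f f' f''}"

lemma abs_cont_on_imp_continuous_on:
  assumes "abs_cont_on {0..1} f"
  shows "continuous_on {0..1} f"
  unfolding continuous_on_iff
proof (intro ballI allI impI)
  fix x e :: real assume x: "x \<in> {0..1}" and e: "0 < e"
  obtain d where d: "d > 0" and *: "\<And>(n::nat) a b.
     (\<forall>i<n. a i \<le> b i \<and> {a i..b i} \<subseteq> {0..1}) \<and>
     disjoint_family_on (\<lambda>i. {a i<..<b i}) {..<n} \<and> (\<Sum>i<n. b i - a i) < d
     \<Longrightarrow> (\<Sum>i<n. \<bar>f (b i) - f (a i)\<bar>) < e"
    using assms e unfolding abs_cont_on_def by blast
  have close: "\<bar>f t - f s\<bar> < e" if "s \<in> {0..1}" "t \<in> {0..1}" "s \<le> t" "t - s < d" for s t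
    using *[of 1 "\<lambda>_. s" "\<lambda>_. t"] that by (auto simp: disjoint_family_on_def)
  show "\<exists>d>0. \<forall>x'\<in>{0..1}. dist x' x < d \<longrightarrow> dist (f x') (f x) < e"
  proof (intro exI[of _ d] conjI d ballI impI)
    fix x' assume x': "x' \<in> {0..1}" "dist x' x < d"
    show "dist (f x') (f x) < e"
      using close[of x x'] close[of x' x] x x'
      by (cases "x \<le> x'") (auto simp: dist_real_def)
  qed
qed

lemma continuous_AE_eq:
  assumes f: "continuous_on {0..1} f" and g: "continuous_on {0..1} g"
    and ae: "AE x in unit_leb. f x = g x" and x: "x \<in> {0..1::real}"
  shows "f x = (g x :: real)"
proof (rule ccontr)
  assume ne: "f x \<noteq> g x"
  define h where "h y = \<bar>f y - g y\<bar>" for y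
  have "continuous_on {0..1} h" unfolding h_def by (intro continuous_intros f g)
  moreover have "0 < h x" using ne by (simp add: h_def)
  ultimately obtain d where d: "d > 0"
    and hd: "\<And>y. y \<in> {0..1} \<Longrightarrow> dist y x < d \<Longrightarrow> dist (h y) (h x) < h x"
    using x unfolding continuous_on_iff by metis
  have pos: "f y \<noteq> g y" if "y \<in> {0..1}" "dist y x < d" for y
    using hd[OF that] by (auto simp: h_def dist_real_def)
  define a b where "a = max 0 (x - d)" and "b = min 1 (x + d)"
  have ab: "a < b" using x d by (auto simp: a_def b_def)
  have sub: "{a<..<b} \<subseteq> {0<..<1}" by (auto simp: a_def b_def)
  have "AE y in lebesgue. y \<in> {0<..<1} \<longrightarrow> f y = g y"
    using ae by (subst (asm) AE_restrict_space_iff) auto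
  then have "AE y in lebesgue. y \<notin> {a<..<b}"
  proof eventually_elim
    case (elim y)
    show ?case
    proof
      assume y: "y \<in> {a<..<b}"
      then have "y \<in> {0<..<1}" using sub by blast
      moreover have "dist y x < d" using y by (auto simp: a_def b_def dist_real_def)
      ultimately show False using elim pos[of y] by auto
    qed
  qed
  then have "{a<..<b} \<in> null_sets lebesgue"
    by (subst (asm) AE_iff_null_sets[symmetric]) auto
  then have "emeasure lebesgue {a<..<b} = 0" by blast
  then show False using ab by simp
qed

lemma pt_val_eq:
  assumes "ac_repr u f" "x \<in> {0..1}"
  shows "pt_val u x = f x"
proof -
  have p: "ac_repr u (pt_val u)" unfolding pt_val_def by (rule someI[of "ac_repr u", OF assms(1)])
  have "AE x in unit_leb. pt_val u x = f x"
    using p assms(1) abs_L2_eq_iff[of "pt_val u" f] by (auto simp: ac_repr_def)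
  then show ?thesis
    using p assms by (intro continuous_AE_eq[of "pt_val u" f])
      (auto simp: ac_repr_def intro: abs_cont_on_imp_continuous_on)
qed

lemma L2_dx_eq:
  assumes u: "ac_repr u f" and ae: "AE x in unit_leb. (f has_real_derivative f' x) (at x)"
    and f': "sq_integrable f'"
  shows "L2_dx u = abs_L2 f'"
proof -
  have "AE x in unit_leb. x \<in> {0<..<1}" by (rule AE_I2) simp
  with ae have ae': "AE x in unit_leb. f' x = deriv (pt_val u) x"
  proof eventually_elim
    case (elim x)
    have "(pt_val u has_real_derivative f' x) (at x)"
    proof (rule has_field_derivative_transform_within_open[of f "f' x" x "{0<..<1}"])
      show "f y = pt_val u y" if "y \<in> {0<..<1}" for y
        using pt_val_eq[OF u, of y] that by simp
    qed (use elim in simp_all)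
    then show ?case by (simp add: DERIV_imp_deriv)
  qed
  have m: "deriv (pt_val u) \<in> borel_measurable unit_leb"
  proof -
    have "(\<lambda>x. if x \<in> {0<..<1} then f' x else 0) \<in> borel_measurable lebesgue"
      by (rule borel_measurable_if_I) (use sq_integrableD(1)[OF f'] in simp_all)
    moreover have "AE x in lebesgue. (if x \<in> {0<..<1} then f' x else 0)
        = (if x \<in> {0<..<1} then deriv (pt_val u) x else 0)"
      using ae' by (subst (asm) AE_restrict_space_iff) auto
    ultimately have "(\<lambda>x. if x \<in> {0<..<1} then deriv (pt_val u) x else 0)
        \<in> borel_measurable lebesgue"
      by (rule borel_measurable_AE)
    then show ?thesis by (rule borel_measurable_if_D)
  qed
  have "integrable unit_leb (\<lambda>x. (deriv (pt_val u) x)\<^sup>2)"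
  proof (rule integrable_cong_AE_imp[of _ "\<lambda>x. (f' x)\<^sup>2"])
    show "integrable unit_leb (\<lambda>x. (f' x)\<^sup>2)" by (rule sq_integrableD(2)[OF f'])
    show "(\<lambda>x. (deriv (pt_val u) x)\<^sup>2) \<in> borel_measurable unit_leb" using m by simp
    show "AE x in unit_leb. (f' x)\<^sup>2 = (deriv (pt_val u) x)\<^sup>2"
      using ae' by eventually_elim simp
  qed
  then have "sq_integrable (deriv (pt_val u))" using m by (simp add: sq_integrable_def)
  moreover have "AE x in unit_leb. deriv (pt_val u) x = f' x"
    using ae' by eventually_elim simp
  ultimately show ?thesis unfolding L2_dx_def using f' by (simp add: abs_L2_eq_iff)
qed

lemma abs_cont_on_imp_sq_integrable:
  assumes "abs_cont_on {0..1} f"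
  shows "sq_integrable f"
proof -
  have c: "continuous_on {0..1} f" by (rule abs_cont_on_imp_continuous_on[OF assms])
  have "f absolutely_integrable_on {0..1}" "(\<lambda>x. (f x)\<^sup>2) absolutely_integrable_on {0..1}"
    by (rule absolutely_integrable_continuous_real, intro continuous_intros c)+
  then have "set_integrable lebesgue {0<..<1} f"
      "set_integrable lebesgue {0<..<1} (\<lambda>x. (f x)\<^sup>2)"
    by (auto elim!: set_integrable_subset)
  then have "integrable unit_leb f" "integrable unit_leb (\<lambda>x. (f x)\<^sup>2)"
    by (simp_all add: integrable_restrict_space set_integrable_def)
  then show ?thesis by (auto simp: sq_integrable_def)
qed

lemma H2_jet_values:
  assumes "H2_jet u f f' f''"
  shows "x \<in> {0..1} \<Longrightarrow> pt_val u x = f x"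
    and "x \<in> {0..1} \<Longrightarrow> pt_val (L2_dx u) x = f' x"
    and "L2_dx (L2_dx u) = abs_L2 f''"
proof -
  note j = assms[unfolded H2_jet_def]
  have f': "sq_integrable f'" using j abs_cont_on_imp_sq_integrable by blast
  have "L2_dx u = abs_L2 f'" using j f' L2_dx_eq by blast
  then have r: "ac_repr (L2_dx u) f'" using j f' by (simp add: ac_repr_def)
  show "x \<in> {0..1} \<Longrightarrow> pt_val u x = f x" using j pt_val_eq by blast
  show "x \<in> {0..1} \<Longrightarrow> pt_val (L2_dx u) x = f' x" using r by (rule pt_val_eq)
  show "L2_dx (L2_dx u) = abs_L2 f''" using r j L2_dx_eq by blast
qed

section \<open>Semilinear abstract systems\<close>

text \<open>A solution of \<open>z' = A z + f(z)\<close> is a pair \<open>(T, \<phi>)\<close>; only the values of \<open>\<phi>\<close> on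
  \<open>[0,T)\<close> are relevant.\<close>

definition time_dom :: "ereal \<Rightarrow> real set" where
  "time_dom T = {t. 0 \<le> t \<and> ereal t < T}"

definition is_solution ::
    "'z::banach set \<Rightarrow> ('z \<Rightarrow> 'z) \<Rightarrow> ('z \<Rightarrow> 'z) \<Rightarrow> ereal \<Rightarrow> (real \<Rightarrow> 'z) \<Rightarrow> bool" where
  "is_solution D A f T \<phi> \<longleftrightarrow> 0 \<le> T \<and> continuous_on (time_dom T) \<phi> \<and>
     (\<forall>t\<in>time_dom T. integral {0..t} \<phi> \<in> D \<and>
        \<phi> t = \<phi> 0 + A (integral {0..t} \<phi>) + integral {0..t} (\<lambda>s. f (\<phi> s)))"

definition is_maximal_solution ::
    "'z::banach set \<Rightarrow> ('z \<Rightarrow> 'z) \<Rightarrow> ('z \<Rightarrow> 'z) \<Rightarrow> ereal \<Rightarrow> (real \<Rightarrow> 'z) \<Rightarrow> bool" where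
  "is_maximal_solution D A f T \<phi> \<longleftrightarrow> is_solution D A f T \<phi> \<and>
     \<not> (\<exists>T' \<psi>. T < T' \<and> is_solution D A f T' \<psi> \<and> (\<forall>t\<in>time_dom T. \<psi> t = \<phi> t))"

text \<open>Completeness of maximal solutions is part of each of the following notions, hence the
  conclusion \<open>T = \<infinity>\<close>.\<close>

definition origin_stable :: "'z::banach set \<Rightarrow> ('z \<Rightarrow> 'z) \<Rightarrow> ('z \<Rightarrow> 'z) \<Rightarrow> bool" where
  "origin_stable D A f \<longleftrightarrow> (\<forall>\<epsilon>>0. \<exists>\<delta>>0. \<forall>T \<phi>.
     is_maximal_solution D A f T \<phi> \<and> norm (\<phi> 0) \<le> \<delta> \<longrightarrow>
     T = \<infinity> \<and> (\<forall>t\<ge>0. norm (\<phi> t) \<le> \<epsilon>))"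

definition origin_glob_unif_attractive ::
    "'z::banach set \<Rightarrow> ('z \<Rightarrow> 'z) \<Rightarrow> ('z \<Rightarrow> 'z) \<Rightarrow> bool" where
  "origin_glob_unif_attractive D A f \<longleftrightarrow>
     (\<forall>T \<phi>. is_solution D A f T \<phi> \<longrightarrow> bounded (\<phi> ` time_dom T)) \<and>
     (\<forall>T \<phi>. is_maximal_solution D A f T \<phi> \<longrightarrow> T = \<infinity>) \<and>
     (\<forall>\<epsilon>>0. \<forall>\<mu>>0. \<exists>\<tau>>0. \<forall>T \<phi>.
        is_maximal_solution D A f T \<phi> \<and> norm (\<phi> 0) \<le> \<mu> \<longrightarrow>
        (\<forall>t\<ge>\<tau>. norm (\<phi> t) \<le> \<epsilon>))"

definition origin_GAS :: "'z::banach set \<Rightarrow> ('z \<Rightarrow> 'z) \<Rightarrow> ('z \<Rightarrow> 'z) \<Rightarrow> bool" where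
  "origin_GAS D A f \<longleftrightarrow> origin_stable D A f \<and> origin_glob_unif_attractive D A f"

definition origin_LES :: "'z::banach set \<Rightarrow> ('z \<Rightarrow> 'z) \<Rightarrow> ('z \<Rightarrow> 'z) \<Rightarrow> bool" where
  "origin_LES D A f \<longleftrightarrow> (\<exists>r>0. \<exists>\<mu>>0. \<exists>\<kappa>>0. \<forall>T \<phi>.
     is_maximal_solution D A f T \<phi> \<and> norm (\<phi> 0) \<le> r \<longrightarrow>
     T = \<infinity> \<and> (\<forall>t\<ge>0. norm (\<phi> t) \<le> \<kappa> * exp (- \<mu> * t) * norm (\<phi> 0)))"

section \<open>The total error system\<close>

definition g_fun :: "real \<Rightarrow> real \<Rightarrow> real" where
  "g_fun lam k = sqrt (k / lam) * tanh (sqrt (k / lam))"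

definition g_inv :: "real \<Rightarrow> real \<Rightarrow> real" where
  "g_inv lam = the_inv_into {0..} (g_fun lam)"

definition chi_bar :: "real \<Rightarrow> real \<Rightarrow> real \<Rightarrow> real" where
  "chi_bar lam k y_r = g_fun lam k * y_r"

definition Psi :: "real \<Rightarrow> real \<Rightarrow> real \<Rightarrow> real \<Rightarrow> real" where
  "Psi lam k y_r chi = g_inv lam (max 0 (chi / y_r + chi_bar lam k y_r / y_r))"

lemma inj_on_g_fun:
  assumes "lam > 0"
  shows "inj_on (g_fun lam) {0..}"
proof (rule strict_mono_on_imp_inj_on, rule strict_mono_onI)
  fix a b :: real assume ab: "a \<in> {0..}" "b \<in> {0..}" "a < b"
  have "a / lam < b / lam" using ab assms by (simp add: divide_strict_right_mono)
  then have lt: "sqrt (a / lam) < sqrt (b / lam)" by simp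
  have nonneg: "0 \<le> sqrt (a / lam)" using ab assms by simp
  show "g_fun lam a < g_fun lam b"
    unfolding g_fun_def by (rule mult_strict_mono') (use lt nonneg in simp_all)
qed

lemma Psi_zero:
  assumes "lam > 0" "k > 0" "y_r \<noteq> 0"
  shows "Psi lam k y_r 0 = k"
proof -
  have "0 \<le> g_fun lam k" using assms by (simp add: g_fun_def)
  then show ?thesis
    using assms inj_on_g_fun[of lam]
    by (simp add: Psi_def g_inv_def chi_bar_def the_inv_into_f_f)
qed

definition D_eta :: "real \<Rightarrow> L2 set" where
  "D_eta \<alpha> = {\<eta> \<in> H2. pt_val (L2_dx \<eta>) 0 = 0 \<and> pt_val (L2_dx \<eta>) 1 = - \<alpha> * pt_val \<eta> 1}"

definition A_eta :: "real \<Rightarrow> L2 \<Rightarrow> L2" where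
  "A_eta lam \<eta> = lam *\<^sub>R L2_dx (L2_dx \<eta>)"

definition D_e :: "real \<Rightarrow> (L2 \<times> real) set" where
  "D_e \<gamma> = {(u, chi). u \<in> H2 \<and> pt_val (L2_dx u) 0 = 0 \<and>
     pt_val (L2_dx u) 1 = - \<gamma> * pt_val u 1 + chi}"

definition A_e :: "real \<Rightarrow> real \<Rightarrow> real \<Rightarrow> L2 \<times> real \<Rightarrow> L2 \<times> real" where
  "A_e lam k \<rho> = (\<lambda>(u, chi). (lam *\<^sub>R L2_dx (L2_dx u) - k *\<^sub>R u, - \<rho> * pt_val u 1))"

definition D_tot :: "real \<Rightarrow> real \<Rightarrow> (L2 \<times> L2 \<times> real) set" where
  "D_tot \<alpha> \<gamma> = D_eta \<alpha> \<times> D_e \<gamma>"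

definition A_tot :: "real \<Rightarrow> real \<Rightarrow> real \<Rightarrow> L2 \<times> L2 \<times> real \<Rightarrow> L2 \<times> L2 \<times> real" where
  "A_tot lam k \<rho> = (\<lambda>(\<eta>, z_e). (A_eta lam \<eta>, A_e lam k \<rho> z_e))"

definition f_tot ::
    "real \<Rightarrow> real \<Rightarrow> real \<Rightarrow> L2 \<Rightarrow> L2 \<times> L2 \<times> real \<Rightarrow> L2 \<times> L2 \<times> real" where
  "f_tot lam k y_r u_r = (\<lambda>(\<eta>, u, chi).
     (- (Psi lam k y_r chi *\<^sub>R \<eta>) - (k - Psi lam k y_r chi) *\<^sub>R (u + u_r), 0, 0))"

end

theory Submission
  imports Defs
begin

text \<open>The energy of \<open>(u, chi)\<close>, written \<open>(u, \<xi>)\<close> below, corrected by a small multiple of \<open>\<xi>\<close> times the mean of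
  \<open>u\<close>, is a strict quadratic Lyapunov function, so this linear subsystem decays exponentially. The
  operator of \<open>\<eta>\<close> is strictly dissipative, \<open>- \<Psi> \<eta>\<close> adds dissipation, and the remaining
  inhomogeneity \<open>(k - \<Psi>) (u + u_r)\<close> is exponentially small because \<open>\<Psi>\<close> is locally Lipschitz with
  value \<open>k\<close> at the origin. Hence every solution starting in a fixed ball decays exponentially, with
  a rate independent of the ball, which gives both claims.

  Energy estimates hold for integrated solutions since their Steklov averages are classical
  solutions. Maximal solutions are global because, once \<open>(u, \<xi>)\<close> is known, the equation of
  \<open>\<eta>\<close> is linear; the linear equations are solved by convergence of the implicit Euler scheme,
  which needs only dissipativity and the solvability of the resolvent equation.\<close>

subsection \<open>Absolute continuity\<close>

text \<open>The obstacle is the product of \<Psi> and \<eta>: the inverse of \<open>g_fun\<close>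
  grows quadratically, so the nonlinearity is only locally Lipschitz and a perturbation argument
  would remain local. The way out is the cascade, in which \<open>(u, \<xi>)\<close> evolves on its
  own, together with the sign of \<Psi>: along a solution the coefficient of \<eta> is a given
  nonnegative function of time, and the radius of the ball enters only the constant in the bound of
  the inhomogeneity. Two quadratic forms are used for \<open>(u, \<xi>)\<close>: the natural energy
  makes \<open>A_e\<close> dissipative, which suffices for existence and uniqueness, and its
  corrected version gives decay. Both resolvent equations reduce to one Robin problem, solved
  explicitly by hyperbolic functions. The energy estimate admits any continuous inhomogeneity, in
  particular the nonlinearity evaluated along a solution, and so serves uniqueness and decay for the
  semilinear system as well.\<close>

lemma abs_cont_on_dominated:
  assumes f: "abs_cont_on S f" and g: "abs_cont_on S g" and C: "0 \<le> C"
    and le: "\<And>a b. a \<le> b \<Longrightarrow> {a..b} \<subseteq> S \<Longrightarrow>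
      \<bar>h b - h a\<bar> \<le> C * (\<bar>f b - f a\<bar> + \<bar>g b - g a\<bar> + (b - a))"
  shows "abs_cont_on S h"
  unfolding abs_cont_on_def
proof (intro allI impI)
  fix e :: real assume e: "0 < e"
  \<comment> \<open>Domination gives at most \<open>C * 3 * e'\<close>, which is
    \<open>e * (C / (C + 1))\<close> and hence below \<open>e\<close>; adding 1 to \<open>C\<close>
    also covers \<open>C = 0\<close>.\<close>
  define e' where "e' = e / (3 * (C + 1))"
  have e': "0 < e'" using e C by (simp add: e'_def)
  obtain d1 where d1: "d1 > 0" and f': "\<And>(n::nat) a b.
     (\<forall>i<n. a i \<le> b i \<and> {a i..b i} \<subseteq> S) \<and>
     disjoint_family_on (\<lambda>i. {a i<..<b i}) {..<n} \<and> (\<Sum>i<n. b i - a i) < d1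
     \<Longrightarrow> (\<Sum>i<n. \<bar>f (b i) - f (a i)\<bar>) < e'"
    using f e' unfolding abs_cont_on_def by blast
  obtain d2 where d2: "d2 > 0" and g': "\<And>(n::nat) a b.
     (\<forall>i<n. a i \<le> b i \<and> {a i..b i} \<subseteq> S) \<and>
     disjoint_family_on (\<lambda>i. {a i<..<b i}) {..<n} \<and> (\<Sum>i<n. b i - a i) < d2
     \<Longrightarrow> (\<Sum>i<n. \<bar>g (b i) - g (a i)\<bar>) < e'"
    using g e' unfolding abs_cont_on_def by blast
  show "\<exists>\<delta>>0. \<forall>(n::nat) a b.
     (\<forall>i<n. a i \<le> b i \<and> {a i..b i} \<subseteq> S) \<and>
     disjoint_family_on (\<lambda>i. {a i<..<b i}) {..<n} \<and> (\<Sum>i<n. b i - a i) < \<delta>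
     \<longrightarrow> (\<Sum>i<n. \<bar>h (b i) - h (a i)\<bar>) < e"
  proof (intro exI[of _ "min e' (min d1 d2)"] conjI allI impI)
    fix n :: nat and a b :: "nat \<Rightarrow> real"
    assume *: "(\<forall>i<n. a i \<le> b i \<and> {a i..b i} \<subseteq> S) \<and>
     disjoint_family_on (\<lambda>i. {a i<..<b i}) {..<n} \<and> (\<Sum>i<n. b i - a i) < min e' (min d1 d2)"
    have "(\<Sum>i<n. \<bar>h (b i) - h (a i)\<bar>)
        \<le> (\<Sum>i<n. C * (\<bar>f (b i) - f (a i)\<bar> + \<bar>g (b i) - g (a i)\<bar> + (b i - a i)))"
      by (rule sum_mono) (use * le in auto)
    also have "\<dots> = C * ((\<Sum>i<n. \<bar>f (b i) - f (a i)\<bar>) + (\<Sum>i<n. \<bar>g (b i) - g (a i)\<bar>)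
        + (\<Sum>i<n. b i - a i))"
      by (simp only: sum_distrib_left sum.distrib distrib_left)
    also have "\<dots> \<le> C * (e' + e' + e')"
      using f'[of n a b] g'[of n a b] * C by (intro mult_left_mono add_mono) auto
    also have "\<dots> = e * (C / (C + 1))" using C unfolding e'_def by (simp add: divide_simps)
    also have "\<dots> < e * 1" using C e by (intro mult_strict_left_mono) auto
    finally show "(\<Sum>i<n. \<bar>h (b i) - h (a i)\<bar>) < e" by simp
  qed (use e' d1 d2 in auto)
qed

lemma abs_cont_on_const: "abs_cont_on S (\<lambda>_. c)"
  by (auto simp: abs_cont_on_def intro: exI[of _ 1])

lemma abs_cont_on_lipschitz:
  assumes "\<And>a b. a \<le> b \<Longrightarrow> {a..b} \<subseteq> S \<Longrightarrow> \<bar>h b - h a\<bar> \<le> C * (b - a)"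
  shows "abs_cont_on S h"
proof (rule abs_cont_on_dominated[of S "\<lambda>_. 0" "\<lambda>_. 0" "\<bar>C\<bar>"])
  fix a b :: real assume ab: "a \<le> b" "{a..b} \<subseteq> S"
  have "C * (b - a) \<le> \<bar>C\<bar> * (b - a)" using ab by (intro mult_right_mono) auto
  then show "\<bar>h b - h a\<bar> \<le> \<bar>C\<bar> * (\<bar>0 - 0\<bar> + \<bar>0 - 0\<bar> + (b - a))"
    using assms[OF ab] by simp
qed (auto intro: abs_cont_on_const)

lemma abs_cont_on_linear_comb:
  assumes "abs_cont_on S f" "abs_cont_on S g"
  shows "abs_cont_on S (\<lambda>x. c * f x + d * g x)"
proof (rule abs_cont_on_dominated[OF assms, of "\<bar>c\<bar> + \<bar>d\<bar>"])
  fix a b :: real assume ab: "a \<le> b"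
  have "\<bar>c * f b + d * g b - (c * f a + d * g a)\<bar> = \<bar>c * (f b - f a) + d * (g b - g a)\<bar>"
    by (simp add: algebra_simps)
  also have "\<dots> \<le> \<bar>c\<bar> * \<bar>f b - f a\<bar> + \<bar>d\<bar> * \<bar>g b - g a\<bar>"
    using abs_triangle_ineq[of "c * (f b - f a)" "d * (g b - g a)"] by (simp add: abs_mult)
  also have "\<dots> \<le> (\<bar>c\<bar> + \<bar>d\<bar>) * (\<bar>f b - f a\<bar> + \<bar>g b - g a\<bar> + (b - a))"
    using ab mult_nonneg_nonneg[of "\<bar>c\<bar>" "b - a"] mult_nonneg_nonneg[of "\<bar>d\<bar>" "b - a"]
      mult_nonneg_nonneg[of "\<bar>c\<bar>" "\<bar>g b - g a\<bar>"] mult_nonneg_nonneg[of "\<bar>d\<bar>" "\<bar>f b - f a\<bar>"]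
    unfolding distrib_left distrib_right by linarith
  finally show "\<bar>c * f b + d * g b - (c * f a + d * g a)\<bar>
      \<le> (\<bar>c\<bar> + \<bar>d\<bar>) * (\<bar>f b - f a\<bar> + \<bar>g b - g a\<bar> + (b - a))" .
qed simp

lemma abs_cont_on_mult:
  assumes f: "abs_cont_on S f" and g: "abs_cont_on S g"
    and bound: "\<And>x. x \<in> S \<Longrightarrow> \<bar>f x\<bar> \<le> M" "\<And>x. x \<in> S \<Longrightarrow> \<bar>g x\<bar> \<le> M"
  shows "abs_cont_on S (\<lambda>x. f x * g x)"
proof (rule abs_cont_on_dominated[OF f g, of "\<bar>M\<bar>"])
  fix a b :: real assume ab: "a \<le> b" "{a..b} \<subseteq> S"
  then have in_S: "a \<in> S" "b \<in> S" by auto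
  have "\<bar>f b * g b - f a * g a\<bar> = \<bar>g b * (f b - f a) + f a * (g b - g a)\<bar>"
    by (simp add: algebra_simps)
  also have "\<dots> \<le> \<bar>g b\<bar> * \<bar>f b - f a\<bar> + \<bar>f a\<bar> * \<bar>g b - g a\<bar>"
    using abs_triangle_ineq[of "g b * (f b - f a)" "f a * (g b - g a)"] by (simp add: abs_mult)
  also have "\<dots> \<le> \<bar>M\<bar> * \<bar>f b - f a\<bar> + \<bar>M\<bar> * \<bar>g b - g a\<bar>"
    using bound(1)[of a] bound(2)[of b] in_S by (intro add_mono mult_right_mono) auto
  also have "\<dots> \<le> \<bar>M\<bar> * (\<bar>f b - f a\<bar> + \<bar>g b - g a\<bar> + (b - a))"
    using ab mult_nonneg_nonneg[of "\<bar>M\<bar>" "b - a"] unfolding distrib_left by simp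
  finally show "\<bar>f b * g b - f a * g a\<bar> \<le> \<bar>M\<bar> * (\<bar>f b - f a\<bar> + \<bar>g b - g a\<bar> + (b - a))" .
qed simp

lemma abs_cont_on_mult_unit:
  assumes f: "abs_cont_on {0..1} f" and g: "abs_cont_on {0..1} g"
  shows "abs_cont_on {0..1} (\<lambda>x. f x * g x)"
proof -
  have "bounded (f ` {0..1})" "bounded (g ` {0..1})"
    using assms by (auto intro!: compact_imp_bounded compact_continuous_image
        abs_cont_on_imp_continuous_on)
  then obtain M1 M2 where "\<forall>x\<in>{0..1}. \<bar>f x\<bar> \<le> M1" "\<forall>x\<in>{0..1}. \<bar>g x\<bar> \<le> M2"
    unfolding bounded_iff by auto
  then show ?thesis
    by (intro abs_cont_on_mult[OF f g, of "max M1 M2"]) (force simp: le_max_iff_disj)+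
qed

text \<open>The gauge is chosen as in the classical proof at points of differentiability; tags in the
  exceptional null set are confined to an open set of small measure, where absolute continuity
  makes the increments of \<open>f\<close> negligible.\<close>

lemma has_integral_abs_cont_on:
  fixes f g :: "real \<Rightarrow> real"
  assumes ac: "abs_cont_on {a..b} f" and ab: "a \<le> b" and N: "negligible N"
    and der: "\<And>x. x \<in> {a..b} - N \<Longrightarrow> (f has_real_derivative g x) (at x within {a..b})"
  shows "(g has_integral f b - f a) {a..b}"
proof -
  \<comment> \<open>With value 0 on \<open>N\<close>, a tag in \<open>N\<close> contributes just an
    increment of \<open>f\<close>, however wild \<open>g\<close> is there.
    \<open>has_integral_spike\<close> returns to \<open>g\<close> at the end.\<close>
  define g0 where "g0 x = (if x \<in> N then 0 else g x)" for x
  have "(g0 has_integral f b - f a) {a..b}"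
    unfolding has_integral_real
  proof (intro allI impI)
    fix e :: real assume e: "0 < e"
    define e1 where "e1 = e / (2 * (b - a + 1))"
    have e1: "0 < e1" "e1 * (b - a) < e / 2"
      using e ab by (auto simp: e1_def field_simps)
    have e2: "0 < e / 2" using e by simp
    obtain d where d: "d > 0" and ac': "\<And>(n::nat) l r.
       (\<forall>i<n. l i \<le> r i \<and> {l i..r i} \<subseteq> {a..b}) \<and>
       disjoint_family_on (\<lambda>i. {l i<..<r i}) {..<n} \<and> (\<Sum>i<n. r i - l i) < d
       \<Longrightarrow> (\<Sum>i<n. \<bar>f (r i) - f (l i)\<bar>) < e / 2"
      using ac e2 unfolding abs_cont_on_def by blast
    have N0: "N \<in> null_sets lebesgue" using N by (simp add: negligible_iff_null_sets)
    obtain U where U: "open U" "N \<subseteq> U" "U - N \<in> lmeasurable" "emeasure lebesgue (U - N) < ennreal d"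
      using sets_lebesgue_outer_open[of N d] N0 d by auto
    have Um: "U \<in> lmeasurable" "measure lebesgue U < d"
    proof -
      have "emeasure lebesgue U = emeasure lebesgue (U - N)"
        using N0 U by (simp add: emeasure_Diff_null_set)
      then have *: "emeasure lebesgue U < ennreal d" using U by simp
      then show "U \<in> lmeasurable"
        using U by (intro fmeasurableI) (auto simp: less_top[symmetric] intro: less_trans)
      then show "measure lebesgue U < d"
        using * d by (simp add: emeasure_eq_measure2 ennreal_less_iff)
    qed
    have "\<forall>x. \<exists>r>0. x \<in> {a..b} - N \<longrightarrow>
        (\<forall>y\<in>{a..b}. \<bar>y - x\<bar> < r \<longrightarrow> \<bar>f y - f x - g x * (y - x)\<bar> \<le> e1 * \<bar>y - x\<bar>)"
    proof
      fix x
      show "\<exists>r>0. x \<in> {a..b} - N \<longrightarrow>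
          (\<forall>y\<in>{a..b}. \<bar>y - x\<bar> < r \<longrightarrow> \<bar>f y - f x - g x * (y - x)\<bar> \<le> e1 * \<bar>y - x\<bar>)"
      proof (cases "x \<in> {a..b} - N")
        case True
        from der[OF this] e1(1) show ?thesis
          unfolding has_field_derivative_def has_derivative_within_alt real_norm_def by metis
      qed (auto intro: exI[of _ 1])
    qed
    then obtain r where r: "\<And>x. r x > 0" and r': "\<And>x y. x \<in> {a..b} - N \<Longrightarrow> y \<in> {a..b} \<Longrightarrow>
        \<bar>y - x\<bar> < r x \<Longrightarrow> \<bar>f y - f x - g x * (y - x)\<bar> \<le> e1 * \<bar>y - x\<bar>"
      by metis
    define \<gamma> where "\<gamma> x = (if x \<in> N then U else ball x (r x))" for x
    show "\<exists>\<gamma>. gauge \<gamma> \<and> (\<forall>p. p tagged_division_of {a..b} \<and> \<gamma> fine p \<longrightarrow>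
        norm ((\<Sum>(x, k)\<in>p. measure lborel k *\<^sub>R g0 x) - (f b - f a)) < e)"
    proof (intro exI conjI allI impI)
      show "gauge \<gamma>" using U r by (auto simp: gauge_def \<gamma>_def)
      fix p assume p: "p tagged_division_of {a..b} \<and> \<gamma> fine p"
      then have p1: "p tagged_division_of {a..b}" and fine: "\<gamma> fine p" by auto
      note pD = tagged_division_ofD[OF p1]
      have K: "\<exists>u v. K = {u..v} \<and> u \<le> v \<and> u \<le> x \<and> x \<le> v \<and> a \<le> u \<and> v \<le> b" if xK: "(x, K) \<in> p" for x K
      proof -
        obtain u v where "K = {u..v}" using pD(4)[OF xK] by auto
        then show ?thesis using pD(2,3)[OF xK] by force
      qed
      define q where "q = {(x, K) \<in> p. x \<in> N}"
      have fin: "finite p" "finite q" "q \<subseteq> p" using pD(1) by (auto simp: q_def intro: finite_subset)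
      define T where "T = (\<lambda>(x::real, K). measure lborel K *\<^sub>R g0 x - (f (Sup K) - f (Inf K)))"
      \<comment> \<open>Straddle lemma: the increment over an interval is split at its tag, so that
        the two one-sided errors add up to at most \<open>e1\<close> times the length.\<close>
      have good: "\<bar>T z\<bar> \<le> e1 * measure lborel (snd z)" if z: "z \<in> p - q" for z
      proof -
        obtain x K where z_eq: "z = (x, K)" by (cases z)
        then have xK: "(x, K) \<in> p" "x \<notin> N" using z by (auto simp: q_def)
        obtain u v where uv: "K = {u..v}" "u \<le> v" "u \<le> x" "x \<le> v" "a \<le> u" "v \<le> b"
          using K[OF xK(1)] by auto
        have "K \<subseteq> ball x (r x)" using fineD[OF fine xK(1)] xK by (auto simp: \<gamma>_def)
        then have "\<bar>u - x\<bar> < r x" "\<bar>v - x\<bar> < r x"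
          using uv(1,2) by (simp_all add: subset_iff dist_real_def abs_minus_commute)
        then have "\<bar>f u - f x - g x * (u - x)\<bar> \<le> e1 * \<bar>u - x\<bar>"
            "\<bar>f v - f x - g x * (v - x)\<bar> \<le> e1 * \<bar>v - x\<bar>"
          using r'[of x u] r'[of x v] uv xK by auto
        then have "\<bar>f u - f x - g x * (u - x)\<bar> \<le> e1 * (x - u)"
            "\<bar>f v - f x - g x * (v - x)\<bar> \<le> e1 * (v - x)" using uv by auto
        moreover have "T z = (f u - f x - g x * (u - x)) - (f v - f x - g x * (v - x))"
          using uv xK by (simp add: T_def z_eq g0_def algebra_simps)
        ultimately have "\<bar>T z\<bar> \<le> e1 * (x - u) + e1 * (v - x)" by linarith
        then show ?thesis using uv by (simp add: z_eq algebra_simps)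
      qed
      have "(\<Sum>z\<in>p - q. \<bar>T z\<bar>) \<le> (\<Sum>z\<in>p - q. e1 * measure lborel (snd z))"
        by (rule sum_mono[OF good])
      also have "\<dots> \<le> (\<Sum>z\<in>p. e1 * measure lborel (snd z))"
        using e1 fin by (intro sum_mono2) auto
      also have "\<dots> = e1 * (\<Sum>(x, K)\<in>p. measure lborel K)"
        by (simp add: sum_distrib_left split_def)
      also have "\<dots> = e1 * (b - a)"
        using additive_content_tagged_division[of p a b] p1 ab by simp
      finally have sum1: "(\<Sum>z\<in>p - q. \<bar>T z\<bar>) < e / 2" using e1 by linarith
      \<comment> \<open>Absolute continuity is stated for families indexed by an initial segment of
        the naturals, so the intervals with tags in \<open>N\<close> are enumerated. They may share
        endpoints, which the open intervals in the definition ignore.\<close>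
      obtain z where z: "bij_betw z {0..<card q} q" using ex_bij_betw_nat_finite[OF fin(2)] by auto
      define n where "n = card q"
      define l where "l i = Inf (snd (z i))" for i
      define w where "w i = Sup (snd (z i))" for i
      have zq: "z i \<in> q" if "i < n" for i using z that by (auto simp: bij_betw_def n_def)
      have lw: "snd (z i) = {l i..w i} \<and> l i \<le> w i \<and> {l i..w i} \<subseteq> {a..b} \<and> {l i..w i} \<subseteq> U"
        if i: "i < n" for i
      proof -
        obtain x K where zi: "z i = (x, K)" by (cases "z i")
        have xK: "(x, K) \<in> p" "x \<in> N" using zq[OF i] zi by (auto simp: q_def)
        obtain u v where uv: "K = {u..v}" "u \<le> v" "a \<le> u" "v \<le> b" using K[OF xK(1)] by auto
        have "K \<subseteq> U" using fineD[OF fine xK(1)] xK by (auto simp: \<gamma>_def)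
        then show ?thesis using uv by (auto simp: l_def w_def zi)
      qed
      have disj: "disjoint_family_on (\<lambda>i. {l i<..<w i}) {..<n}"
        unfolding disjoint_family_on_def
      proof (intro ballI impI)
        fix i j assume ij: "i \<in> {..<n}" "j \<in> {..<n}" "i \<noteq> j"
        then have ne: "z i \<noteq> z j"
          using z by (auto simp: bij_betw_def inj_on_def n_def)
        obtain x K x' K' where zz: "z i = (x, K)" "z j = (x', K')" by (cases "z i", cases "z j")
        have "(x, K) \<in> p" "(x', K') \<in> p" using zq[of i] zq[of j] ij zz by (auto simp: q_def)
        then have "interior K \<inter> interior K' = {}" using pD(5) ne zz by auto
        moreover have "K = {l i..w i}" "K' = {l j..w j}" using lw[of i] lw[of j] ij zz by auto
        ultimately show "{l i<..<w i} \<inter> {l j<..<w j} = {}" by (simp add: interior_atLeastAtMost_real)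
      qed
      have "(\<Sum>i<n. w i - l i) = (\<Sum>i<n. measure lebesgue {l i<..<w i})"
        by (rule sum.cong) (use lw in auto)
      also have "\<dots> = measure lebesgue (\<Union>i<n. {l i<..<w i})"
      proof (rule measure_finite_Union[symmetric])
        show "emeasure lebesgue {l i<..<w i} \<noteq> \<infinity>" for i by (cases "l i \<le> w i") auto
      qed (use disj in auto)
      also have "\<dots> \<le> measure lebesgue U"
      proof (rule measure_mono_fmeasurable)
        show "(\<Union>i<n. {l i<..<w i}) \<subseteq> U" using lw by fastforce
      qed (use Um in auto)
      finally have small: "(\<Sum>i<n. w i - l i) < d" using Um by simp
      have "(\<Sum>t\<in>q. \<bar>T t\<bar>) = (\<Sum>i<n. \<bar>T (z i)\<bar>)"
        using sum.reindex_bij_betw[OF z, of "\<lambda>t. \<bar>T t\<bar>"] by (simp add: n_def lessThan_atLeast0)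
      also have "\<dots> = (\<Sum>i<n. \<bar>f (w i) - f (l i)\<bar>)"
      proof (rule sum.cong)
        fix i assume "i \<in> {..<n}"
        then have "z i \<in> q" using zq by auto
        then show "\<bar>T (z i)\<bar> = \<bar>f (w i) - f (l i)\<bar>"
          by (auto simp: T_def q_def l_def w_def g0_def split: prod.splits)
      qed simp
      also have "\<dots> < e / 2" using ac'[of n l w] lw disj small by auto
      finally have sum2: "(\<Sum>z\<in>q. \<bar>T z\<bar>) < e / 2" .
      have "(\<Sum>(x, k)\<in>p. measure lborel k *\<^sub>R g0 x) - (f b - f a) = (\<Sum>z\<in>p. T z)"
        using additive_tagged_division_1[OF ab p1, of f]
        by (simp add: T_def split_def sum_subtractf)
      also have "\<bar>\<dots>\<bar> \<le> (\<Sum>z\<in>p. \<bar>T z\<bar>)" by (rule sum_abs)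
      also have "\<dots> = (\<Sum>z\<in>p - q. \<bar>T z\<bar>) + (\<Sum>z\<in>q. \<bar>T z\<bar>)"
        using fin by (simp add: sum.subset_diff)
      finally show "norm ((\<Sum>(x, k)\<in>p. measure lborel k *\<^sub>R g0 x) - (f b - f a)) < e"
        using sum1 sum2 by (simp add: real_norm_def)
    qed
  qed
  then show ?thesis
    by (rule has_integral_spike[OF N, rotated]) (auto simp: g0_def)
qed

subsection \<open>Differentiation of indefinite integrals\<close>

text \<open>Henstock's lemma bounds the total length of disjoint intervals on which the difference
  quotient misses \<open>f\<close> by \<open>e\<close>, and these intervals form a Vitali cover of the exceptional set.\<close>

lemma negligible_integral_deviation:
  fixes f :: "real \<Rightarrow> real"
  assumes f: "f integrable_on {a..b}" and e: "0 < e"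
  defines "F \<equiv> \<lambda>x. integral {a..x} f"
  shows "negligible {x \<in> {a<..<b}. \<forall>d>0. \<exists>y\<in>{a..b}. y \<noteq> x \<and> \<bar>y - x\<bar> < d \<and>
    e * \<bar>y - x\<bar> < \<bar>F y - F x - f x * (y - x)\<bar>}" (is "negligible ?E")
  unfolding negligible_outer
proof (intro allI impI)
  fix \<epsilon> :: real assume \<epsilon>: "0 < \<epsilon>"
  have eps': "0 < e * (\<epsilon> / 2)" using e \<epsilon> by simp
  have f': "f integrable_on cbox a b" using f by simp
  obtain \<gamma> where \<gamma>: "gauge \<gamma>" and H: "\<And>p. \<lbrakk>p tagged_partial_division_of cbox a b; \<gamma> fine p\<rbrakk> \<Longrightarrow>
      (\<Sum>(x, k)\<in>p. norm (measure lborel k *\<^sub>R f x - integral k f)) < e * (\<epsilon> / 2)"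
    by (rule Henstock_lemma[OF f' eps'], rule that)
  \<comment> \<open>A pair of a point and a nearby \<open>y\<close> witnessing the deviation stands
    for the interval between them. Centre and radius give it the form of a closed ball required by
    the Vitali covering theorem, while the first component survives as the tag.\<close>
  define I where "I = (\<lambda>(x::real, y). {min x y..max x y})"
  define c where "c = (\<lambda>(x::real, y). (x + y) / 2)"
  define r where "r = (\<lambda>(x::real, y). \<bar>y - x\<bar> / 2)"
  have I_cball: "I i = cball (c i) (r i)" for i
    by (cases i) (auto simp: I_def c_def r_def cball_eq_atLeastAtMost min_def max_def field_simps)
  define K where "K = {(x, y). x \<in> ?E \<and> y \<in> {a..b} \<and> y \<noteq> x \<and> I (x, y) \<subseteq> \<gamma> x \<and>
    e * \<bar>y - x\<bar> < \<bar>F y - F x - f x * (y - x)\<bar>}"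
  obtain C where C: "countable C" "C \<subseteq> K"
    "pairwise (\<lambda>i j. disjnt (cball (c i) (r i)) (cball (c j) (r j))) C"
    "negligible (?E - (\<Union>i\<in>C. cball (c i) (r i)))"
  proof (rule Vitali_covering_theorem_cballs[of K r ?E c])
    show "0 < r i" if "i \<in> K" for i using that by (auto simp: K_def r_def)
    fix x d :: real assume x: "x \<in> ?E" and d: "0 < d"
    have "open (\<gamma> x)" "x \<in> \<gamma> x" using \<gamma> by (auto simp: gauge_def)
    then obtain s where s: "s > 0" "ball x s \<subseteq> \<gamma> x" unfolding open_contains_ball by blast
    obtain y where y: "y \<in> {a..b}" "y \<noteq> x" "\<bar>y - x\<bar> < min s d"
        "e * \<bar>y - x\<bar> < \<bar>F y - F x - f x * (y - x)\<bar>"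
    proof -
      have "0 < min s d" using s(1) d by simp
      then show ?thesis using x that by blast
    qed
    have "I (x, y) \<subseteq> ball x s" using y by (auto simp: I_def dist_real_def)
    then have "(x, y) \<in> K" using x y s by (auto simp: K_def)
    moreover have "x \<in> cball (c (x, y)) (r (x, y))"
      unfolding I_cball[symmetric] by (auto simp: I_def)
    moreover have "r (x, y) < d" using y by (auto simp: r_def)
    ultimately show "\<exists>i. i \<in> K \<and> x \<in> cball (c i) (r i) \<and> r i < d" by blast
  qed
  have bnd: "measure lebesgue (\<Union>i\<in>J. I i) \<le> \<epsilon> / 2" if J: "J \<subseteq> C" "finite J" for J
  proof -
    define p where "p = (\<lambda>i. (fst i, I i)) ` J"
    have JK: "J \<subseteq> K" using J C by auto
    have inj: "inj_on (\<lambda>i. (fst i, I i)) J"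
    proof (rule inj_onI)
      fix i j assume ij: "i \<in> J" "j \<in> J" "(fst i, I i) = (fst j, I j)"
      show "i = j"
      proof (rule ccontr)
        assume "i \<noteq> j"
        then have "disjnt (I i) (I j)" using pairwiseD[OF C(3), of i j] ij(1,2) J(1) unfolding I_cball by blast
        moreover have "I i \<noteq> {}" by (cases i) (auto simp: I_def)
        ultimately show False using ij by (auto simp: disjnt_def)
      qed
    qed
    have p: "p tagged_partial_division_of cbox a b"
      unfolding tagged_partial_division_of_def
    proof (intro conjI allI impI)
      show "finite p" using J by (simp add: p_def)
      fix x k assume "(x, k) \<in> p"
      then obtain y where y: "(x, y) \<in> K" "k = I (x, y)" using JK by (force simp: p_def)
      then show "x \<in> k" "k \<subseteq> cbox a b" "\<exists>u v. k = cbox u v"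
        by (auto simp: K_def I_def)
    next
      fix x k x' k' assume "(x, k) \<in> p \<and> (x', k') \<in> p \<and> (x, k) \<noteq> (x', k')"
      then obtain i j where "i \<in> J" "j \<in> J" "i \<noteq> j" "k = I i" "k' = I j"
        by (auto simp: p_def)
      then have "disjnt k k'" using pairwiseD[OF C(3), of i j] J(1) unfolding I_cball by blast
      then show "interior k \<inter> interior k' = {}"
        using interior_subset[of k] interior_subset[of k'] by (auto simp: disjnt_def)
    qed
    have fine: "\<gamma> fine p"
      using JK by (force simp: fine_def p_def K_def)
    have "e * measure lebesgue (\<Union>i\<in>J. I i) \<le> e * (\<Sum>i\<in>J. measure lebesgue (I i))"
      using e J by (intro mult_left_mono measure_UNION_le) (auto simp: I_cball)
    also have "\<dots> \<le> (\<Sum>i\<in>J. norm (measure lborel (I i) *\<^sub>R f (fst i) - integral (I i) f))"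
      unfolding sum_distrib_left
    proof (rule sum_mono)
      fix i assume i: "i \<in> J"
      obtain x y where i_eq: "i = (x, y)" by (cases i)
      have K': "x \<in> {a<..<b}" "y \<in> {a..b}" "y \<noteq> x"
          "e * \<bar>y - x\<bar> < \<bar>F y - F x - f x * (y - x)\<bar>"
        using i JK i_eq by (auto simp: K_def)
      have comb: "F v - F u = integral {u..v} f" if "a \<le> u" "u \<le> v" "v \<le> b" for u v
      proof -
        have "f integrable_on {a..v}"
          by (rule integrable_on_subinterval[OF f]) (use that in auto)
        from Henstock_Kurzweil_Integration.integral_combine[OF that(1,2) this]
        show ?thesis by (simp add: F_def)
      qed
      have "\<bar>F y - F x - f x * (y - x)\<bar> = \<bar>measure lborel (I i) * f x - integral (I i) f\<bar>"
      proof (cases "x \<le> y")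
        case True
        then show ?thesis using comb[of x y] K' by (simp add: i_eq I_def algebra_simps abs_minus_commute)
      next
        case False
        then show ?thesis using comb[of y x] K'
          by (simp add: i_eq I_def min_def max_def) (simp add: algebra_simps abs_minus_commute)
      qed
      moreover have "measure lebesgue (I i) = \<bar>y - x\<bar>"
        by (simp add: i_eq I_def min_def max_def)
      ultimately show "e * measure lebesgue (I i) \<le> norm (measure lborel (I i) *\<^sub>R f (fst i) - integral (I i) f)"
        using K' by (simp add: i_eq)
    qed
    also have "\<dots> = (\<Sum>(x, k)\<in>p. norm (measure lborel k *\<^sub>R f x - integral k f))"
      unfolding p_def by (simp add: sum.reindex[OF inj] split_def)
    also have "\<dots> < e * (\<epsilon> / 2)" by (rule H[OF p fine])
    finally show ?thesis using e by simp
  qed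
  have U: "(\<Union>i\<in>C. I i) \<in> lmeasurable" "measure lebesgue (\<Union>i\<in>C. I i) \<le> \<epsilon> / 2"
    using fmeasurable_UN_bound[of C I lebesgue "\<epsilon> / 2"] measure_UN_bound[of C I lebesgue "\<epsilon> / 2"] C(1) bnd
    by (auto simp: I_cball)
  have N: "?E - (\<Union>i\<in>C. I i) \<in> lmeasurable" "measure lebesgue (?E - (\<Union>i\<in>C. I i)) = 0"
    using C(4) unfolding I_cball[symmetric] negligible_iff_measure by auto
  show "\<exists>T. ?E \<subseteq> T \<and> T \<in> lmeasurable \<and> measure lebesgue T < \<epsilon>"
  proof (intro exI conjI)
    show "?E \<subseteq> (?E - (\<Union>i\<in>C. I i)) \<union> (\<Union>i\<in>C. I i)" by blast
    show "(?E - (\<Union>i\<in>C. I i)) \<union> (\<Union>i\<in>C. I i) \<in> lmeasurable"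
      by (rule fmeasurable.Un[OF N(1) U(1)])
    have "measure lebesgue ((?E - (\<Union>i\<in>C. I i)) \<union> (\<Union>i\<in>C. I i))
        \<le> measure lebesgue (?E - (\<Union>i\<in>C. I i)) + measure lebesgue (\<Union>i\<in>C. I i)"
      by (rule measure_Un_le) (use N(1) U(1) in \<open>simp_all only: fmeasurableD\<close>)
    then show "measure lebesgue ((?E - (\<Union>i\<in>C. I i)) \<union> (\<Union>i\<in>C. I i)) < \<epsilon>"
      using N(2) U(2) \<epsilon> by linarith
  qed
qed

text \<open>If the derivative at \<open>x\<close> is not \<open>f x\<close>, then difference
  quotients arbitrarily close to \<open>x\<close> miss \<open>f x\<close> by more than some
  \<open>1 / Suc n\<close>. Countably many of the preceding null sets therefore cover the
  exceptional set.\<close>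

lemma negligible_not_derivative_integral:
  fixes f :: "real \<Rightarrow> real"
  assumes f: "f integrable_on {a..b}"
  shows "negligible {x \<in> {a<..<b}. \<not> ((\<lambda>x. integral {a..x} f) has_real_derivative f x) (at x)}"
proof -
  define F where "F x = integral {a..x} f" for x
  define E where "E e = {x \<in> {a<..<b}. \<forall>d>0. \<exists>y\<in>{a..b}. y \<noteq> x \<and> \<bar>y - x\<bar> < d \<and>
    e * \<bar>y - x\<bar> < \<bar>F y - F x - f x * (y - x)\<bar>}" for e :: real
  have "negligible (\<Union>n. E (1 / Suc n))"
  proof (rule negligible_countable_Union)
    show "negligible T" if T: "T \<in> range (\<lambda>n. E (1 / real (Suc n)))" for T
    proof -
      obtain n where "T = E (1 / real (Suc n))" using T by blast
      then show ?thesis using negligible_integral_deviation[OF f, of "1 / real (Suc n)"]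
        by (simp only: E_def F_def of_nat_0_less_iff zero_less_Suc zero_less_divide_1_iff)
    qed
  qed simp
  then show ?thesis
  proof (rule negligible_subset, intro subsetI)
    fix x assume "x \<in> {x \<in> {a<..<b}. \<not> ((\<lambda>x. integral {a..x} f) has_real_derivative f x) (at x)}"
    then have x: "x \<in> {a<..<b}" and nd: "\<not> (F has_real_derivative f x) (at x)"
      by (auto simp: F_def[abs_def])
    show "x \<in> (\<Union>n. E (1 / Suc n))"
    proof (rule ccontr)
      assume no: "x \<notin> (\<Union>n. E (1 / Suc n))"
      have "(F has_real_derivative f x) (at x within {a..b})"
        unfolding has_field_derivative_def has_derivative_within_alt
      proof (intro conjI allI impI)
        show "bounded_linear ((*) (f x))" by (rule bounded_linear_mult_right)
        fix e :: real assume "0 < e"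
        then obtain n :: nat where n: "1 / Suc n < e" using nat_approx_posE by blast
        have "x \<notin> E (1 / Suc n)" using no by blast
        then obtain d where d: "d > 0" "\<And>y. y \<in> {a..b} \<Longrightarrow> y \<noteq> x \<Longrightarrow> \<bar>y - x\<bar> < d \<Longrightarrow>
            \<bar>F y - F x - f x * (y - x)\<bar> \<le> 1 / Suc n * \<bar>y - x\<bar>"
          using x unfolding E_def by fastforce
        show "\<exists>d>0. \<forall>y\<in>{a..b}. norm (y - x) < d \<longrightarrow>
            norm (F y - F x - f x * (y - x)) \<le> e * norm (y - x)"
        proof (intro exI[of _ d] conjI d ballI impI)
          fix y assume y: "y \<in> {a..b}" "norm (y - x) < d"
          have "\<bar>F y - F x - f x * (y - x)\<bar> \<le> 1 / Suc n * \<bar>y - x\<bar>"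
            using d(2)[of y] y by (cases "y = x") auto
          also have "\<dots> \<le> e * \<bar>y - x\<bar>" using n by (intro mult_right_mono) auto
          finally show "norm (F y - F x - f x * (y - x)) \<le> e * norm (y - x)" by simp
        qed
      qed
      then have "(F has_real_derivative f x) (at x within {a<..<b})"
        by (rule DERIV_subset) auto
      then show False using nd x at_within_open[of x "{a<..<b}"] by simp
    qed
  qed
qed

text \<open>The passage from the Lebesgue integral over the open interval, on which
  \<open>L2\<close> is built, to the gauge integral over the closed one, for which the fundamental
  theorem of calculus was just proved.\<close>

lemma unit_leb_integral:
  fixes f :: "real \<Rightarrow> real"
  assumes "integrable unit_leb f"
  shows "f absolutely_integrable_on {0..1}" "integral\<^sup>L unit_leb f = integral {0..1} f"
proof -
  have "f absolutely_integrable_on {0<..<1}"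
    using assms by (simp add: integrable_restrict_space set_integrable_def)
  then show "f absolutely_integrable_on {0..1}"
    using absolutely_integrable_on_open_interval[where f = f and a = "0::real" and b = 1] by simp
  show "integral\<^sup>L unit_leb f = integral {0..1} f"
    using lebesgue_integral_eq_integral[OF assms] by (simp add: integral_open_interval_real)
qed

lemma sq_integrable_HK:
  assumes "sq_integrable f"
  shows "f absolutely_integrable_on {0..1}" "(\<lambda>x. (f x)\<^sup>2) absolutely_integrable_on {0..1}"
proof -
  have "integrable unit_leb (\<lambda>x. f x * 1)"
    by (rule sq_integrable_mult[OF assms sq_integrable_const])
  then show "f absolutely_integrable_on {0..1}" using unit_leb_integral by simp
  show "(\<lambda>x. (f x)\<^sup>2) absolutely_integrable_on {0..1}"
    by (rule unit_leb_integral[OF sq_integrableD(2)[OF assms]])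
qed

lemma inner_abs_L2:
  assumes "sq_integrable f" "sq_integrable g"
  shows "inner (abs_L2 f) (abs_L2 g) = integral {0..1} (\<lambda>x. f x * g x)"
    and "(\<lambda>x. f x * g x) integrable_on {0..1}"
  using assms unit_leb_integral[OF sq_integrable_mult[OF assms]]
  by (auto simp: inner_L2.abs_eq absolutely_integrable_on_def)

text \<open>The closed intervals may share endpoints, so the open ones are used: their indicators
  sum to an indicator, and the integrals do not see the difference.\<close>

lemma sum_integral_disjoint_le:
  fixes h :: "real \<Rightarrow> real" and a b :: "nat \<Rightarrow> real"
  assumes h: "h integrable_on {0..1}" and pos: "\<And>x. 0 \<le> h x"
    and ab: "\<And>i. i < n \<Longrightarrow> {a i..b i} \<subseteq> {0..1}"
    and disj: "disjoint_family_on (\<lambda>i. {a i<..<b i}) {..<n}"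
  shows "(\<Sum>i<n. integral {a i..b i} h) \<le> integral {0..1} h"
proof -
  have I: "(\<lambda>x. if x \<in> {a i<..<b i} then h x else 0) integrable_on {0..1}"
    "integral {a i..b i} h = integral {0..1} (\<lambda>x. if x \<in> {a i<..<b i} then h x else 0)"
    if i: "i < n" for i
  proof -
    have sub: "{a i<..<b i} \<subseteq> {0..1}" using ab[OF i] by auto
    have "h integrable_on {a i..b i}" by (rule integrable_on_subinterval[OF h ab[OF i]])
    then have "h integrable_on {a i<..<b i}" by (simp add: integrable_on_open_interval_real)
    then show "(\<lambda>x. if x \<in> {a i<..<b i} then h x else 0) integrable_on {0..1}"
      using sub integrable_restrict_Int[of "{a i<..<b i}" h "{0..1}"] by (simp only: Int_absorb2)
    show "integral {a i..b i} h = integral {0..1} (\<lambda>x. if x \<in> {a i<..<b i} then h x else 0)"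
      using sub Henstock_Kurzweil_Integration.integral_restrict_Int[of "{0..1}" "{a i<..<b i}" h]
      by (simp only: Int_absorb2 integral_open_interval_real)
  qed
  have "(\<Sum>i<n. integral {a i..b i} h)
      = (\<Sum>i<n. integral {0..1} (\<lambda>x. if x \<in> {a i<..<b i} then h x else 0))"
    using I(2) by (intro sum.cong) auto
  also have "\<dots> = integral {0..1} (\<lambda>x. \<Sum>i<n. if x \<in> {a i<..<b i} then h x else 0)"
    by (rule integral_sum[symmetric]) (use I in auto)
  also have "\<dots> \<le> integral {0..1} h"
  proof (rule integral_le)
    show "(\<lambda>x. \<Sum>i<n. if x \<in> {a i<..<b i} then h x else 0) integrable_on {0..1}"
      by (rule integrable_sum) (use I in auto)
    fix x :: real
    have "(\<Sum>i<n. if x \<in> {a i<..<b i} then h x else 0)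
        = (\<Sum>i<n. indicator {a i<..<b i} x) * h x"
      unfolding sum_distrib_right by (intro sum.cong) (auto simp: indicator_def)
    also have "\<dots> = indicator (\<Union>i<n. {a i<..<b i}) x * h x"
      by (subst indicator_UN_disjoint[OF _ disj]) simp_all
    also have "\<dots> \<le> h x" using pos[of x] by (auto simp: indicator_def)
    finally show "(\<Sum>i<n. if x \<in> {a i<..<b i} then h x else 0) \<le> h x" .
  qed (rule h)
  finally show ?thesis .
qed

text \<open>Young's inequality bounds \<open>\<bar>f t\<bar>\<close> by
  \<open>s * (f t)\<^sup>2 + 1 / (4 * s)\<close>. The first part sums to at most \<open>s\<close>
  times the squared norm, whatever the family of intervals, so \<open>s\<close> can be fixed before
  the total length is made small.\<close>

lemma abs_cont_on_integral:
  assumes f: "sq_integrable f"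
  shows "abs_cont_on {0..1} (\<lambda>x. integral {0..x} f)"
  unfolding abs_cont_on_def
proof (intro allI impI)
  fix e :: real assume e: "0 < e"
  define G where "G = integral {0..1} (\<lambda>x. (f x)\<^sup>2)"
  have G: "0 \<le> G" unfolding G_def by (rule integral_nonneg)
      (use sq_integrable_HK[OF f] in \<open>auto simp: absolutely_integrable_on_def\<close>)
  define s where "s = e / (2 * (G + 1))"
  have s: "0 < s" "s * G < e / 2"
    using e G by (auto simp: s_def divide_simps)
  have f1: "f integrable_on {0..1}" and f2: "(\<lambda>x. (f x)\<^sup>2) integrable_on {0..1}"
    using sq_integrable_HK[OF f] by (auto simp: absolutely_integrable_on_def)
  have fa: "(\<lambda>x. \<bar>f x\<bar>) integrable_on {0..1}"
    using sq_integrable_HK(1)[OF f] by (auto simp: absolutely_integrable_on_def)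
  have le: "\<bar>integral {0..y} f - integral {0..x} f\<bar>
      \<le> s * integral {x..y} (\<lambda>x. (f x)\<^sup>2) + (y - x) / (4 * s)"
    if xy: "x \<le> y" "{x..y} \<subseteq> {0..1}" for x y
  proof -
    have sub: "{0..y} \<subseteq> {0..1}" "0 \<le> x" using xy by auto
    note sub_int = integrable_on_subinterval[OF _ xy(2)]
    have "integral {0..x} f + integral {x..y} f = integral {0..y} f"
      by (rule Henstock_Kurzweil_Integration.integral_combine)
        (use xy sub integrable_on_subinterval[OF f1 sub(1)] in auto)
    then have "\<bar>integral {0..y} f - integral {0..x} f\<bar> = norm (integral {x..y} f)" by simp
    also have "\<dots> \<le> integral {x..y} (\<lambda>t. s * (f t)\<^sup>2 + 1 / (4 * s))"
    proof (rule integral_norm_bound_integral)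
      show "f integrable_on {x..y}" by (rule sub_int[OF f1])
      show "(\<lambda>t. s * (f t)\<^sup>2 + 1 / (4 * s)) integrable_on {x..y}"
        by (intro integrable_add integrable_on_mult_right sub_int[OF f2] integrable_const_ivl)
      fix t
      have "0 \<le> (2 * s * \<bar>f t\<bar> - 1)\<^sup>2" by simp
      then have "4 * s * \<bar>f t\<bar> \<le> 4 * s * (s * (f t)\<^sup>2) + 1"
        by (simp add: power2_diff power_mult_distrib) (simp add: power2_eq_square algebra_simps)
      then show "norm (f t) \<le> s * (f t)\<^sup>2 + 1 / (4 * s)"
        using s by (simp add: field_simps)
    qed
    also have "\<dots> = s * integral {x..y} (\<lambda>x. (f x)\<^sup>2) + (y - x) / (4 * s)"
      using sub_int[OF f2] xy
      by (subst Henstock_Kurzweil_Integration.integral_add) (auto intro: integrable_on_mult_right)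
    finally show ?thesis .
  qed
  show "\<exists>\<delta>>0. \<forall>(n::nat) a b.
     (\<forall>i<n. a i \<le> b i \<and> {a i..b i} \<subseteq> {0..1}) \<and>
     disjoint_family_on (\<lambda>i. {a i<..<b i}) {..<n} \<and> (\<Sum>i<n. b i - a i) < \<delta>
     \<longrightarrow> (\<Sum>i<n. \<bar>integral {0..b i} f - integral {0..a i} f\<bar>) < e"
  \<comment> \<open>This length turns the second part of Young's inequality into
    \<open>e / 2\<close>; the choice of \<open>s\<close> keeps the first part strictly below
    \<open>e / 2\<close>.\<close>
  proof (intro exI[of _ "2 * s * e"] conjI allI impI)
    show "0 < 2 * s * e" using s e by simp
    fix n :: nat and a b :: "nat \<Rightarrow> real"
    assume *: "(\<forall>i<n. a i \<le> b i \<and> {a i..b i} \<subseteq> {0..1}) \<and>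
     disjoint_family_on (\<lambda>i. {a i<..<b i}) {..<n} \<and> (\<Sum>i<n. b i - a i) < 2 * s * e"
    have "(\<Sum>i<n. \<bar>integral {0..b i} f - integral {0..a i} f\<bar>)
        \<le> (\<Sum>i<n. s * integral {a i..b i} (\<lambda>x. (f x)\<^sup>2) + (b i - a i) / (4 * s))"
      by (rule sum_mono, rule le) (use * in auto)
    also have "\<dots> = s * (\<Sum>i<n. integral {a i..b i} (\<lambda>x. (f x)\<^sup>2)) + (\<Sum>i<n. b i - a i) / (4 * s)"
      by (simp add: sum.distrib sum_distrib_left sum_divide_distrib)
    also have "\<dots> \<le> s * G + 2 * s * e / (4 * s)"
      unfolding G_def using sum_integral_disjoint_le[OF f2, of n a b] * s
      by (intro add_mono mult_left_mono divide_right_mono) auto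
    also have "\<dots> < e" using s by (simp add: field_simps)
    finally show "(\<Sum>i<n. \<bar>integral {0..b i} f - integral {0..a i} f\<bar>) < e" .
  qed
qed

text \<open>Lebesgue measure is complete, so the exceptional set itself is measurable for arbitrary
  \<open>P\<close>, and the two notions of null set can be interchanged.\<close>

lemma AE_unit_leb_iff_negligible:
  "(AE x in unit_leb. P x) \<longleftrightarrow> negligible {x \<in> {0<..<1}. \<not> P x}"
proof -
  have "(AE x in unit_leb. P x) \<longleftrightarrow> (AE x in lebesgue. x \<in> {0<..<1} \<longrightarrow> P x)"
    by (subst AE_restrict_space_iff) auto
  also have "\<dots> \<longleftrightarrow> {x. \<not> (x \<in> {0<..<1} \<longrightarrow> P x)} \<in> null_sets lebesgue"
  proof
    assume "AE x in lebesgue. x \<in> {0<..<1} \<longrightarrow> P x"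
    then obtain N where N: "N \<in> null_sets lebesgue" "{x. \<not> (x \<in> {0<..<1} \<longrightarrow> P x)} \<subseteq> N"
      by (auto simp: eventually_ae_filter)
    then have "negligible {x. \<not> (x \<in> {0<..<1} \<longrightarrow> P x)}"
      by (meson negligible_iff_null_sets negligible_subset)
    then show "{x. \<not> (x \<in> {0<..<1} \<longrightarrow> P x)} \<in> null_sets lebesgue"
      by (simp add: negligible_iff_null_sets)
  next
    assume "{x. \<not> (x \<in> {0<..<1} \<longrightarrow> P x)} \<in> null_sets lebesgue"
    then show "AE x in lebesgue. x \<in> {0<..<1} \<longrightarrow> P x"
      by (rule AE_I') auto
  qed
  also have "{x. \<not> (x \<in> {0<..<1} \<longrightarrow> P x)} = {x \<in> {0<..<1}. \<not> P x}" by auto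
  finally show ?thesis by (simp add: negligible_iff_null_sets)
qed

lemma AE_integral_derivative:
  assumes "sq_integrable f"
  shows "AE x in unit_leb. ((\<lambda>x. integral {0..x} f) has_real_derivative f x) (at x)"
  unfolding AE_unit_leb_iff_negligible
  by (rule negligible_not_derivative_integral)
    (use sq_integrable_HK[OF assms] in \<open>auto simp: absolutely_integrable_on_def\<close>)

lemma abs_cont_on_subset: "abs_cont_on T f \<Longrightarrow> S \<subseteq> T \<Longrightarrow> abs_cont_on S f"
  unfolding abs_cont_on_def by (meson order_trans)

lemma has_integral_abs_cont_unit:
  assumes f: "abs_cont_on {0..1} f" and der: "AE x in unit_leb. (f has_real_derivative g x) (at x)"
    and xy: "0 \<le> x" "x \<le> y" "y \<le> 1"
  shows "(g has_integral f y - f x) {x..y}"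
proof (rule has_integral_abs_cont_on)
  show "abs_cont_on {x..y} f" using xy by (intro abs_cont_on_subset[OF f]) auto
  \<comment> \<open>Statements almost everywhere in the open interval are silent about its
    endpoints, which therefore join the exceptional set.\<close>
  show "negligible ({t \<in> {0<..<1}. \<not> (f has_real_derivative g t) (at t)} \<union> {0, 1})"
    using der unfolding AE_unit_leb_iff_negligible by (intro negligible_Un) auto
  fix t assume "t \<in> {x..y} - ({t \<in> {0<..<1}. \<not> (f has_real_derivative g t) (at t)} \<union> {0, 1})"
  then have "(f has_real_derivative g t) (at t)" using xy by auto
  then show "(f has_real_derivative g t) (at t within {x..y})" by (rule has_field_derivative_at_within)
qed (rule xy)

lemma abs_cont_on_C1:
  assumes der: "\<And>x. x \<in> {0..1} \<Longrightarrow> (h has_real_derivative h' x) (at x)"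
    and cont: "continuous_on {0..1} h'"
  shows "abs_cont_on {0..1} h"
proof -
  have "bounded (h' ` {0..1})"
    using cont by (intro compact_imp_bounded compact_continuous_image) auto
  then obtain M where M: "\<And>x. x \<in> {0..1} \<Longrightarrow> \<bar>h' x\<bar> \<le> M"
    unfolding bounded_iff real_norm_def by blast
  show ?thesis
  proof (rule abs_cont_on_lipschitz)
    fix a b :: real assume ab: "a \<le> b" "{a..b} \<subseteq> {0..1}"
    have "norm (h b - h a) \<le> M * norm (b - a)"
      by (rule field_differentiable_bound[of "{0..1}" h h'])
        (use ab M der in \<open>auto intro: has_field_derivative_at_within\<close>)
    then show "\<bar>h b - h a\<bar> \<le> M * (b - a)" using ab by simp
  qed
qed

subsection \<open>The space \<open>H2\<close>\<close>

lemma H2_jetD: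
  assumes "H2_jet u f f1 f2"
  shows "abs_cont_on {0..1} f" "sq_integrable f" "u = abs_L2 f"
    "AE x in unit_leb. (f has_real_derivative f1 x) (at x)" "abs_cont_on {0..1} f1"
    "AE x in unit_leb. (f1 has_real_derivative f2 x) (at x)" "sq_integrable f2"
    "sq_integrable f1"
  using assms abs_cont_on_imp_sq_integrable by (auto simp: H2_jet_def ac_repr_def)

lemma H2_jetI:
  assumes "abs_cont_on {0..1} f" "u = abs_L2 f"
    "AE x in unit_leb. (f has_real_derivative f1 x) (at x)" "abs_cont_on {0..1} f1"
    "AE x in unit_leb. (f1 has_real_derivative f2 x) (at x)" "sq_integrable f2"
  shows "H2_jet u f f1 f2"
  using assms abs_cont_on_imp_sq_integrable by (auto simp: H2_jet_def ac_repr_def)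

lemma abs_L2_linear_comb:
  assumes "sq_integrable f" "sq_integrable g"
  shows "abs_L2 (\<lambda>x. c * f x + d * g x) = c *\<^sub>R abs_L2 f + d *\<^sub>R abs_L2 g"
  using assms by (simp add: scaleR_L2.abs_eq plus_L2.abs_eq sq_integrable_scale)

lemma H2_jet_linear_comb:
  assumes u: "H2_jet u f f1 f2" and v: "H2_jet v g g1 g2"
  shows "H2_jet (c *\<^sub>R u + d *\<^sub>R v) (\<lambda>x. c * f x + d * g x) (\<lambda>x. c * f1 x + d * g1 x)
    (\<lambda>x. c * f2 x + d * g2 x)"
proof (rule H2_jetI)
  note U = H2_jetD[OF u] and V = H2_jetD[OF v]
  show "abs_cont_on {0..1} (\<lambda>x. c * f x + d * g x)" "abs_cont_on {0..1} (\<lambda>x. c * f1 x + d * g1 x)"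
    by (intro abs_cont_on_linear_comb U V)+
  show "c *\<^sub>R u + d *\<^sub>R v = abs_L2 (\<lambda>x. c * f x + d * g x)"
    using U V by (simp add: abs_L2_linear_comb)
  show "AE x in unit_leb. ((\<lambda>x. c * f x + d * g x) has_real_derivative c * f1 x + d * g1 x) (at x)"
    using U(4) V(4) by eventually_elim (auto intro!: derivative_eq_intros)
  show "AE x in unit_leb. ((\<lambda>x. c * f1 x + d * g1 x) has_real_derivative c * f2 x + d * g2 x) (at x)"
    using U(6) V(6) by eventually_elim (auto intro!: derivative_eq_intros)
  show "sq_integrable (\<lambda>x. c * f2 x + d * g2 x)"
    by (intro sq_integrable_add sq_integrable_scale U V)
qed

lemma H2_linear_comb:
  assumes "u \<in> H2" "v \<in> H2"
  shows "c *\<^sub>R u + d *\<^sub>R v \<in> H2"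
    and "x \<in> {0..1} \<Longrightarrow> pt_val (c *\<^sub>R u + d *\<^sub>R v) x = c * pt_val u x + d * pt_val v x"
    and "x \<in> {0..1} \<Longrightarrow>
      pt_val (L2_dx (c *\<^sub>R u + d *\<^sub>R v)) x = c * pt_val (L2_dx u) x + d * pt_val (L2_dx v) x"
    and "L2_dx (L2_dx (c *\<^sub>R u + d *\<^sub>R v)) = c *\<^sub>R L2_dx (L2_dx u) + d *\<^sub>R L2_dx (L2_dx v)"
proof -
  obtain f f1 f2 g g1 g2 where j: "H2_jet u f f1 f2" "H2_jet v g g1 g2"
    using assms by (auto simp: H2_def)
  note J = H2_jet_linear_comb[OF j, of c d]
  show "c *\<^sub>R u + d *\<^sub>R v \<in> H2" using J by (auto simp: H2_def)
  note vals = H2_jet_values[OF J] H2_jet_values[OF j(1)] H2_jet_values[OF j(2)]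
  show "x \<in> {0..1} \<Longrightarrow> pt_val (c *\<^sub>R u + d *\<^sub>R v) x = c * pt_val u x + d * pt_val v x"
    by (simp add: vals)
  show "x \<in> {0..1} \<Longrightarrow>
      pt_val (L2_dx (c *\<^sub>R u + d *\<^sub>R v)) x = c * pt_val (L2_dx u) x + d * pt_val (L2_dx v) x"
    by (simp add: vals)
  show "L2_dx (L2_dx (c *\<^sub>R u + d *\<^sub>R v)) = c *\<^sub>R L2_dx (L2_dx u) + d *\<^sub>R L2_dx (L2_dx v)"
    unfolding vals by (rule abs_L2_linear_comb[OF H2_jetD(7)[OF j(1)] H2_jetD(7)[OF j(2)]])
qed

text \<open>The fundamental theorem applied to \<open>f1 * f\<close> and to \<open>f1\<close> gives
  the first two parts. The third is a Poincare inequality without a vanishing boundary value, hence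
  the value at 1 on the right; for \<open>D_eta\<close> the Robin condition supplies dissipation of
  exactly this value.\<close>

lemma H2_integration_by_parts:
  assumes "u \<in> H2"
  shows "inner (L2_dx (L2_dx u)) u = pt_val (L2_dx u) 1 * pt_val u 1 -
      pt_val (L2_dx u) 0 * pt_val u 0 - (norm (L2_dx u))\<^sup>2" (is ?parts)
    and "inner (L2_dx (L2_dx u)) (abs_L2 (\<lambda>_. 1)) = pt_val (L2_dx u) 1 - pt_val (L2_dx u) 0" (is ?ftc)
    and "(norm u)\<^sup>2 \<le> 2 * (pt_val u 1)\<^sup>2 + 2 * (norm (L2_dx u))\<^sup>2" (is ?trace)
proof -
  obtain f f1 f2 where j: "H2_jet u f f1 f2" using assms by (auto simp: H2_def)
  note J = H2_jetD[OF j] and vals = H2_jet_values[OF j]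
  have dx: "L2_dx u = abs_L2 f1"
    using j J(8) L2_dx_eq by (auto simp: H2_jet_def)
  have "((\<lambda>x. f2 x * f x + f1 x * f1 x) has_integral f1 1 * f 1 - f1 0 * f 0) {0..1}"
  proof (rule has_integral_abs_cont_unit)
    show "abs_cont_on {0..1} (\<lambda>x. f1 x * f x)" by (rule abs_cont_on_mult_unit[OF J(5,1)])
    show "AE x in unit_leb. ((\<lambda>x. f1 x * f x) has_real_derivative f2 x * f x + f1 x * f1 x) (at x)"
      using J(4,6) by eventually_elim (auto intro!: derivative_eq_intros)
  qed auto
  then have "integral {0..1} (\<lambda>x. f2 x * f x + f1 x * f1 x) = f1 1 * f 1 - f1 0 * f 0"
    by (rule integral_unique)
  then have parts: "inner (abs_L2 f2) u + inner (abs_L2 f1) (abs_L2 f1) = f1 1 * f 1 - f1 0 * f 0"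
    unfolding J(3) by (simp add: inner_abs_L2 J Henstock_Kurzweil_Integration.integral_add)
  have ends: "pt_val u 0 = f 0" "pt_val u 1 = f 1" "pt_val (L2_dx u) 0 = f1 0" "pt_val (L2_dx u) 1 = f1 1"
    by (simp_all add: vals)
  show ?parts unfolding ends vals(3) using parts by (simp add: dx power2_norm_eq_inner)
  have "(f2 has_integral f1 1 - f1 0) {0..1}"
    by (rule has_integral_abs_cont_unit[OF J(5,6)]) auto
  then show ?ftc using vals by (simp add: inner_abs_L2 J sq_integrable_const integral_unique)
  have bound: "(f x)\<^sup>2 \<le> 2 * (f 1)\<^sup>2 + 2 * (norm (abs_L2 f1))\<^sup>2" if x: "x \<in> {0..1}" for x
  proof -
    have i: "(f1 has_integral f 1 - f x) {x..1}"
      by (rule has_integral_abs_cont_unit[OF J(1,4)]) (use x in auto)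
    have ai: "f1 absolutely_integrable_on {0..1}" "f1 absolutely_integrable_on {x..1}"
      using sq_integrable_HK(1)[OF J(8)] x by (auto intro: absolutely_integrable_on_subinterval)
    have "\<bar>f 1 - f x\<bar> = norm (integral {x..1} f1)" using integral_unique[OF i] by simp
    also have "\<dots> \<le> integral {x..1} (\<lambda>t. \<bar>f1 t\<bar>)"
      using ai(2) by (intro integral_norm_bound_integral) (auto simp: absolutely_integrable_on_def)
    also have "\<dots> \<le> integral {0..1} (\<lambda>t. \<bar>f1 t\<bar>)"
      using ai x by (intro integral_subset_le) (auto simp: absolutely_integrable_on_def)
    also have "\<dots> = integral\<^sup>L unit_leb (\<lambda>t. \<bar>f1 t\<bar>)"
    proof -
      have "integrable unit_leb (\<lambda>t. \<bar>f1 t\<bar> * 1)"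
        by (intro sq_integrable_mult sq_integrable_abs J sq_integrable_const)
      then show ?thesis using unit_leb_integral(2)[of "\<lambda>t. \<bar>f1 t\<bar>"] by simp
    qed
    also have "\<dots> \<le> norm (abs_L2 f1)" by (rule L1_le_L2[OF J(8)])
    finally have d: "(f 1 - f x)\<^sup>2 \<le> (norm (abs_L2 f1))\<^sup>2" by (rule abs_le_square_iff[THEN iffD1, OF order_trans]) simp
    \<comment> \<open>This square is the difference of the two sides of the next inequality.\<close>
    have "0 \<le> (f x - 2 * f 1)\<^sup>2" by simp
    then have "(f x)\<^sup>2 \<le> 2 * (f 1)\<^sup>2 + 2 * (f 1 - f x)\<^sup>2"
      by (simp add: power2_eq_square algebra_simps)
    then show ?thesis using d by simp
  qed
  have "(norm u)\<^sup>2 = integral {0..1} (\<lambda>x. (f x)\<^sup>2)"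
    using inner_abs_L2[OF J(2,2)] J(3) by (simp add: power2_norm_eq_inner) (simp add: power2_eq_square)
  also have "\<dots> \<le> integral {0..1} (\<lambda>x::real. 2 * (f 1)\<^sup>2 + 2 * (norm (abs_L2 f1))\<^sup>2)"
    by (rule integral_le) (use sq_integrable_HK(2)[OF J(2)] bound in \<open>auto simp: absolutely_integrable_on_def\<close>)
  finally show ?trace using vals by (simp add: dx)
qed

text \<open>The datum is merely square integrable, so the equation is solved by variation of
  constants: a particular solution with zero Cauchy data at 0 plus a multiple of
  \<open>cosh\<close>, which keeps the derivative at 0 equal to zero and is fitted to the Robin
  condition at 1.\<close>

lemma boundary_value_problem:
  assumes pos: "0 < a" "0 < b" "0 < \<beta>"
  obtains v where "v \<in> H2" "a *\<^sub>R v - b *\<^sub>R L2_dx (L2_dx v) = w"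
    "pt_val (L2_dx v) 0 = 0" "pt_val (L2_dx v) 1 = - \<beta> * pt_val v 1 + c"
proof -
  obtain f where f: "sq_integrable f" "w = abs_L2 f" by (rule L2_cases)
  define \<omega> where "\<omega> = sqrt (a / b)"
  have \<omega>: "0 < \<omega>" "\<omega>\<^sup>2 = a / b" using pos by (auto simp: \<omega>_def)
  define g where "g x = f x / b" for x
  have g: "sq_integrable g" unfolding g_def using sq_integrable_scale[OF f(1), of "1 / b"] by simp
  have sq_mult: "sq_integrable (\<lambda>x. h x * g x)" if h: "continuous_on UNIV h" for h :: "real \<Rightarrow> real"
  proof -
    have "bounded (h ` {0..1})"
      by (intro compact_imp_bounded compact_continuous_image) (auto intro: continuous_on_subset[OF h])
    then obtain M where M: "\<And>x. x \<in> {0..1} \<Longrightarrow> \<bar>h x\<bar> \<le> M"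
    unfolding bounded_iff real_norm_def by blast
    have [measurable]: "h \<in> borel_measurable unit_leb"
      using continuous_imp_measurable_on_sets_lebesgue[of "{0<..<1}" h] h
      by (auto intro: continuous_on_subset)
    have [measurable]: "g \<in> borel_measurable unit_leb" using sq_integrableD(1)[OF g] .
    have "integrable unit_leb (\<lambda>x. (h x * g x)\<^sup>2)"
    proof (rule Bochner_Integration.integrable_bound)
      show "integrable unit_leb (\<lambda>x. M\<^sup>2 * (g x)\<^sup>2)" using sq_integrableD(2)[OF g] by simp
      have "AE x in unit_leb. x \<in> {0<..<1}" by (rule AE_I2) simp
      then show "AE x in unit_leb. norm ((h x * g x)\<^sup>2) \<le> norm (M\<^sup>2 * (g x)\<^sup>2)"
      proof eventually_elim
        case (elim x)
        have "(h x)\<^sup>2 \<le> M\<^sup>2"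
          using M[of x] elim by (intro abs_le_square_iff[THEN iffD1]) auto
        then show ?case by (simp add: power_mult_distrib mult_right_mono)
      qed
    qed measurable
    then show ?thesis by (simp add: sq_integrable_def)
  qed
  define C where "C x = integral {0..x} (\<lambda>t. cosh (\<omega> * t) * g t)" for x
  define S where "S x = integral {0..x} (\<lambda>t. sinh (\<omega> * t) * g t)" for x
  have sC: "sq_integrable (\<lambda>t. cosh (\<omega> * t) * g t)" and sS: "sq_integrable (\<lambda>t. sinh (\<omega> * t) * g t)"
    by (auto intro!: sq_mult continuous_intros)
  have C0: "C 0 = 0" "S 0 = 0" by (auto simp: C_def S_def)
  have acC: "abs_cont_on {0..1} C" "abs_cont_on {0..1} S"
    unfolding C_def S_def by (intro abs_cont_on_integral sC sS)+
  have ach: "abs_cont_on {0..1} (\<lambda>x. cosh (\<omega> * x))" "abs_cont_on {0..1} (\<lambda>x. sinh (\<omega> * x))"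
    by (rule abs_cont_on_C1[where h' = "\<lambda>x. \<omega> * sinh (\<omega> * x)"] abs_cont_on_C1[where h' = "\<lambda>x. \<omega> * cosh (\<omega> * x)"];
        auto intro!: derivative_eq_intros continuous_intros)+
  have dC: "AE x in unit_leb. (C has_real_derivative cosh (\<omega> * x) * g x) (at x)"
      "AE x in unit_leb. (S has_real_derivative sinh (\<omega> * x) * g x) (at x)"
    unfolding C_def S_def by (intro AE_integral_derivative sC sS)+
  \<comment> \<open>By the addition theorem this is \<open>- 1 / \<omega>\<close> times the
    convolution of \<open>sinh (\<omega> * x)\<close> with \<open>g\<close>, so that
    \<open>p'' = \<omega>\<^sup>2 * p - g\<close>. The factors 1 and -1 in these definitions match
    the form of \<open>abs_cont_on_linear_comb\<close>.\<close>
  define p where "p x = - (1 / \<omega>) * (sinh (\<omega> * x) * C x) + (1 / \<omega>) * (cosh (\<omega> * x) * S x)" for x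
  define p1 where "p1 x = (-1) * (cosh (\<omega> * x) * C x) + 1 * (sinh (\<omega> * x) * S x)" for x
  \<comment> \<open>The Robin functional \<open>v'(1) + \<beta> * v(1)\<close> evaluated at
    \<open>cosh (\<omega> * x)\<close>. It is positive, so the multiple \<open>A\<close> can be
    solved for.\<close>
  define den where "den = \<omega> * sinh \<omega> + \<beta> * cosh \<omega>"
  have den: "0 < den" unfolding den_def using \<omega> pos by (intro add_pos_pos mult_pos_pos) auto
  define A where "A = (c - p1 1 - \<beta> * p 1) / den"
  define v where "v x = A * cosh (\<omega> * x) + 1 * p x" for x
  define v1 where "v1 x = (A * \<omega>) * sinh (\<omega> * x) + 1 * p1 x" for x
  define v2 where "v2 x = (a / b) * v x + (-1) * g x" for x
  have acp: "abs_cont_on {0..1} p" "abs_cont_on {0..1} p1"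
    unfolding p_def p1_def by (intro abs_cont_on_linear_comb abs_cont_on_mult_unit acC ach)+
  have acv: "abs_cont_on {0..1} v" "abs_cont_on {0..1} v1"
    unfolding v_def v1_def by (intro abs_cont_on_linear_comb acp ach)+
  have jet: "H2_jet (abs_L2 v) v v1 v2"
  proof (rule H2_jetI)
    show "AE x in unit_leb. (v has_real_derivative v1 x) (at x)"
      using dC
    proof eventually_elim
      case (elim x)
      show ?case unfolding v_def p_def v1_def p1_def
        by (rule derivative_eq_intros elim refl)+ (use \<omega> in \<open>simp add: field_simps\<close>)
    qed
    show "AE x in unit_leb. (v1 has_real_derivative v2 x) (at x)"
      using dC
    proof eventually_elim
      case (elim x)
      \<comment> \<open>The derivatives of \<open>C\<close> and \<open>S\<close> contribute to
        \<open>p1'\<close> a combination that the hyperbolic Pythagorean identity reduces to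
        \<open>- g\<close>.\<close>
      have "g x = (cosh (\<omega> * x) * cosh (\<omega> * x) - sinh (\<omega> * x) * sinh (\<omega> * x)) * g x"
        using hyperbolic_pythagoras[of "\<omega> * x"] by (simp add: power2_eq_square)
      then have *: "cosh (\<omega> * x) * (cosh (\<omega> * x) * g x) = g x + sinh (\<omega> * x) * (sinh (\<omega> * x) * g x)"
        by (simp add: algebra_simps)
      show ?case unfolding v1_def p1_def v2_def v_def p_def \<omega>(2)[symmetric]
        by (rule derivative_eq_intros elim refl)+
          (use \<omega>(1) * in \<open>simp add: field_simps power2_eq_square\<close>)
    qed
    show "sq_integrable v2" unfolding v2_def
      by (intro sq_integrable_add sq_integrable_scale g abs_cont_on_imp_sq_integrable acv)
  qed (use acv in auto)
  note vals = H2_jet_values[OF jet]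
  have sv: "sq_integrable v" by (rule abs_cont_on_imp_sq_integrable[OF acv(1)])
  show thesis
  proof (rule that)
    show "abs_L2 v \<in> H2" using jet by (auto simp: H2_def)
    have "abs_L2 v2 = (a / b) *\<^sub>R abs_L2 v + (-1) *\<^sub>R abs_L2 g"
      unfolding v2_def by (rule abs_L2_linear_comb[OF sv g])
    moreover have "abs_L2 g = (1 / b) *\<^sub>R abs_L2 f"
      unfolding g_def using f by (simp add: scaleR_L2.abs_eq)
    ultimately have "b *\<^sub>R abs_L2 v2 = a *\<^sub>R abs_L2 v - w"
      using pos by (simp add: f(2) scaleR_diff_right)
    then show "a *\<^sub>R abs_L2 v - b *\<^sub>R L2_dx (L2_dx (abs_L2 v)) = w"
      by (simp add: vals)
    show "pt_val (L2_dx (abs_L2 v)) 0 = 0"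
      by (simp add: vals v1_def p1_def C0)
    have "v1 1 + \<beta> * v 1 = A * den + p1 1 + \<beta> * p 1"
      by (simp add: v1_def v_def den_def algebra_simps)
    also have "A * den = c - p1 1 - \<beta> * p 1" using den by (simp add: A_def)
    finally show "pt_val (L2_dx (abs_L2 v)) 1 = - \<beta> * pt_val (abs_L2 v) 1 + c"
      by (simp add: vals)
  qed
qed

subsection \<open>Integrated solutions of linear evolution equations\<close>

text \<open>The linear equation on a compact time interval. \<open>F\<close> is a function of time,
  but may be a nonlinearity evaluated along \<phi> itself, which is how estimates for linear
  equations reach the semilinear system.\<close>

definition mild_solution ::
    "'z::banach set \<Rightarrow> ('z \<Rightarrow> 'z) \<Rightarrow> real \<Rightarrow> (real \<Rightarrow> 'z) \<Rightarrow> 'z \<Rightarrow> (real \<Rightarrow> 'z) \<Rightarrow> bool" where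
  "mild_solution D A T F x \<phi> \<longleftrightarrow> continuous_on {0..T} \<phi> \<and>
     (\<forall>t\<in>{0..T}. integral {0..t} \<phi> \<in> D \<and>
        \<phi> t = x + A (integral {0..t} \<phi>) + integral {0..t} F)"

text \<open>The average of \<open>g\<close> over \<open>{s..s + h}\<close>, written with primitives
  from 0 because these are the integrals that \<open>mild_solution\<close> places in
  \<open>D\<close>.\<close>

definition steklov :: "real \<Rightarrow> (real \<Rightarrow> 'z::banach) \<Rightarrow> real \<Rightarrow> 'z" where
  "steklov h g s = (1 / h) *\<^sub>R (integral {0..s + h} g - integral {0..s} g)"

lemma steklov_has_vector_derivative:
  assumes g: "continuous_on {0..T} g" and h: "0 < h" "t + h \<le> T" and s: "s \<in> {0..t}"
  shows "(steklov h g has_vector_derivative (1 / h) *\<^sub>R (g (s + h) - g s)) (at s within {0..t})"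
proof -
  have 1: "((\<lambda>u. integral {0..u} g) has_vector_derivative g s) (at s within {0..t})"
    by (rule has_vector_derivative_within_subset[OF integral_has_vector_derivative[OF g]])
      (use h s in auto)
  have 2: "((\<lambda>u. integral {0..u} g) has_vector_derivative g (s + h)) (at (s + h) within (\<lambda>u. u + h) ` {0..t})"
    by (rule has_vector_derivative_within_subset[OF integral_has_vector_derivative[OF g]])
      (use h s in auto)
  have "((\<lambda>u. u + h) has_vector_derivative 1) (at s within {0..t})"
    by (auto intro!: derivative_eq_intros)
  from vector_diff_chain_within[OF this 2]
  have 3: "((\<lambda>u. integral {0..u + h} g) has_vector_derivative g (s + h)) (at s within {0..t})"
    by (simp add: o_def)
  show ?thesis unfolding steklov_def[abs_def]
    by (rule derivative_eq_intros 1 3 refl)+ simp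
qed

lemma steklov_continuous:
  assumes "continuous_on {0..T} g" "0 < h" "t + h \<le> T"
  shows "continuous_on {0..t} (steklov h g)"
  using steklov_has_vector_derivative[OF assms]
  by (meson continuous_on_eq_continuous_within has_vector_derivative_continuous)

lemma steklov_uniform_limit:
  fixes g :: "real \<Rightarrow> 'z::banach"
  assumes g: "continuous_on {0..T} g" and h: "\<And>n. 0 < h n" "\<And>n. t + h n \<le> T" "h \<longlonglongrightarrow> 0"
  shows "uniform_limit {0..t} (\<lambda>n. steklov (h n) g) g sequentially"
proof (rule uniform_limitI)
  fix e :: real assume e: "0 < e"
  have "uniformly_continuous_on {0..T} g"
    by (rule compact_uniformly_continuous[OF g]) simp
  then obtain d where d: "d > 0" and
    gd: "\<And>x y. x \<in> {0..T} \<Longrightarrow> y \<in> {0..T} \<Longrightarrow> dist y x < d \<Longrightarrow> dist (g y) (g x) < e / 2"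
    unfolding uniformly_continuous_on_def using half_gt_zero[OF e] by metis
  have "\<forall>\<^sub>F n in sequentially. h n < d" by (rule order_tendstoD(2)[OF h(3) d])
  then show "\<forall>\<^sub>F n in sequentially. \<forall>s\<in>{0..t}. dist (steklov (h n) g s) (g s) < e"
  proof eventually_elim
    case (elim n)
    show ?case
    proof
      fix s assume s: "s \<in> {0..t}"
      have gi: "g integrable_on {s..s + h n}" "g integrable_on {0..s + h n}"
        using s h(1)[of n] h(2)[of n]
        by (auto intro!: integrable_continuous_real continuous_on_subset[OF g])
      have "integral {0..s} g + integral {s..s + h n} g = integral {0..s + h n} g"
        by (rule Henstock_Kurzweil_Integration.integral_combine) (use s h(1)[of n] gi in auto)
      then have "steklov (h n) g s = (1 / h n) *\<^sub>R integral {s..s + h n} g"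
        unfolding steklov_def by (metis add_diff_cancel_left')
      moreover have "g s = (1 / h n) *\<^sub>R integral {s..s + h n} (\<lambda>_. g s)"
        using h(1)[of n] by simp
      moreover have "integral {s..s + h n} (\<lambda>r. g r - g s)
          = integral {s..s + h n} g - integral {s..s + h n} (\<lambda>_. g s)"
        by (rule Henstock_Kurzweil_Integration.integral_diff) (use gi in auto)
      ultimately have "steklov (h n) g s - g s = (1 / h n) *\<^sub>R integral {s..s + h n} (\<lambda>r. g r - g s)"
        by (metis scaleR_diff_right)
      moreover have "norm (integral {s..s + h n} (\<lambda>r. g r - g s)) \<le> e / 2 * (s + h n - s)"
      proof (rule integral_bound)
        show "continuous_on {s..s + h n} (\<lambda>r. g r - g s)"
          using s h(2)[of n] by (auto intro!: continuous_intros continuous_on_subset[OF g])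
        fix r assume r: "r \<in> {s..s + h n}"
        have "dist (g r) (g s) < e / 2" 
          by (rule gd) (use r s h(1,2)[of n] elim in \<open>auto simp: dist_real_def\<close>)
        then show "norm (g r - g s) \<le> e / 2" by (simp add: dist_norm)
      qed (use h(1)[of n] in simp)
      ultimately have "norm (steklov (h n) g s - g s) \<le> e / 2"
        using h(1)[of n] by (simp add: field_simps)
      then show "dist (steklov (h n) g s) (g s) < e" using e by (simp add: dist_norm)
    qed
  qed
qed

lemma tendsto_integral_uniform_limit:
  fixes g :: "nat \<Rightarrow> real \<Rightarrow> 'z::banach"
  assumes lim: "uniform_limit {a..b} g k sequentially" and cont: "\<And>n. continuous_on {a..b} (g n)"
  shows "(\<lambda>n. integral {a..b} (g n)) \<longlonglongrightarrow> integral {a..b} k"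
proof -
  obtain I L where IL: "\<And>n. (g n has_integral I n) {a..b}" "(k has_integral L) {a..b}" "I \<longlonglongrightarrow> L"
    by (rule uniform_limit_integral[OF lim cont sequentially_bot], rule that)
  have "integral {a..b} (g n) = I n" for n using IL(1) by (rule integral_unique)
  then show ?thesis using IL(3) integral_unique[OF IL(2)] by simp
qed

locale linear_operator =
  fixes D :: "'z::banach set" and A :: "'z \<Rightarrow> 'z"
  assumes zero_in_D: "0 \<in> D"
    and lincomb_in_D: "x \<in> D \<Longrightarrow> y \<in> D \<Longrightarrow> c *\<^sub>R x + d *\<^sub>R y \<in> D"
    and A_lincomb: "x \<in> D \<Longrightarrow> y \<in> D \<Longrightarrow> A (c *\<^sub>R x + d *\<^sub>R y) = c *\<^sub>R A x + d *\<^sub>R A y"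
begin

lemma D_closed:
  assumes "x \<in> D" "y \<in> D"
  shows "x + y \<in> D" "x - y \<in> D" "c *\<^sub>R x \<in> D"
  using lincomb_in_D[OF assms, of 1 1] lincomb_in_D[OF assms, of 1 "-1"] lincomb_in_D[OF assms, of c 0]
  by simp_all

lemma A_linear:
  assumes "x \<in> D"
  shows "y \<in> D \<Longrightarrow> A (x + y) = A x + A y" "y \<in> D \<Longrightarrow> A (x - y) = A x - A y" "A (c *\<^sub>R x) = c *\<^sub>R A x"
  using A_lincomb[OF assms, of y 1 1] A_lincomb[OF assms, of y 1 "-1"] A_lincomb[OF assms assms, of c 0]
  by simp_all

lemma A_zero: "A 0 = 0"
  using A_linear(3)[OF zero_in_D, of 0] by simp

lemma mild_solution_0:
  assumes "mild_solution D A T F x \<phi>" "0 \<le> T"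
  shows "\<phi> 0 = x"
  using assms A_zero by (auto simp: mild_solution_def dest!: bspec[of _ _ 0])

lemma mild_solution_lincomb:
  assumes f: "mild_solution D A T F x \<phi>" and g: "mild_solution D A T G y \<psi>"
    and F: "continuous_on {0..T} F" and G: "continuous_on {0..T} G"
  shows "mild_solution D A T (\<lambda>t. c *\<^sub>R F t + d *\<^sub>R G t) (c *\<^sub>R x + d *\<^sub>R y)
    (\<lambda>t. c *\<^sub>R \<phi> t + d *\<^sub>R \<psi> t)"
  unfolding mild_solution_def
proof (intro conjI ballI)
  have cont: "continuous_on {0..T} \<phi>" "continuous_on {0..T} \<psi>"
    using f g by (auto simp: mild_solution_def)
  then show "continuous_on {0..T} (\<lambda>t. c *\<^sub>R \<phi> t + d *\<^sub>R \<psi> t)" by (intro continuous_intros)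
  fix t assume t: "t \<in> {0..T}"
  have int: "k integrable_on {0..t}" if "continuous_on {0..T} k" for k :: "real \<Rightarrow> 'z"
    by (rule integrable_continuous_real) (use t in \<open>auto intro: continuous_on_subset[OF that]\<close>)
  have eq: "integral {0..t} (\<lambda>t. c *\<^sub>R k t + d *\<^sub>R l t) = c *\<^sub>R integral {0..t} k + d *\<^sub>R integral {0..t} l"
    if "continuous_on {0..T} k" "continuous_on {0..T} l" for k l :: "real \<Rightarrow> 'z"
    using int[OF that(1)] int[OF that(2)]
    by (subst Henstock_Kurzweil_Integration.integral_add) (auto intro: integrable_cmul)
  have i: "integral {0..t} \<phi> \<in> D" "integral {0..t} \<psi> \<in> D"
    and e: "\<phi> t = x + A (integral {0..t} \<phi>) + integral {0..t} F"
       "\<psi> t = y + A (integral {0..t} \<psi>) + integral {0..t} G"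
    using f g t by (auto simp: mild_solution_def)
  show "integral {0..t} (\<lambda>t. c *\<^sub>R \<phi> t + d *\<^sub>R \<psi> t) \<in> D"
    unfolding eq[OF cont] by (rule lincomb_in_D[OF i])
  show "c *\<^sub>R \<phi> t + d *\<^sub>R \<psi> t = c *\<^sub>R x + d *\<^sub>R y + A (integral {0..t} (\<lambda>t. c *\<^sub>R \<phi> t + d *\<^sub>R \<psi> t)) +
      integral {0..t} (\<lambda>t. c *\<^sub>R F t + d *\<^sub>R G t)"
    unfolding eq[OF cont] eq[OF F G] A_lincomb[OF i] e by (simp add: algebra_simps)
qed

text \<open>The Steklov averages of an integrated solution are classical solutions, since they are
  difference quotients of its primitive, which takes values in \<open>D\<close>.\<close>

lemma mild_solution_energy:
  assumes sol: "mild_solution D A T F x \<phi>" and F: "continuous_on {0..T} F"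
    and B: "bounded_bilinear B" and sym: "\<And>y z. B y z = B z y"
    and diss: "\<And>y. y \<in> D \<Longrightarrow> B y (A y) \<le> - c * B y y"
    and t: "0 \<le> t" "t < T"
  shows "exp (2 * a * t) * B (\<phi> t) (\<phi> t) \<le> B x x +
    integral {0..t} (\<lambda>s. exp (2 * a * s) * (2 * (a - c) * B (\<phi> s) (\<phi> s) + 2 * B (\<phi> s) (F s)))"
proof -
  interpret B: bounded_bilinear B by (rule B)
  have cont: "continuous_on {0..T} \<phi>" using sol by (simp add: mild_solution_def)
  have x: "\<phi> 0 = x" using mild_solution_0[OF sol] t by simp
  \<comment> \<open>Averages at times up to \<open>t\<close> look ahead by \<open>h n\<close>, which
    is why \<open>t < T\<close> is strict.\<close>
  define h where "h n = (T - t) / real (Suc n)" for n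
  have h: "0 < h n" "t + h n \<le> T" for n
  proof -
    show "0 < h n" using t by (simp add: h_def)
    have "(T - t) / real (Suc n) \<le> (T - t) / 1" using t by (intro divide_left_mono) auto
    then show "t + h n \<le> T" by (simp add: h_def)
  qed
  have h0: "h \<longlonglongrightarrow> 0"
    unfolding h_def using LIMSEQ_Suc[OF lim_const_over_n[of "T - t"]] by simp
  define p where "p n = steklov (h n) \<phi>" for n
  define q where "q n = steklov (h n) F" for n
  have pc: "continuous_on {0..t} (p n)" "continuous_on {0..t} (q n)" for n
    unfolding p_def q_def using steklov_continuous[OF cont h] steklov_continuous[OF F h] by auto
  have pl: "uniform_limit {0..t} p \<phi> sequentially" "uniform_limit {0..t} q F sequentially"
    unfolding p_def q_def using steklov_uniform_limit[OF cont h h0] steklov_uniform_limit[OF F h h0] by auto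
  have p: "p n s \<in> D" "(1 / h n) *\<^sub>R (\<phi> (s + h n) - \<phi> s) = A (p n s) + q n s" if s: "s \<in> {0..t}" for n s
  proof -
    have s': "s \<in> {0..T}" "s + h n \<in> {0..T}" using s h[of n] by auto
    then have i: "integral {0..s} \<phi> \<in> D" "integral {0..s + h n} \<phi> \<in> D"
      and e: "\<phi> s = x + A (integral {0..s} \<phi>) + integral {0..s} F"
         "\<phi> (s + h n) = x + A (integral {0..s + h n} \<phi>) + integral {0..s + h n} F"
      using sol unfolding mild_solution_def by blast+
    show "p n s \<in> D" unfolding p_def steklov_def using D_closed i by blast
    show "(1 / h n) *\<^sub>R (\<phi> (s + h n) - \<phi> s) = A (p n s) + q n s"
      unfolding p_def q_def steklov_def e
      using A_linear(3)[OF D_closed(2)[OF i(2,1)]] A_linear(2)[OF i(2,1)]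
      by (simp add: algebra_simps)
  qed
  \<comment> \<open>An upper bound for the derivative of \<open>v n\<close> from which dissipativity
    has removed \<open>A\<close>. Only continuous expressions in the averages remain, so the limit
    can be taken under the integral; \<open>A (p n s)\<close> itself need not converge.\<close>
  define R where "R n s = exp (2 * a * s) * (2 * (a - c) * B (p n s) (p n s) + 2 * B (p n s) (q n s))" for n s
  define v where "v n s = exp (2 * a * s) * B (p n s) (p n s)" for n s
  have le: "v n t - v n 0 \<le> integral {0..t} (R n)" for n
  proof (rule has_integral_le)
    show "((\<lambda>s. 2 * a * exp (2 * a * s) * B (p n s) (p n s) + exp (2 * a * s) *
        (2 * B (p n s) (A (p n s) + q n s))) has_integral v n t - v n 0) {0..t}"
    proof (rule fundamental_theorem_of_calculus)
      fix s assume s: "s \<in> {0..t}"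
      have "(p n has_vector_derivative A (p n s) + q n s) (at s within {0..t})"
        using steklov_has_vector_derivative[OF cont h s, of n] unfolding p(2)[OF s] p_def .
      from B.has_vector_derivative[OF this this]
      have 1: "((\<lambda>s. B (p n s) (p n s)) has_vector_derivative 2 * B (p n s) (A (p n s) + q n s)) (at s within {0..t})"
        using sym[of "p n s"] by simp
      show "(v n has_vector_derivative 2 * a * exp (2 * a * s) * B (p n s) (p n s) + exp (2 * a * s) *
        (2 * B (p n s) (A (p n s) + q n s))) (at s within {0..t})"
        unfolding v_def[abs_def] has_real_derivative_iff_has_vector_derivative[symmetric]
        by (rule derivative_eq_intros refl 1[unfolded has_real_derivative_iff_has_vector_derivative[symmetric]])+
          simp
    qed (rule t)
    show "(R n has_integral integral {0..t} (R n)) {0..t}"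
      unfolding R_def
      by (intro integrable_integral integrable_continuous_real continuous_intros pc B.continuous_on)
    fix s assume s: "s \<in> {0..t}"
    have "B (p n s) (A (p n s)) \<le> - c * B (p n s) (p n s)" by (rule diss[OF p(1)[OF s]])
    then have "2 * a * B (p n s) (p n s) + 2 * B (p n s) (A (p n s) + q n s)
        \<le> 2 * (a - c) * B (p n s) (p n s) + 2 * B (p n s) (q n s)"
      by (simp add: B.add_right algebra_simps)
    from mult_left_mono[OF this, of "exp (2 * a * s)"]
    show "2 * a * exp (2 * a * s) * B (p n s) (p n s) + exp (2 * a * s) * (2 * B (p n s) (A (p n s) + q n s)) \<le> R n s"
      by (simp add: R_def algebra_simps)
  qed
  have bdd: "bounded (\<phi> ` {0..t})" "bounded (F ` {0..t})"
    using t by (auto intro!: compact_imp_bounded compact_continuous_image continuous_on_subset[OF cont]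
        continuous_on_subset[OF F])
  define R' where "R' s = exp (2 * a * s) * (2 * (a - c) * B (\<phi> s) (\<phi> s) + 2 * B (\<phi> s) (F s))" for s
  have c': "continuous_on {0..t} \<phi>" "continuous_on {0..t} F"
    using t by (auto intro: continuous_on_subset[OF cont] continuous_on_subset[OF F])
  have "uniform_limit {0..t} R R' sequentially"
    unfolding R_def[abs_def] R'_def[abs_def]
    by (intro uniform_lim_mult uniform_limit_add B.bounded_uniform_limit pl bdd uniform_limit_const
        compact_imp_bounded compact_continuous_image continuous_intros c' B.continuous_on) auto
  moreover have "continuous_on {0..t} (R n)" for n
    unfolding R_def by (intro continuous_intros pc B.continuous_on)
  ultimately have lim: "(\<lambda>n. integral {0..t} (R n)) \<longlonglongrightarrow> integral {0..t} R'"
    by (rule tendsto_integral_uniform_limit)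
  have ptw: "(\<lambda>n. p n s) \<longlonglongrightarrow> \<phi> s" if "s \<in> {0..t}" for s
    by (rule tendsto_uniform_limitI[OF pl(1) that])
  have "(\<lambda>n. v n t - v n 0) \<longlonglongrightarrow> exp (2 * a * t) * B (\<phi> t) (\<phi> t) - exp (2 * a * 0) * B (\<phi> 0) (\<phi> 0)"
    unfolding v_def by (intro tendsto_intros B.tendsto ptw) (use t in auto)
  from LIMSEQ_le[OF this lim] le
  show ?thesis by (auto simp: R'_def[abs_def] x)
qed

end

section \<open>Resolvents of m-dissipative operators\<close>

locale m_dissipative = linear_operator D A for D :: "'z::banach set" and A +
  fixes B :: "'z \<Rightarrow> 'z \<Rightarrow> real" and m M :: real
  assumes bilinear: "bounded_bilinear B" and sym: "B x y = B y x"
    and m_pos: "0 < m" and coercive: "m * (norm x)\<^sup>2 \<le> B x x" and bounded: "B x x \<le> M * (norm x)\<^sup>2"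
    and dissipative: "x \<in> D \<Longrightarrow> B x (A x) \<le> 0"
    and range: "0 < h \<Longrightarrow> \<exists>x\<in>D. x - h *\<^sub>R A x = y"
begin

sublocale B: bounded_bilinear B by (rule bilinear)

text \<open>The resolvent, that is, one step of the implicit Euler scheme. Being the identity for
  \<open>h \<le> 0\<close>, it also covers step size 0, which occurs at time 0.\<close>

definition J :: "real \<Rightarrow> 'z \<Rightarrow> 'z" where
  "J h y = (if 0 < h then SOME x. x \<in> D \<and> x - h *\<^sub>R A x = y else y)"

text \<open>Dissipativity refers to the inner product \<open>B\<close>, whose norm is only
  equivalent to the given one; for \<open>A_e\<close> it is a weighted energy. \<open>K\<close> is
  the price of changing norms, and the maximum with 1 lets it dominate plain norms as well.\<close>

definition K :: real where "K = max 1 (sqrt (M / m))"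

lemma K_ge_1: "1 \<le> K" by (simp add: K_def)

lemma B_nonneg: "0 \<le> B x x"
  using coercive[of x] m_pos by (meson mult_nonneg_nonneg less_imp_le order_trans zero_le_power2)

lemma B_eq_0_iff: "B x x = 0 \<longleftrightarrow> x = 0"
proof
  assume "B x x = 0"
  then have "m * (norm x)\<^sup>2 \<le> 0" using coercive[of x] by simp
  then show "x = 0" using m_pos by (simp add: mult_le_0_iff)
qed (simp add: B.zero_left)

lemma norm_le_K:
  assumes "B y y \<le> B x x"
  shows "norm y \<le> K * norm x"
proof -
  have "m * (norm y)\<^sup>2 \<le> M * (norm x)\<^sup>2"
    using coercive[of y] bounded[of x] assms by linarith
  then have "(norm y)\<^sup>2 \<le> (M / m) * (norm x)\<^sup>2" using m_pos by (simp add: field_simps)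
  then have "sqrt ((norm y)\<^sup>2) \<le> sqrt ((M / m) * (norm x)\<^sup>2)" by (rule real_sqrt_le_mono)
  then have "norm y \<le> sqrt (M / m) * norm x"
    by (simp only: real_sqrt_mult real_sqrt_abs abs_norm_cancel)
  also have "\<dots> \<le> K * norm x" by (intro mult_right_mono) (auto simp: K_def)
  finally show ?thesis .
qed

lemma resolvent_inj:
  assumes "x \<in> D" "y \<in> D" "0 < h" "x - h *\<^sub>R A x = y - h *\<^sub>R A y"
  shows "x = y"
proof -
  have "x - y = h *\<^sub>R A x - h *\<^sub>R A y" using assms(4) by (simp add: algebra_simps)
  then have "x - y = h *\<^sub>R A (x - y)"
    unfolding A_linear(2)[OF assms(1,2)] scaleR_diff_right .
  then have "B (x - y) (x - y) = h * B (x - y) (A (x - y))"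
    by (metis B.scaleR_right real_scaleR_def)
  also have "\<dots> \<le> 0"
    using dissipative[OF D_closed(2)[OF assms(1,2)]] assms(3) by (simp add: mult_le_0_iff)
  finally show ?thesis using B_nonneg[of "x - y"] B_eq_0_iff[of "x - y"] by simp
qed

lemma J_properties:
  assumes "0 < h"
  shows "J h y \<in> D" "J h y - h *\<^sub>R A (J h y) = y"
proof -
  have "J h y \<in> D \<and> J h y - h *\<^sub>R A (J h y) = y"
    unfolding J_def using range[OF assms, of y] assms by (auto intro: someI2_ex)
  then show "J h y \<in> D" "J h y - h *\<^sub>R A (J h y) = y" by auto
qed

lemma J_0: "h \<le> 0 \<Longrightarrow> J h y = y" by (simp add: J_def)

lemma J_unique: "x \<in> D \<Longrightarrow> 0 \<le> h \<Longrightarrow> J h (x - h *\<^sub>R A x) = x"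
  using resolvent_inj[of "J h (x - h *\<^sub>R A x)" x h] J_properties[of h] J_0[of h]
  by (cases "h = 0") auto

lemma J_in_D: "x \<in> D \<Longrightarrow> J h x \<in> D"
  using J_properties(1)[of h x] J_0[of h x] by (cases "0 < h") auto

lemma J_eq: "0 \<le> h \<Longrightarrow> J h y - h *\<^sub>R A (J h y) = y"
  using J_properties(2)[of h y] J_0[of h y] by (cases "0 < h") auto

lemma J_lincomb: "J h (c *\<^sub>R x + d *\<^sub>R y) = c *\<^sub>R J h x + d *\<^sub>R J h y"
proof (cases "0 < h")
  case True
  note J = J_properties[OF True]
  have "c *\<^sub>R x + d *\<^sub>R y = c *\<^sub>R (J h x - h *\<^sub>R A (J h x)) + d *\<^sub>R (J h y - h *\<^sub>R A (J h y))"
    by (simp add: J)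
  also have "\<dots> = (c *\<^sub>R J h x + d *\<^sub>R J h y) - h *\<^sub>R A (c *\<^sub>R J h x + d *\<^sub>R J h y)"
    using A_lincomb[OF J(1) J(1)] by (simp add: algebra_simps)
  finally show ?thesis
    using J_unique[OF lincomb_in_D[OF J(1) J(1)], of h c x d y] True by simp
qed (simp add: J_0)

text \<open>Pairing the resolvent equation with \<open>J h x\<close> gives
  \<open>B (J h x) (J h x) \<le> B (J h x) x\<close>; nonnegativity of \<open>B\<close> at
  \<open>x - J h x\<close> disposes of the mixed term.\<close>

lemma B_J_le: "B (J h x) (J h x) \<le> B x x"
proof (cases "0 < h")
  case True
  note J = J_properties[OF True, of x]
  have "B (J h x) (J h x) - h * B (J h x) (A (J h x)) = B (J h x) x"
    using arg_cong[OF J(2), of "B (J h x)"] by (simp add: B.diff_right B.scaleR_right)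
  moreover have "h * B (J h x) (A (J h x)) \<le> 0"
    using dissipative[OF J(1)] True by (simp add: mult_le_0_iff)
  moreover have "0 \<le> B x x - 2 * B (J h x) x + B (J h x) (J h x)"
    using B_nonneg[of "x - J h x"] sym[of x "J h x"] by (simp add: B.diff_left B.diff_right)
  ultimately show ?thesis by linarith
qed (simp add: J_0)

text \<open>Stability of the Euler scheme: the iterates do not grow in \<open>B\<close> and norms
  are compared once, so the constant is \<open>K\<close> and not its n-th power.\<close>

lemma norm_J_power: "norm ((J h ^^ n) x) \<le> K * norm x"
proof (rule norm_le_K)
  show "B ((J h ^^ n) x) ((J h ^^ n) x) \<le> B x x"
    by (induction n) (auto intro: order_trans[OF B_J_le])
qed

lemma norm_J: "norm (J h x) \<le> K * norm x"
  using norm_J_power[where h = h and n = 1 and x = x] by simp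

lemma bounded_linear_J: "bounded_linear (J h)"
proof (rule bounded_linear_intro)
  show "J h (x + y) = J h x + J h y" for x y using J_lincomb[of h 1 x 1 y] by simp
  show "J h (c *\<^sub>R x) = c *\<^sub>R J h x" for c x using J_lincomb[of h c x 0 x] by simp
  show "norm (J h x) \<le> norm x * K" for x using norm_J[of h x] by (simp add: mult.commute)
qed

lemmas J_simps = linear_diff[OF bounded_linear.linear[OF bounded_linear_J]]
  linear_add[OF bounded_linear.linear[OF bounded_linear_J]]
  linear_scale[OF bounded_linear.linear[OF bounded_linear_J]]

lemma J_power_simps:
  "(J h ^^ n) (x - y) = (J h ^^ n) x - (J h ^^ n) y"
  "(J h ^^ n) (x + y) = (J h ^^ n) x + (J h ^^ n) y"
  "(J h ^^ n) (c *\<^sub>R x) = c *\<^sub>R (J h ^^ n) x"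
  by (induction n) (simp_all add: J_simps)

lemma A_J: 
  assumes "x \<in> D" "0 \<le> h"
  shows "A (J h x) = J h (A x)"
proof (cases "h = 0")
  case False
  then have h: "0 < h" using assms by simp
  have "J h x - h *\<^sub>R J h (A x) = x" using J_unique[OF assms] by (simp add: J_simps)
  moreover have "J h x - h *\<^sub>R A (J h x) = x" by (rule J_properties(2)[OF h])
  ultimately have "h *\<^sub>R J h (A x) = h *\<^sub>R A (J h x)" by (metis diff_left_imp_eq)
  then show ?thesis using h by simp
qed (simp add: J_0)

lemma J_commute:
  assumes "0 \<le> h" "0 \<le> k"
  shows "J h (J k x) = J k (J h x)"
proof (cases "k = 0 \<or> h = 0")
  case False
  then have h: "0 < h" "0 < k" using assms by auto
  define z where "z = J k x"
  have z: "z \<in> D" "z - k *\<^sub>R A z = x" unfolding z_def using J_properties[OF h(2)] by auto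
  have Jz: "J h z \<in> D" by (rule J_in_D[OF z(1)])
  have "J h x = J h z - k *\<^sub>R A (J h z)"
    using z h A_J[of z h] by (simp add: J_simps flip: z(2))
  then have "J k (J h x) = J h z" using J_unique[OF Jz, of k] h by simp
  then show ?thesis by (simp add: z_def)
qed (auto simp: J_0)

lemma J_power_in_D: "x \<in> D \<Longrightarrow> (J h ^^ n) x \<in> D"
  by (induction n) (auto intro: J_in_D)

lemma A_J_power: "x \<in> D \<Longrightarrow> 0 \<le> h \<Longrightarrow> A ((J h ^^ n) x) = (J h ^^ n) (A x)"
  by (induction n) (auto simp: A_J J_power_in_D)

text \<open>\<open>p = lim (J h x - x)\<close> exists because the squared lengths of these vectors are monotone in
  \<open>h\<close> and dominate their squared distances; applying \<open>J 1\<close> shows \<open>p = 0\<close>.\<close>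

lemma J_tendsto_id: "(\<lambda>n. J (1 / Suc n) x) \<longlonglongrightarrow> x"
proof -
  define p where "p n = J (1 / Suc n) x - x" for n
  have hp: "(0::real) < 1 / Suc n" for n by simp
  \<comment> \<open>The Yosida approximation: \<open>A\<close> after the resolvent is a difference
    quotient of the resolvent.\<close>
  have Ap: "A (J (1 / Suc n) x) = Suc n *\<^sub>R p n" for n
  proof -
    have "p n = (1 / real (Suc n)) *\<^sub>R A (J (1 / Suc n) x)"
      using J_properties(2)[OF hp, of n x] by (simp only: p_def algebra_simps)
    then show ?thesis by simp
  qed
  have mono: "B (p n - p k) (p n - p k) \<le> B (p n) (p n) - B (p k) (p k)"
    if nk: "n \<le> k" for n k
  proof -
    define a b where "a = real (Suc n)" and "b = real (Suc k)"
    have ab: "0 < a" "a \<le> b" using nk by (auto simp: a_def b_def)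
    have in_D: "J (1 / Suc n) x \<in> D" "J (1 / Suc k) x \<in> D" using J_properties(1) hp by auto
    have "B (J (1 / Suc n) x - J (1 / Suc k) x) (A (J (1 / Suc n) x - J (1 / Suc k) x)) \<le> 0"
      by (rule dissipative[OF D_closed(2)[OF in_D]])
    moreover have "J (1 / Suc n) x - J (1 / Suc k) x = p n - p k" by (simp add: p_def)
    moreover have "A (J (1 / Suc n) x - J (1 / Suc k) x) = a *\<^sub>R p n - b *\<^sub>R p k"
      unfolding A_linear(2)[OF in_D] Ap a_def b_def ..
    ultimately have "B (p n - p k) (a *\<^sub>R p n - b *\<^sub>R p k) \<le> 0" by simp
    then have 1: "a * B (p n) (p n) + b * B (p k) (p k) \<le> (a + b) * B (p n) (p k)"
      using sym[of "p k" "p n"] by (simp add: B.diff_left B.diff_right B.scaleR_right algebra_simps)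
    have 2: "B (p n - p k) (p n - p k) = B (p n) (p n) - 2 * B (p n) (p k) + B (p k) (p k)"
      using sym[of "p k" "p n"] by (simp add: B.diff_left B.diff_right)
    define P Q R where "P = B (p n) (p n)" and "Q = B (p k) (p k)" and "R = B (p n) (p k)"
    have R: "a * P + b * Q \<le> (a + b) * R" "0 \<le> P - 2 * R + Q"
      using 1 2 B_nonneg[of "p n - p k"] by (auto simp: P_def Q_def R_def)
    \<comment> \<open>Expanding the square shows that the claim amounts to this inequality. The
      bound from dissipativity combined with \<open>a\<close> times the nonnegative expression
      leaves \<open>(b - a) * (Q - R) \<le> 0\<close>.\<close>
    have "Q \<le> R"
    proof (cases "n = k")
      case False
      then have ab': "a < b" using nk by (simp add: a_def b_def)
      have "0 \<le> a * (P - 2 * R + Q)" using R(2) ab by simp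
      then have "(b - a) * (Q - R) \<le> 0" using R(1) by (simp add: algebra_simps)
      then show ?thesis using ab' by (simp add: mult_le_0_iff)
    qed (simp add: Q_def R_def)
    moreover have "P - 2 * R + Q \<le> P - Q \<longleftrightarrow> Q \<le> R" by linarith
    ultimately show ?thesis using 2 by (simp add: P_def Q_def R_def)
  qed
  define q where "q n = B (p n) (p n)" for n
  have "decseq q"
    unfolding decseq_def
  proof (intro allI impI)
    fix n k :: nat assume "n \<le> k"
    from mono[OF this] B_nonneg[of "p n - p k"] show "q k \<le> q n" by (simp add: q_def)
  qed
  moreover have "\<And>n. 0 \<le> q n" using B_nonneg by (simp add: q_def)
  ultimately have "convergent q"
    using decseq_convergent[of q 0] by (metis convergent_def)
  then have Cq: "Cauchy q" by (rule convergent_Cauchy)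
  have "Cauchy p"
  proof (rule CauchyI)
    fix e :: real assume e: "0 < e"
    have e': "0 < m * e\<^sup>2" using e m_pos by simp
    obtain N where N: "\<And>i j. i \<ge> N \<Longrightarrow> j \<ge> N \<Longrightarrow> norm (q i - q j) < m * e\<^sup>2"
      using CauchyD[OF Cq e'] by blast
    have lt: "norm (p i - p j) < e" if "N \<le> i" "i \<le> j" for i j
    proof -
      have "m * (norm (p i - p j))\<^sup>2 \<le> q i - q j"
        using coercive[of "p i - p j"] mono[OF that(2)] by (simp add: q_def)
      also have "\<dots> < m * e\<^sup>2" using N[of i j] that by simp
      finally have "(norm (p i - p j))\<^sup>2 < e\<^sup>2" using m_pos by simp
      then show ?thesis using e by (simp add: power2_less_imp_less)
    qed
    show "\<exists>N. \<forall>i\<ge>N. \<forall>j\<ge>N. norm (p i - p j) < e"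
    proof (intro exI allI impI)
      fix i j assume "i \<ge> N" "j \<ge> N"
      then show "norm (p i - p j) < e"
        using lt[of i j] lt[of j i] by (cases "i \<le> j") (auto simp: norm_minus_commute)
    qed
  qed
  then obtain p0 where p0: "p \<longlonglongrightarrow> p0" using Cauchy_convergent_iff convergent_def by blast
  have "(\<lambda>n. J 1 (p n)) \<longlonglongrightarrow> J 1 p0"
    by (rule bounded_linear.tendsto[OF bounded_linear_J p0])
  \<comment> \<open>\<open>p n\<close> is \<open>1 / Suc n\<close> times a value of
    \<open>A\<close>, and \<open>J 1\<close> turns the unbounded \<open>A\<close> into the bounded
    \<open>J 1 - id\<close>. As \<open>J 1\<close> is injective, the limit of \<open>p\<close>
    vanishes too.\<close>
  moreover have "(\<lambda>n. J 1 (p n)) \<longlonglongrightarrow> 0"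
  proof (rule Lim_null_comparison)
    have "(\<lambda>n. 1 / real (Suc n)) \<longlonglongrightarrow> 0" using LIMSEQ_Suc[OF lim_const_over_n[of 1]] by simp
    then show "(\<lambda>n. (1 / real (Suc n)) * ((K + 1) * (K * norm x))) \<longlonglongrightarrow> 0"
      by (rule tendsto_mult_left_zero)
    show "\<forall>\<^sub>F n in sequentially. norm (J 1 (p n)) \<le> (1 / real (Suc n)) * ((K + 1) * (K * norm x))"
    proof (rule always_eventually, rule allI)
      fix n
      define y where "y = J (1 / Suc n) x"
      have y: "y \<in> D" unfolding y_def using J_properties(1) hp by auto
      have "p n = (1 / Suc n) *\<^sub>R A y" unfolding y_def Ap by simp
      then have "J 1 (p n) = (1 / Suc n) *\<^sub>R A (J 1 y)" using A_J[OF y, of 1] by (simp add: J_simps)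
      also have "A (J 1 y) = J 1 y - y" using J_eq[of 1 y] by (simp add: algebra_simps)
      finally have "norm (J 1 (p n)) = (1 / real (Suc n)) * norm (J 1 y - y)" by simp
      also have "norm (J 1 y - y) \<le> K * norm y + norm y"
        using norm_triangle_ineq4[of "J 1 y" y] norm_J[of 1 y] by linarith
      also have "\<dots> = (K + 1) * norm y" by (simp add: algebra_simps)
      also have "\<dots> \<le> (K + 1) * (K * norm x)"
        unfolding y_def using K_ge_1 by (intro mult_left_mono norm_J) auto
      finally show "norm (J 1 (p n)) \<le> (1 / real (Suc n)) * ((K + 1) * (K * norm x))"
        by (simp add: divide_right_mono)
    qed
  qed
  ultimately have "J 1 p0 = 0" by (rule LIMSEQ_unique)
  then have "p0 = 0" using J_eq[of 1 p0] A_zero by simp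
  then have "(\<lambda>n. p n + x) \<longlonglongrightarrow> 0 + x" using p0 by (intro tendsto_intros) simp
  then show ?thesis by (simp add: p_def)
qed

text \<open>The domain of the square of \<open>A\<close>, where one Euler step has an error of
  second order in the step size.\<close>

definition D2 :: "'z set" where "D2 = {x \<in> D. A x \<in> D}"

text \<open>Two resolvents move any point into \<open>D2\<close>. Their product tends to the
  identity because the outer factor is bounded by \<open>K\<close> uniformly in the step
  size.\<close>

lemma D2_dense:
  obtains y where "\<And>n. y n \<in> D2" "y \<longlonglongrightarrow> x"
proof
  define y where "y n = J (1 / Suc n) (J (1 / Suc n) x)" for n
  show "y n \<in> D2" for n
  proof -
    have 1: "J (1 / Suc n) x \<in> D" using J_properties(1)[of "1 / Suc n"] by simp
    then have "y n \<in> D" unfolding y_def by (rule J_in_D)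
    moreover have "A (y n) \<in> D"
      unfolding y_def using A_J[OF 1, of "1 / Suc n"] J_properties(1)[of "1 / Suc n"] by simp
    ultimately show ?thesis by (simp add: D2_def)
  qed
  have lim0: "(\<lambda>n. norm (J (1 / Suc n) x - x)) \<longlonglongrightarrow> 0"
    using J_tendsto_id[of x] by (intro tendsto_norm_zero) (simp add: LIM_zero)
  have "(\<lambda>n. y n - x) \<longlonglongrightarrow> 0"
  proof (rule Lim_null_comparison)
    show "\<forall>\<^sub>F n in sequentially. norm (y n - x) \<le> (K + 1) * norm (J (1 / Suc n) x - x)"
    proof (rule always_eventually, rule allI)
      fix n
      have "y n - x = J (1 / Suc n) (J (1 / Suc n) x - x) + (J (1 / Suc n) x - x)"
        by (simp add: y_def J_simps)
      also have "norm \<dots> \<le> K * norm (J (1 / Suc n) x - x) + norm (J (1 / Suc n) x - x)"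
        by (rule order_trans[OF norm_triangle_ineq add_right_mono[OF norm_J]])
      finally show "norm (y n - x) \<le> (K + 1) * norm (J (1 / Suc n) x - x)"
        by (simp add: algebra_simps)
    qed
    show "(\<lambda>n. (K + 1) * norm (J (1 / Suc n) x - x)) \<longlonglongrightarrow> 0"
      using tendsto_mult_right_zero[OF lim0] by simp
  qed
  then show "y \<longlonglongrightarrow> x" by (rule LIM_zero_cancel)
qed

text \<open>Consecutive iterates differ by \<open>h\<close> times an iterate of \<open>A x\<close>,
  and that iterate differs from \<open>A x\<close> by a similar sum in \<open>A (A x)\<close>.
  Summing twice gives the quadratic remainder.\<close>

lemma J_power_taylor:
  assumes x: "x \<in> D2" and h: "0 \<le> h" and C: "\<And>j. norm ((J h ^^ j) (A (A x))) \<le> C"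
  shows "norm ((J h ^^ i) x - x - (i * h) *\<^sub>R A x) \<le> (i * h)\<^sup>2 * C"
proof (induction i)
  case (Suc i)
  have xD: "x \<in> D" "A x \<in> D" using x by (auto simp: D2_def)
  have C0: "0 \<le> C" using C[of 0] norm_ge_zero order_trans by blast
  have AJ: "norm ((J h ^^ j) (A x) - A x) \<le> j * h * C" for j
  proof (induction j)
    case (Suc j)
    have "(J h ^^ Suc j) (A x) - (J h ^^ j) (A x) = h *\<^sub>R (J h ^^ Suc j) (A (A x))"
      using J_eq[OF h, of "(J h ^^ j) (A x)"] A_J_power[OF xD(2) h, of "Suc j"] by (simp add: algebra_simps)
    then have "(J h ^^ Suc j) (A x) - A x = h *\<^sub>R (J h ^^ Suc j) (A (A x)) + ((J h ^^ j) (A x) - A x)"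
      by (simp add: algebra_simps)
    also have "norm \<dots> \<le> h * C + j * h * C"
      using C[of "Suc j"] h Suc by (intro order_trans[OF norm_triangle_ineq] add_mono) (auto intro: mult_left_mono)
    finally show ?case by (simp add: algebra_simps)
  qed simp
  have "(J h ^^ Suc i) x - (J h ^^ i) x = h *\<^sub>R (J h ^^ Suc i) (A x)"
    using J_eq[OF h, of "(J h ^^ i) x"] A_J_power[OF xD(1) h, of "Suc i"] by (simp add: algebra_simps)
  then have "(J h ^^ Suc i) x - x - (Suc i * h) *\<^sub>R A x
      = ((J h ^^ i) x - x - (i * h) *\<^sub>R A x) + h *\<^sub>R ((J h ^^ Suc i) (A x) - A x)"
    by (simp add: algebra_simps)
  also have "norm \<dots> \<le> (i * h)\<^sup>2 * C + h * (Suc i * h * C)"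
    using AJ[of "Suc i"] h Suc
    by (intro order_trans[OF norm_triangle_ineq] add_mono) (auto intro: mult_left_mono)
  also have "\<dots> \<le> (Suc i * h)\<^sup>2 * C"
  proof -
    have "(Suc i * h)\<^sup>2 * C - ((i * h)\<^sup>2 * C + h * (Suc i * h * C)) = i * h\<^sup>2 * C"
      by (simp add: power2_eq_square algebra_simps)
    moreover have "0 \<le> i * h\<^sup>2 * C" using C0 by simp
    ultimately show ?thesis by linarith
  qed
  finally show ?case .
qed simp

text \<open>One coarse step and \<open>k\<close> fine ones both agree with
  \<open>x + h *\<^sub>R A x\<close> up to second order in \<open>h\<close>. The local errors are
  carried forward by powers of \<open>J h\<close>, which \<open>K\<close> bounds uniformly, so they
  merely add up.\<close>

lemma J_power_refine:
  assumes x: "x \<in> D2" and h: "0 \<le> h" and k: "0 < k" and C: "\<And>j. norm ((J (h / k) ^^ j) (A (A x))) \<le> C"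
  shows "norm ((J h ^^ n) x - (J (h / real k) ^^ (k * n)) x) \<le> n * (2 * K\<^sup>2 * h\<^sup>2 * C)"
  using x C
proof (induction n arbitrary: x)
  case (Suc n)
  define g where "g = h / real k"
  have g: "0 \<le> g" "k * g = h" using h k by (auto simp: g_def)
  define r where "r = (J g ^^ k) x"
  have xD: "x \<in> D" "A x \<in> D" using Suc.prems by (auto simp: D2_def)
  have Ar: "A r = (J g ^^ k) (A x)" "A (A r) = (J g ^^ k) (A (A x))" "r \<in> D"
    using A_J_power[OF xD(1) g(1)] A_J_power[OF xD(2) g(1)] J_power_in_D[OF xD(1)] by (auto simp: r_def)
  have rD: "r \<in> D2" using Ar J_power_in_D[OF xD(2)] by (simp add: D2_def)
  \<comment> \<open>Bounding all fine iterates of \<open>A (A x)\<close> makes the hypothesis pass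
    to the next starting point with the same \<open>C\<close>; a bound on \<open>A (A x)\<close>
    alone could grow by the factor \<open>K\<close>.\<close>
  have rC: "norm ((J (h / k) ^^ j) (A (A r))) \<le> C" for j
    using Suc.prems(2)[of "j + k"] Ar by (simp add: g_def funpow_add)
  have C0: "norm (A (A x)) \<le> C" using Suc.prems(2)[of 0] by simp
  have "norm ((J h ^^ j) (A (A x))) \<le> K * C" for j
    using norm_J_power[where h = h and n = j and x = "A (A x)"] mult_left_mono[OF C0, of K] K_ge_1 by linarith
  from J_power_taylor[OF Suc.prems(1) h this, of 1]
  have 1: "norm (J h x - x - h *\<^sub>R A x) \<le> h\<^sup>2 * (K * C)" by simp
  have 2: "norm (r - x - h *\<^sub>R A x) \<le> h\<^sup>2 * C"
    using J_power_taylor[OF Suc.prems(1) g(1), of C k] Suc.prems(2) g(2) unfolding r_def g_def[symmetric] by simp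
  have C00: "0 \<le> C" using C0 norm_ge_zero order_trans by blast
  have "h\<^sup>2 * C \<le> h\<^sup>2 * (K * C)"
    using K_ge_1 mult_right_mono[of 1 K C] C00 by (intro mult_left_mono) auto
  then have loc: "norm (J h x - r) \<le> 2 * (h\<^sup>2 * (K * C))"
    using norm_triangle_ineq4[of "J h x - x - h *\<^sub>R A x" "r - x - h *\<^sub>R A x"] 1 2 by simp
  have "(J h ^^ Suc n) x - (J g ^^ (k * Suc n)) x = (J h ^^ n) (J h x - r) + ((J h ^^ n) r - (J g ^^ (k * n)) r)"
    by (simp add: J_power_simps r_def funpow_add[symmetric] funpow_swap1 add.commute
        flip: comp_apply[of "J g ^^ _" "J g ^^ _"])
  also have "norm \<dots> \<le> K * (2 * (h\<^sup>2 * (K * C))) + n * (2 * K\<^sup>2 * h\<^sup>2 * C)"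
  proof (intro order_trans[OF norm_triangle_ineq] add_mono)
    show "norm ((J h ^^ n) (J h x - r)) \<le> K * (2 * (h\<^sup>2 * (K * C)))"
      using K_ge_1 loc by (intro order_trans[OF norm_J_power] mult_left_mono) auto
    show "norm ((J h ^^ n) r - (J g ^^ (k * n)) r) \<le> n * (2 * K\<^sup>2 * h\<^sup>2 * C)"
      unfolding g_def by (rule Suc.IH[OF rD rC])
  qed
  finally show ?case by (simp add: g_def power2_eq_square algebra_simps)
qed simp

text \<open>The resolvent identity \<open>J h x - J g x = (h - g) *\<^sub>R J h (J g (A x))\<close>,
  telescoped over \<open>n\<close> steps. It is the source of the Lipschitz continuity in time of
  the Euler limit.\<close>

lemma J_power_lipschitz:
  assumes x: "x \<in> D" and h: "0 \<le> h" "0 \<le> g" and C: "\<And>j. norm ((J g ^^ j) (A x)) \<le> C"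
  shows "norm ((J h ^^ n) x - (J g ^^ n) x) \<le> n * (K * \<bar>h - g\<bar> * C)"
  using x C
proof (induction n arbitrary: x)
  case (Suc n)
  have loc: "J h x - J g x = (h - g) *\<^sub>R J h (J g (A x))"
  proof -
    define Z W where "Z = J h (J g x)" and "W = J h (J g (A x))"
    have 1: "J h x = Z - g *\<^sub>R W"
      using arg_cong[OF J_unique[OF Suc.prems(1) h(2)], of "J h"] by (simp add: J_simps Z_def W_def)
    have 2: "J g x = Z - h *\<^sub>R W"
      using arg_cong[OF J_unique[OF Suc.prems(1) h(1)], of "J g"]
      unfolding J_commute[OF h(2,1)] by (simp add: J_simps Z_def W_def J_commute[OF h(2,1)])
    show ?thesis unfolding W_def[symmetric] 1 2 by (simp add: algebra_simps)
  qed
  have "(J h ^^ Suc n) x - (J g ^^ Suc n) x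
      = (h - g) *\<^sub>R (J h ^^ Suc n) (J g (A x)) + ((J h ^^ n) (J g x) - (J g ^^ n) (J g x))"
  proof -
    have "(J h ^^ n) (J h x) - (J h ^^ n) (J g x) = (h - g) *\<^sub>R (J h ^^ n) (J h (J g (A x)))"
      by (simp only: loc flip: J_power_simps)
    then show ?thesis by (simp add: funpow_swap1 diff_eq_eq)
  qed
  also have "norm \<dots> \<le> \<bar>h - g\<bar> * (K * C) + n * (K * \<bar>h - g\<bar> * C)"
  proof (intro order_trans[OF norm_triangle_ineq] add_mono)
    have "norm ((J h ^^ Suc n) (J g (A x))) \<le> K * norm (J g (A x))" by (rule norm_J_power)
    also have "\<dots> \<le> K * C" using Suc.prems(2)[of 1] K_ge_1 by (intro mult_left_mono) auto
    finally show "norm ((h - g) *\<^sub>R (J h ^^ Suc n) (J g (A x))) \<le> \<bar>h - g\<bar> * (K * C)"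
      by (simp add: mult_left_mono)
    show "norm ((J h ^^ n) (J g x) - (J g ^^ n) (J g x)) \<le> n * (K * \<bar>h - g\<bar> * C)"
    proof (rule Suc.IH)
      show "J g x \<in> D" by (rule J_in_D[OF Suc.prems(1)])
      show "norm ((J g ^^ j) (A (J g x))) \<le> C" for j
        using Suc.prems(2)[of "Suc j"] A_J[OF Suc.prems(1) h(2)] by (simp add: funpow_swap1)
    qed
  qed
  finally show ?case by (simp add: algebra_simps)
qed simp

end

context m_dissipative
begin

subsection \<open>The semigroup as a limit of implicit Euler schemes\<close>

text \<open>The exponential formula, with the number of steps counted from 1. Convergence is
  established on \<open>D2\<close>; other initial values are reached through limits of
  solutions.\<close>

definition S :: "real \<Rightarrow> 'z \<Rightarrow> 'z" where
  "S t x = lim (\<lambda>n. (J (t / real (Suc n)) ^^ Suc n) x)"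

definition c2 :: "'z \<Rightarrow> real" where "c2 x = 2 * K\<^sup>2 * (K * norm (A (A x)))"

lemma c2_nonneg: "0 \<le> c2 x" using K_ge_1 by (simp add: c2_def)

text \<open>Schemes with \<open>i\<close> and \<open>j\<close> steps are compared through their
  common refinement with \<open>i * j\<close> steps, which gives the Cauchy property without
  knowledge of the limit.\<close>

lemma S_rate:
  assumes x: "x \<in> D2" and t: "0 \<le> t" and n: "0 < n"
  shows "norm ((J (t / real n) ^^ n) x - S t x) \<le> t\<^sup>2 * c2 x / n"
proof -
  define u where "u n = (J (t / real n) ^^ n) x" for n :: nat
  have step: "norm (u n - u (k * n)) \<le> t\<^sup>2 * c2 x / n" if "0 < n" "0 < k" for n k
  proof -
    have "norm ((J (t / n) ^^ n) x - (J (t / n / real k) ^^ (k * n)) x)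
        \<le> n * (2 * K\<^sup>2 * (t / n)\<^sup>2 * (K * norm (A (A x))))"
      by (rule J_power_refine[OF x _ that(2) norm_J_power]) (use t in simp)
    also have "t / n / real k = t / real (k * n)" by (simp add: mult.commute)
    also have "n * (2 * K\<^sup>2 * (t / n)\<^sup>2 * (K * norm (A (A x)))) = t\<^sup>2 * c2 x / n"
      using that(1) by (simp add: c2_def power2_eq_square field_simps)
    finally show ?thesis by (simp add: u_def)
  qed
  have cau: "norm (u i - u j) \<le> t\<^sup>2 * c2 x / i + t\<^sup>2 * c2 x / j" if "0 < i" "0 < j" for i j
    using norm_triangle_ineq4[of "u i - u (j * i)" "u j - u (i * j)"] step[OF that] step[OF that(2,1)]
    by (simp add: mult.commute)
  have "Cauchy (\<lambda>n. u (Suc n))"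
  proof (rule CauchyI)
    fix e :: real assume e: "0 < e"
    obtain N :: nat where N: "t\<^sup>2 * c2 x / (e / 2) < N" using reals_Archimedean2 by blast
    have lt: "t\<^sup>2 * c2 x / Suc i < e / 2" if "i \<ge> N" for i
    proof -
      have "t\<^sup>2 * c2 x < (e / 2) * real N" using N e by (simp add: field_simps)
      also have "\<dots> \<le> (e / 2) * Suc i" using e that by (intro mult_left_mono) auto
      finally show ?thesis by (simp add: divide_less_eq)
    qed
    show "\<exists>N. \<forall>i\<ge>N. \<forall>j\<ge>N. norm (u (Suc i) - u (Suc j)) < e"
    proof (intro exI allI impI)
      fix i j assume "i \<ge> N" "j \<ge> N"
      then show "norm (u (Suc i) - u (Suc j)) < e" using cau[OF zero_less_Suc zero_less_Suc, of i j] lt[of i] lt[of j] by linarith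
    qed
  qed
  then have lim: "(\<lambda>n. u (Suc n)) \<longlonglongrightarrow> S t x"
    unfolding S_def u_def by (simp add: Cauchy_convergent_iff convergent_LIMSEQ_iff)
  \<comment> \<open>The refinement estimate holds along multiples of \<open>n\<close>; subtracting 1
    matches the indexing by \<open>Suc\<close> in \<open>S\<close>.\<close>
  have "strict_mono (\<lambda>i. Suc i * n - 1)"
    using n by (auto simp: strict_mono_Suc_iff)
  from LIMSEQ_subseq_LIMSEQ[OF lim this] have "(\<lambda>i. u (Suc (Suc i * n - 1))) \<longlonglongrightarrow> S t x"
    by (simp add: o_def)
  moreover have "Suc (Suc i * n - 1) = Suc i * n" for i using n by simp
  ultimately have "(\<lambda>i. u (Suc i * n)) \<longlonglongrightarrow> S t x" by simp
  then have "(\<lambda>i. norm (u n - u (Suc i * n))) \<longlonglongrightarrow> norm (u n - S t x)"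
    by (intro tendsto_intros)
  then have "norm (u n - S t x) \<le> t\<^sup>2 * c2 x / n"
    by (rule LIMSEQ_le_const2) (use step[OF n zero_less_Suc] in blast)
  then show ?thesis by (simp add: u_def)
qed

lemma S_mesh:
  assumes x: "x \<in> D2" and h: "0 \<le> h"
  shows "norm ((J h ^^ n) x - S (n * h) x) \<le> n * h\<^sup>2 * c2 x"
proof (cases "n = 0")
  case True
  have "(J 0 ^^ n) x = x" for n by (induction n) (simp_all add: J_0)
  then have "S 0 x = x" by (simp add: S_def J_0)
  then show ?thesis using True by simp
next
  case False
  then have "real n * h / real n = h" "(real n * h)\<^sup>2 * c2 x / n = n * h\<^sup>2 * c2 x"
    by (auto simp: power2_eq_square)
  then show ?thesis using S_rate[OF x, of "n * h" n] h False by simp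
qed

lemma S_tendsto:
  assumes "x \<in> D2" "0 \<le> t"
  shows "(\<lambda>n. (J (t / real (Suc n)) ^^ Suc n) x) \<longlonglongrightarrow> S t x"
proof (rule LIM_zero_cancel, rule Lim_null_comparison)
  show "(\<lambda>n. t\<^sup>2 * c2 x / real (Suc n)) \<longlonglongrightarrow> 0" by (rule LIMSEQ_Suc[OF lim_const_over_n])
  show "\<forall>\<^sub>F n in sequentially. norm ((J (t / real (Suc n)) ^^ Suc n) x - S t x) \<le> t\<^sup>2 * c2 x / real (Suc n)"
    by (rule always_eventually, rule allI, rule S_rate[OF assms]) simp
qed

lemma S_lipschitz:
  assumes x: "x \<in> D2" and ts: "0 \<le> t" "0 \<le> s"
  shows "norm (S t x - S s x) \<le> K\<^sup>2 * norm (A x) * \<bar>t - s\<bar>"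
proof (rule LIMSEQ_le_const2)
  show "(\<lambda>n. norm ((J (t / real (Suc n)) ^^ Suc n) x - (J (s / real (Suc n)) ^^ Suc n) x)) \<longlonglongrightarrow> norm (S t x - S s x)"
    by (intro tendsto_intros S_tendsto assms)
  have "norm ((J (t / real (Suc n)) ^^ Suc n) x - (J (s / real (Suc n)) ^^ Suc n) x) \<le> K\<^sup>2 * norm (A x) * \<bar>t - s\<bar>" for n
  proof -
    have "norm ((J (t / real (Suc n)) ^^ Suc n) x - (J (s / real (Suc n)) ^^ Suc n) x)
        \<le> Suc n * (K * \<bar>t / Suc n - s / Suc n\<bar> * (K * norm (A x)))"
      by (rule J_power_lipschitz[OF _ _ _ norm_J_power]) (use x ts in \<open>auto simp: D2_def\<close>)
    also have "\<bar>t / Suc n - s / Suc n\<bar> = \<bar>t - s\<bar> / Suc n"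
      by (simp add: diff_divide_distrib[symmetric] del: of_nat_Suc)
    also have "Suc n * (K * (\<bar>t - s\<bar> / Suc n) * (K * norm (A x))) = K\<^sup>2 * norm (A x) * \<bar>t - s\<bar>"
      by (simp add: power2_eq_square del: of_nat_Suc)
    finally show ?thesis .
  qed
  then show "\<exists>N. \<forall>n\<ge>N. norm ((J (t / real (Suc n)) ^^ Suc n) x - (J (s / real (Suc n)) ^^ Suc n) x) \<le> K\<^sup>2 * norm (A x) * \<bar>t - s\<bar>"
    by blast
qed

text \<open>The bounded operator \<open>J 1\<close> recovers \<open>X n\<close> from
  \<open>X n - A (X n)\<close>, and this relation passes to the limit.\<close>

lemma A_closed:
  assumes X: "\<And>n. X n \<in> D" "X \<longlonglongrightarrow> x" "(\<lambda>n. A (X n)) \<longlonglongrightarrow> y"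
  shows "x \<in> D" "A x = y"
proof -
  have "(\<lambda>n. J 1 (X n - A (X n))) \<longlonglongrightarrow> J 1 (x - y)"
    by (rule bounded_linear.tendsto[OF bounded_linear_J tendsto_diff[OF X(2,3)]])
  moreover have "J 1 (X n - A (X n)) = X n" for n
    using J_unique[where h = 1, OF X(1)[of n]] by simp
  ultimately have "X \<longlonglongrightarrow> J 1 (x - y)" by simp
  then have eq: "J 1 (x - y) = x" by (rule LIMSEQ_unique[OF _ X(2)])
  show "x \<in> D" using J_properties(1)[of 1 "x - y"] unfolding eq by simp
  show "A x = y" using J_properties(2)[of 1 "x - y"] unfolding eq by simp
qed

text \<open>A pair \<open>(x, y)\<close> belongs to the graph of \<open>A\<close> exactly if
  \<open>J 1 (x - y) = x\<close>, and the bounded operator in this equation commutes with the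
  integral.\<close>

lemma A_integral:
  assumes g: "continuous_on {a..b::real} g" "\<And>s. s \<in> {a..b} \<Longrightarrow> g s \<in> D"
    and Ag: "continuous_on {a..b} (\<lambda>s. A (g s))"
  shows "integral {a..b} g \<in> D" "A (integral {a..b} g) = integral {a..b} (\<lambda>s. A (g s))"
proof -
  have i: "g integrable_on {a..b}" "(\<lambda>s. A (g s)) integrable_on {a..b}"
    using g Ag by (auto intro: integrable_continuous_real)
  define G where "G = integral {a..b} g"
  define H where "H = integral {a..b} (\<lambda>s. A (g s))"
  have "J 1 (g s - A (g s)) = g s" if "s \<in> {a..b}" for s
    using J_unique[where h = 1, OF g(2)[OF that]] by simp
  then have "G = integral {a..b} (\<lambda>s. J 1 (g s - A (g s)))"
    unfolding G_def by (intro integral_cong) auto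
  also have "\<dots> = integral {a..b} (J 1 \<circ> (\<lambda>s. g s - A (g s)))" by (simp only: o_def)
  also have "\<dots> = J 1 (integral {a..b} (\<lambda>s. g s - A (g s)))"
    by (rule integral_linear[OF integrable_diff[OF i] bounded_linear_J])
  also have "integral {a..b} (\<lambda>s. g s - A (g s)) = G - H"
    unfolding G_def H_def by (rule Henstock_Kurzweil_Integration.integral_diff[OF i])
  finally have eq: "J 1 (G - H) = G" ..
  show "integral {a..b} g \<in> D"
    using J_properties(1)[of 1 "G - H"] unfolding eq by (simp add: G_def)
  show "A (integral {a..b} g) = integral {a..b} (\<lambda>s. A (g s))"
    using J_properties(2)[of 1 "G - H"] unfolding eq by (simp add: G_def H_def)
qed

lemma S_continuous:
  assumes x: "x \<in> D2"
  shows "continuous_on {0..} (\<lambda>t. S t x)"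
proof (rule lipschitz_on_continuous_on, rule lipschitz_onI)
  fix s t :: real assume "s \<in> {0..}" "t \<in> {0..}"
  then show "dist (S s x) (S t x) \<le> K\<^sup>2 * norm (A x) * dist s t"
    using S_lipschitz[OF x, of s t] by (simp add: dist_norm)
qed simp

text \<open>On each cell the integrand and the Euler iterate at the right end differ by the
  variation of \<open>S\<close> in time plus the error of the scheme at that mesh point.
  \<open>N\<close> makes the latter bound uniform, so that the induction on \<open>k\<close> adds
  equal terms.\<close>

lemma euler_sum_integral:
  assumes x: "x \<in> D2" and h: "0 \<le> h" and kN: "k \<le> N"
  shows "norm (integral {0..k * h} (\<lambda>s. S s x) - (\<Sum>i<k. h *\<^sub>R (J h ^^ Suc i) x))
    \<le> k * (h * (K\<^sup>2 * norm (A x) * h + N * h\<^sup>2 * c2 x))"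
  using kN
proof (induction k)
  case (Suc k)
  define E where "E = K\<^sup>2 * norm (A x) * h + N * h\<^sup>2 * c2 x"
  have S: "(\<lambda>s. S s x) integrable_on {a..b}" if "0 \<le> a" for a b
    by (rule integrable_continuous_real) (use that in \<open>auto intro: continuous_on_subset[OF S_continuous[OF x]]\<close>)
  have kh: "0 \<le> k * h" "k * h \<le> Suc k * h" using h by (auto intro: mult_right_mono)
  have "integral {0..k * h} (\<lambda>s. S s x) + integral {k * h..Suc k * h} (\<lambda>s. S s x) = integral {0..Suc k * h} (\<lambda>s. S s x)"
    by (rule Henstock_Kurzweil_Integration.integral_combine[OF kh S]) simp
  moreover have "integral {k * h..Suc k * h} (\<lambda>s. S s x - (J h ^^ Suc k) x)
      = integral {k * h..Suc k * h} (\<lambda>s. S s x) - h *\<^sub>R (J h ^^ Suc k) x"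
    using kh h by (subst Henstock_Kurzweil_Integration.integral_diff[OF S]) (auto simp: algebra_simps)
  ultimately have "integral {0..Suc k * h} (\<lambda>s. S s x) - (\<Sum>i<Suc k. h *\<^sub>R (J h ^^ Suc i) x)
      = (integral {0..k * h} (\<lambda>s. S s x) - (\<Sum>i<k. h *\<^sub>R (J h ^^ Suc i) x))
        + integral {k * h..Suc k * h} (\<lambda>s. S s x - (J h ^^ Suc k) x)"
    by (simp only: sum.lessThan_Suc) (simp add: algebra_simps del: funpow.simps)
  also have "norm \<dots> \<le> k * (h * E) + E * (Suc k * h - k * h)"
  proof (intro order_trans[OF norm_triangle_ineq] add_mono)
    show "norm (integral {0..k * h} (\<lambda>s. S s x) - (\<Sum>i<k. h *\<^sub>R (J h ^^ Suc i) x)) \<le> k * (h * E)"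
      unfolding E_def using Suc by simp
    show "norm (integral {k * h..Suc k * h} (\<lambda>s. S s x - (J h ^^ Suc k) x)) \<le> E * (Suc k * h - k * h)"
    proof (rule integral_bound[OF kh(2)])
      show "continuous_on {k * h..Suc k * h} (\<lambda>s. S s x - (J h ^^ Suc k) x)"
        using kh(1) by (intro continuous_intros continuous_on_subset[OF S_continuous[OF x]]) auto
      fix s assume s: "s \<in> {k * h..Suc k * h}"
      have "norm (S s x - S (Suc k * h) x) \<le> K\<^sup>2 * norm (A x) * \<bar>s - Suc k * h\<bar>"
        by (rule S_lipschitz[OF x]) (use s kh in auto)
      also have "\<dots> \<le> K\<^sup>2 * norm (A x) * h"
        using s by (intro mult_left_mono) (auto simp: algebra_simps)
      finally have 1: "norm (S s x - S (Suc k * h) x) \<le> K\<^sup>2 * norm (A x) * h" .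
      have "norm ((J h ^^ Suc k) x - S (Suc k * h) x) \<le> Suc k * h\<^sup>2 * c2 x" by (rule S_mesh[OF x h])
      also have "\<dots> \<le> N * h\<^sup>2 * c2 x"
        using Suc.prems c2_nonneg by (intro mult_right_mono) (auto simp del: of_nat_Suc)
      finally have 2: "norm ((J h ^^ Suc k) x - S (Suc k * h) x) \<le> N * h\<^sup>2 * c2 x" .
      show "norm (S s x - (J h ^^ Suc k) x) \<le> E"
        using norm_triangle_ineq4[of "S s x - S (Suc k * h) x" "(J h ^^ Suc k) x - S (Suc k * h) x"] 1 2
        by (simp add: E_def del: funpow.simps)
    qed
  qed
  also have "\<dots> = Suc k * (h * E)" by (simp add: algebra_simps)
  finally show ?case by (simp add: E_def)
qed simp

text \<open>By the Euler equation, \<open>A\<close> applied to the Riemann sum of the iterates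
  telescopes to the last iterate minus \<open>x\<close>. Both sides converge and \<open>A\<close> is
  closed.\<close>

lemma mild_solution_S:
  assumes x: "x \<in> D2"
  shows "mild_solution D A T (\<lambda>_. 0) x (\<lambda>t. S t x)"
  unfolding mild_solution_def
proof (intro conjI ballI)
  show "continuous_on {0..T} (\<lambda>t. S t x)" by (rule continuous_on_subset[OF S_continuous[OF x]]) auto
  fix t assume "t \<in> {0..T}"
  then have t: "0 \<le> t" by simp
  define h where "h n = t / real (Suc n)" for n
  have h: "0 \<le> h n" "real (Suc n) * h n = t" for n
    using t by (auto simp: h_def simp del: of_nat_Suc)
  define X where "X n = (\<Sum>i<Suc n. h n *\<^sub>R (J (h n) ^^ Suc i) x)" for n
  have xD: "x \<in> D" using x by (simp add: D2_def)
  have part: "(\<Sum>i<k. h n *\<^sub>R (J (h n) ^^ Suc i) x) \<in> D \<and>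
      A (\<Sum>i<k. h n *\<^sub>R (J (h n) ^^ Suc i) x) = (J (h n) ^^ k) x - x" for n k
  proof (induction k)
    case (Suc k)
    have jD: "(J (h n) ^^ Suc k) x \<in> D" by (rule J_power_in_D[OF xD])
    have "h n *\<^sub>R A ((J (h n) ^^ Suc k) x) = (J (h n) ^^ Suc k) x - (J (h n) ^^ k) x"
      using J_eq[OF h(1), of n "(J (h n) ^^ k) x"] by (simp add: algebra_simps)
    then show ?case
      using Suc D_closed(3)[OF jD jD, of "h n"] D_closed(1) A_linear(1) A_linear(3)[OF jD, of "h n"]
      by (simp del: funpow.simps)
  qed (simp add: zero_in_D A_zero)
  have lim: "X \<longlonglongrightarrow> integral {0..t} (\<lambda>s. S s x)"
  proof (rule LIM_zero_cancel, rule Lim_null_comparison)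
    define C where "C = t * (K\<^sup>2 * norm (A x) * t + t\<^sup>2 * c2 x)"
    show "(\<lambda>n. C / real (Suc n)) \<longlonglongrightarrow> 0" by (rule LIMSEQ_Suc[OF lim_const_over_n])
    have "norm (X n - integral {0..t} (\<lambda>s. S s x)) \<le> C / real (Suc n)" for n
    proof -
      have "norm (integral {0..Suc n * h n} (\<lambda>s. S s x) - X n)
          \<le> Suc n * (h n * (K\<^sup>2 * norm (A x) * h n + Suc n * (h n)\<^sup>2 * c2 x))"
        unfolding X_def by (rule euler_sum_integral[OF x h(1)]) simp
      also have "\<dots> = (Suc n * h n) * (K\<^sup>2 * norm (A x) * h n + (Suc n * h n) * h n * c2 x)"
        by (simp add: power2_eq_square algebra_simps)
      also have "\<dots> = C / real (Suc n)"
        unfolding h(2) by (simp add: C_def h_def power2_eq_square add_divide_distrib algebra_simps del: of_nat_Suc)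
      finally show ?thesis unfolding h(2) by (simp add: norm_minus_commute)
    qed
    then show "\<forall>\<^sub>F n in sequentially. norm (X n - integral {0..t} (\<lambda>s. S s x)) \<le> C / real (Suc n)"
      by (intro always_eventually allI)
  qed
  have AX: "(\<lambda>n. A (X n)) \<longlonglongrightarrow> S t x - x"
  proof -
    have "A (X n) = (J (t / real (Suc n)) ^^ Suc n) x - x" for n
      using part[of n "Suc n"] by (simp only: X_def h_def)
    then show ?thesis by (simp only:) (intro tendsto_intros S_tendsto x t)
  qed
  have XD: "X n \<in> D" for n unfolding X_def using part by blast
  show "integral {0..t} (\<lambda>s. S s x) \<in> D" by (rule A_closed(1)[OF XD lim AX])
  show "S t x = x + A (integral {0..t} (\<lambda>s. S s x)) + integral {0..t} (\<lambda>_. 0)"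
    using A_closed(2)[OF XD lim AX] by simp
qed

subsection \<open>Inhomogeneous equations\<close>

lemma mild_solution_bound:
  assumes sol: "mild_solution D A T F x \<phi>" and F: "continuous_on {0..T} F"
    and T: "0 < T" and f: "\<And>s. s \<in> {0..T} \<Longrightarrow> norm (F s) \<le> f" and t: "t \<in> {0..T}"
  shows "(norm (\<phi> t))\<^sup>2 \<le> exp T * \<bar>M\<bar> * (1 + T) / m * ((norm x)\<^sup>2 + f\<^sup>2)"
proof -
  have cont: "continuous_on {0..T} \<phi>" using sol by (simp add: mild_solution_def)
  have BM: "B y y \<le> \<bar>M\<bar> * (norm y)\<^sup>2" for y
    using bounded[of y] mult_right_mono[OF abs_ge_self zero_le_power2, of M "norm y"] by linarith
  have ok: "(norm (\<phi> t))\<^sup>2 \<le> exp T * \<bar>M\<bar> * (1 + T) / m * ((norm x)\<^sup>2 + f\<^sup>2)" if t: "0 \<le> t" "t < T" for t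
  proof -
    \<comment> \<open>The negative weight leaves \<open>- B (\<phi> s) (\<phi> s)\<close> under the
      integral, which completes the square with the mixed term and replaces Gronwall's
      inequality.\<close>
    have "exp (2 * (- 1 / 2) * t) * B (\<phi> t) (\<phi> t) \<le> B x x + integral {0..t} (\<lambda>s. exp (2 * (- 1 / 2) * s) *
        (2 * (- 1 / 2 - 0) * B (\<phi> s) (\<phi> s) + 2 * B (\<phi> s) (F s)))"
      by (rule mild_solution_energy[OF sol F bilinear sym _ t]) (use dissipative in auto)
    also have "\<dots> \<le> \<bar>M\<bar> * (norm x)\<^sup>2 + integral {0..t} (\<lambda>s. \<bar>M\<bar> * f\<^sup>2)"
    proof (intro add_mono BM integral_le)
      show "(\<lambda>s. exp (2 * (- 1 / 2) * s) * (2 * (- 1 / 2 - 0) * B (\<phi> s) (\<phi> s) + 2 * B (\<phi> s) (F s))) integrable_on {0..t}"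
        using t by (intro integrable_continuous_real continuous_intros B.continuous_on
          continuous_on_subset[OF cont] continuous_on_subset[OF F]) auto
      fix s assume s: "s \<in> {0..t}"
      have "2 * B (\<phi> s) (F s) - B (\<phi> s) (\<phi> s) \<le> B (F s) (F s)"
        using B_nonneg[of "\<phi> s - F s"] sym[of "F s" "\<phi> s"] by (simp add: B.diff_left B.diff_right)
      also have "\<dots> \<le> \<bar>M\<bar> * f\<^sup>2"
        using s t f[of s] by (intro order_trans[OF BM] mult_left_mono power_mono) auto
      finally have 1: "2 * B (\<phi> s) (F s) - B (\<phi> s) (\<phi> s) \<le> \<bar>M\<bar> * f\<^sup>2" .
      have "exp (- s) * (2 * B (\<phi> s) (F s) - B (\<phi> s) (\<phi> s)) \<le> exp (- s) * (\<bar>M\<bar> * f\<^sup>2)"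
        by (rule mult_left_mono[OF 1]) simp
      also have "\<dots> \<le> 1 * (\<bar>M\<bar> * f\<^sup>2)" using s by (intro mult_right_mono) auto
      finally show "exp (2 * (- 1 / 2) * s) * (2 * (- 1 / 2 - 0) * B (\<phi> s) (\<phi> s) + 2 * B (\<phi> s) (F s)) \<le> \<bar>M\<bar> * f\<^sup>2"
        by simp
    qed (rule integrable_const_ivl)
    also have "\<dots> \<le> \<bar>M\<bar> * (1 + T) * ((norm x)\<^sup>2 + f\<^sup>2)"
    proof -
      have "0 \<le> \<bar>M\<bar> * (T * (norm x)\<^sup>2 + (1 + T - t) * f\<^sup>2)"
        using t T by (intro mult_nonneg_nonneg add_nonneg_nonneg) auto
      then show ?thesis using t by (simp add: algebra_simps)
    qed
    finally have "exp (- t) * B (\<phi> t) (\<phi> t) \<le> \<bar>M\<bar> * (1 + T) * ((norm x)\<^sup>2 + f\<^sup>2)" by simp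
    from mult_left_mono[OF this, of "exp t"]
    have "B (\<phi> t) (\<phi> t) \<le> exp t * (\<bar>M\<bar> * (1 + T) * ((norm x)\<^sup>2 + f\<^sup>2))"
      by (simp add: mult.assoc[symmetric] exp_minus)
    also have "\<dots> \<le> exp T * (\<bar>M\<bar> * (1 + T) * ((norm x)\<^sup>2 + f\<^sup>2))"
      using t by (intro mult_right_mono) auto
    finally have "m * (norm (\<phi> t))\<^sup>2 \<le> exp T * (\<bar>M\<bar> * (1 + T) * ((norm x)\<^sup>2 + f\<^sup>2))"
      using coercive[of "\<phi> t"] by linarith
    then show ?thesis using m_pos by (simp add: pos_le_divide_eq mult_ac)
  qed
  \<comment> \<open>The energy estimate looks ahead in time and stops short of \<open>T\<close>;
    continuity supplies the endpoint.\<close>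
  have cl: "closure {0..<T} = {0..T}" using T by simp
  show ?thesis
  proof (rule continuous_le_on_closure[where f = "\<lambda>t. (norm (\<phi> t))\<^sup>2" and S = "{0..<T}"])
    show "continuous_on (closure {0..<T}) (\<lambda>t. (norm (\<phi> t))\<^sup>2)"
      unfolding cl by (intro continuous_intros cont)
  qed (use ok t cl in auto)
qed

text \<open>The a priori bound for differences makes the solutions uniformly Cauchy, and closedness
  of \<open>A\<close> identifies the limit. Existence thus reduces to dense initial values and
  simple inhomogeneities.\<close>

lemma mild_solution_limit:
  assumes sol: "\<And>n::nat. mild_solution D A T (F n) (x n) (\<phi> n)" and F: "\<And>n. continuous_on {0..T} (F n)"
    and T: "0 < T" and G: "uniform_limit {0..T} F G sequentially" and y: "x \<longlonglongrightarrow> y"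
  obtains \<psi> where "mild_solution D A T G y \<psi>"
proof -
  define C where "C = exp T * \<bar>M\<bar> * (1 + T) / m + 1"
  have C: "0 < C" using T m_pos unfolding C_def by (intro add_nonneg_pos divide_nonneg_pos) auto
  have cont: "continuous_on {0..T} (\<phi> n)" for n using sol by (simp add: mild_solution_def)
  have "uniformly_Cauchy_on {0..T} \<phi>"
  proof (rule uniformly_Cauchy_onI)
    fix e :: real assume e: "0 < e"
    define d where "d = e / sqrt (2 * C)"
    have d: "0 < d" "2 * C * d\<^sup>2 = e\<^sup>2" using e C by (auto simp: d_def power_divide)
    have "uniformly_Cauchy_on {0..T} F"
      by (rule uniformly_convergent_Cauchy) (use G in \<open>auto simp: uniformly_convergent_on_def\<close>)
    then obtain N1 where N1: "\<And>s m n. s \<in> {0..T} \<Longrightarrow> m \<ge> N1 \<Longrightarrow> n \<ge> N1 \<Longrightarrow> dist (F m s) (F n s) < d / 2"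
      using half_gt_zero[OF d(1)] unfolding uniformly_Cauchy_on_def by blast
    obtain N2 where N2: "\<And>m n. m \<ge> N2 \<Longrightarrow> n \<ge> N2 \<Longrightarrow> norm (x m - x n) < d / 2"
      using CauchyD[OF LIMSEQ_imp_Cauchy[OF y], of "d / 2"] d(1) by auto
    show "\<exists>N. \<forall>s\<in>{0..T}. \<forall>m\<ge>N. \<forall>n\<ge>N. dist (\<phi> m s) (\<phi> n s) < e"
    proof (intro exI[of _ "max N1 N2"] ballI allI impI)
      fix s i j assume s: "s \<in> {0..T}" and ij: "max N1 N2 \<le> i" "max N1 N2 \<le> j"
      have sol': "mild_solution D A T (\<lambda>t. 1 *\<^sub>R F i t + (-1) *\<^sub>R F j t) (1 *\<^sub>R x i + (-1) *\<^sub>R x j)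
          (\<lambda>t. 1 *\<^sub>R \<phi> i t + (-1) *\<^sub>R \<phi> j t)"
        by (rule mild_solution_lincomb[OF sol sol F F])
      have "norm (1 *\<^sub>R F i r + (-1) *\<^sub>R F j r) \<le> d / 2" if "r \<in> {0..T}" for r
        using N1[OF that, of i j] ij by (simp add: dist_norm)
      then have "(norm (1 *\<^sub>R \<phi> i s + (-1) *\<^sub>R \<phi> j s))\<^sup>2
          \<le> exp T * \<bar>M\<bar> * (1 + T) / m * ((norm (1 *\<^sub>R x i + (-1) *\<^sub>R x j))\<^sup>2 + (d / 2)\<^sup>2)"
        by (intro mild_solution_bound[OF sol' _ T _ s] continuous_intros F)
      also have "\<dots> \<le> C * ((d / 2)\<^sup>2 + (d / 2)\<^sup>2)"
        using N2[of i j] ij C T m_pos d(1) unfolding C_def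
        by (intro mult_mono add_mono power_mono) auto
      also have "\<dots> = (2 * C * d\<^sup>2) / 4" by (simp add: power_divide)
      also have "\<dots> < e\<^sup>2" unfolding d(2) using e by simp
      finally have "(norm (\<phi> i s - \<phi> j s))\<^sup>2 < e\<^sup>2" by simp
      then show "dist (\<phi> i s) (\<phi> j s) < e"
        using e by (simp add: dist_norm power2_less_imp_less)
    qed
  qed
  then obtain \<psi> where \<psi>: "uniform_limit {0..T} \<phi> \<psi> sequentially"
    using Cauchy_uniformly_convergent[of "{0..T}" \<phi>] by (auto simp: uniformly_convergent_on_def)
  have int_lim: "(\<lambda>n. integral {0..t} (g n)) \<longlonglongrightarrow> integral {0..t} k"
    if "uniform_limit {0..T} g k sequentially" "\<And>n::nat. continuous_on {0..T} (g n)" "t \<in> {0..T}"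
    for g :: "nat \<Rightarrow> real \<Rightarrow> 'z" and k t
    using that(3)
    by (intro tendsto_integral_uniform_limit uniform_limit_on_subset[OF that(1)] continuous_on_subset[OF that(2)]) auto
  show thesis
  proof (rule that, unfold mild_solution_def, intro conjI ballI)
    show "continuous_on {0..T} \<psi>"
      by (rule uniform_limit_theorem[OF _ \<psi>]) (use cont in auto)
    fix t assume t: "t \<in> {0..T}"
    have pD: "integral {0..t} (\<phi> n) \<in> D" and pA: "A (integral {0..t} (\<phi> n)) = \<phi> n t - x n - integral {0..t} (F n)" for n
      using sol[of n] t by (auto simp: mild_solution_def)
    have l2: "(\<lambda>n. A (integral {0..t} (\<phi> n))) \<longlonglongrightarrow> \<psi> t - y - integral {0..t} G"
      unfolding pA by (intro tendsto_intros y int_lim[OF G F t] tendsto_uniform_limitI[OF \<psi> t])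
    note l1 = int_lim[OF \<psi> cont t]
    show "integral {0..t} \<psi> \<in> D" by (rule A_closed(1)[OF pD l1 l2])
    show "\<psi> t = y + A (integral {0..t} \<psi>) + integral {0..t} G"
      using A_closed(2)[OF pD l1 l2] by simp
  qed
qed

end

lemma mild_solution_cong:
  assumes "mild_solution D A T F x \<phi>" "\<And>s. s \<in> {0..T} \<Longrightarrow> F s = G s"
  shows "mild_solution D A T G x \<phi>"
proof -
  have "integral {0..t} F = integral {0..t} G" if "t \<in> {0..T}" for t
    by (rule integral_cong) (use assms(2) that in auto)
  then show ?thesis using assms(1) by (auto simp: mild_solution_def)
qed

lemma integral_power_scaleR:
  fixes y :: "'z::banach"
  assumes "0 \<le> t"
  shows "integral {0..t} (\<lambda>s. s ^ j *\<^sub>R y) = (t ^ Suc j / real (Suc j)) *\<^sub>R y"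
proof -
  have "((\<lambda>s. s ^ j) has_integral t ^ Suc j / real (Suc j) - 0 ^ Suc j / real (Suc j)) {0..t}"
  proof (rule fundamental_theorem_of_calculus[OF assms])
    fix s :: real
    show "((\<lambda>s. s ^ Suc j / real (Suc j)) has_vector_derivative s ^ j) (at s within {0..t})"
      unfolding has_real_derivative_iff_has_vector_derivative[symmetric]
      using DERIV_cdivide[OF DERIV_pow[of "Suc j" s "{0..t}"], of "real (Suc j)"]
      by (simp del: of_nat_Suc)
  qed
  then show ?thesis by (intro integral_unique has_integral_scaleR_left) simp
qed

context m_dissipative
begin

text \<open>Integration in time turns an initial value into a constant inhomogeneity. Starting from
  the homogeneous equation and iterating, one obtains every \<open>t ^ j *\<^sub>R y\<close> as
  inhomogeneity, in place of a Duhamel formula.\<close>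

lemma mild_solution_primitive:
  assumes sol: "mild_solution D A T F x \<phi>" and F: "continuous_on {0..T} F"
  shows "mild_solution D A T (\<lambda>t. x + integral {0..t} F) 0 (\<lambda>t. integral {0..t} \<phi>)"
  unfolding mild_solution_def
proof (intro conjI ballI)
  have cont: "continuous_on {0..T} \<phi>" using sol by (simp add: mild_solution_def)
  have prim: "continuous_on {0..T} (\<lambda>t. integral {0..t} g)" if "continuous_on {0..T} g" for g :: "real \<Rightarrow> 'z"
    by (rule indefinite_integral_continuous_1[OF integrable_continuous_real[OF that]])
  show "continuous_on {0..T} (\<lambda>t. integral {0..t} \<phi>)" by (rule prim[OF cont])
  fix t assume t: "t \<in> {0..T}"
  then have sub: "{0..t} \<subseteq> {0..T}" by auto
  have c: "continuous_on {0..t} (\<lambda>s. \<phi> s)" "continuous_on {0..t} (\<lambda>s. x + integral {0..s} F)"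
      "continuous_on {0..t} (\<lambda>s. integral {0..s} \<phi>)"
    by (intro continuous_intros continuous_on_subset[OF _ sub] cont prim F)+
  have s: "integral {0..s} \<phi> \<in> D" "A (integral {0..s} \<phi>) = \<phi> s - (x + integral {0..s} F)" if "s \<in> {0..t}" for s
    using sol that sub by (auto simp: mild_solution_def)
  have cA: "continuous_on {0..t} (\<lambda>s. A (integral {0..s} \<phi>))"
    using continuous_on_diff[OF c(1,2)] by (rule continuous_on_eq) (simp add: s(2))
  show "integral {0..t} (\<lambda>t. integral {0..t} \<phi>) \<in> D" by (rule A_integral(1)[OF c(3) s(1) cA])
  have "A (integral {0..t} (\<lambda>t. integral {0..t} \<phi>)) = integral {0..t} (\<lambda>s. A (integral {0..s} \<phi>))"
    by (rule A_integral(2)[OF c(3) s(1) cA])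
  also have "\<dots> = integral {0..t} (\<lambda>s. \<phi> s - (x + integral {0..s} F))"
    by (rule integral_cong) (simp add: s(2))
  also have "\<dots> = integral {0..t} \<phi> - integral {0..t} (\<lambda>s. x + integral {0..s} F)"
    by (intro Henstock_Kurzweil_Integration.integral_diff integrable_continuous_real c)
  finally show "integral {0..t} \<phi> = 0 + A (integral {0..t} (\<lambda>t. integral {0..t} \<phi>)) +
      integral {0..t} (\<lambda>t. x + integral {0..t} F)" by simp
qed

lemma ex_mild_solution_homogeneous:
  assumes "0 < T"
  obtains \<phi> where "mild_solution D A T (\<lambda>_. 0) x \<phi>"
proof -
  obtain y where y: "\<And>n. y n \<in> D2" "y \<longlonglongrightarrow> x" by (rule D2_dense[of x], rule that)
  show thesis
  proof (rule mild_solution_limit[OF mild_solution_S[OF y(1)] _ assms _ y(2)])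
    show "uniform_limit {0..T} (\<lambda>n x. 0) (\<lambda>x. 0) sequentially" by (rule uniform_limit_const)
  qed (use that in auto)
qed

text \<open>These inhomogeneities form a linear space closed under uniform limits, so that monomials
  in time with vector coefficients generate all continuous functions.\<close>

definition admissible :: "real \<Rightarrow> (real \<Rightarrow> 'z) \<Rightarrow> bool" where
  "admissible T F \<longleftrightarrow> continuous_on {0..T} F \<and> (\<exists>\<phi>. mild_solution D A T F 0 \<phi>)"

lemma admissible_lincomb:
  assumes "admissible T F" "admissible T G"
  shows "admissible T (\<lambda>t. c *\<^sub>R F t + d *\<^sub>R G t)"
  using assms mild_solution_lincomb[of T F 0 _ G 0 _ c d]
  unfolding admissible_def by (auto intro!: continuous_intros)

lemma admissible_limit:
  assumes F: "\<And>n::nat. admissible T (F n)" and T: "0 < T" and lim: "uniform_limit {0..T} F G sequentially"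
  shows "admissible T G"
proof -
  obtain \<phi> where \<phi>: "\<And>n. mild_solution D A T (F n) 0 (\<phi> n)"
    using F unfolding admissible_def by metis
  have cont: "continuous_on {0..T} (F n)" for n using F by (simp add: admissible_def)
  obtain \<psi> where "mild_solution D A T G 0 \<psi>"
    by (rule mild_solution_limit[OF \<phi> cont T lim tendsto_const])
  moreover have "continuous_on {0..T} G"
    by (rule uniform_limit_theorem[OF _ lim]) (use cont in auto)
  ultimately show ?thesis by (auto simp: admissible_def)
qed

lemma admissible_power:
  assumes T: "0 < T"
  shows "admissible T (\<lambda>t. t ^ j *\<^sub>R y)"
proof (induction j)
  case 0
  obtain \<phi> where \<phi>: "mild_solution D A T (\<lambda>_. 0) y \<phi>" by (rule ex_mild_solution_homogeneous[OF T])
  have "mild_solution D A T (\<lambda>t. y + integral {0..t} (\<lambda>_. 0)) 0 (\<lambda>t. integral {0..t} \<phi>)"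
    by (rule mild_solution_primitive[OF \<phi>]) simp
  then show ?case by (auto simp: admissible_def)
next
  case (Suc j)
  then obtain \<phi> where \<phi>: "mild_solution D A T (\<lambda>t. t ^ j *\<^sub>R y) 0 \<phi>" by (auto simp: admissible_def)
  have "mild_solution D A T (\<lambda>t. 0 + integral {0..t} (\<lambda>s. s ^ j *\<^sub>R y)) 0 (\<lambda>t. integral {0..t} \<phi>)"
    by (rule mild_solution_primitive[OF \<phi>]) (auto intro!: continuous_intros)
  from mild_solution_cong[OF this, of "\<lambda>t. (t ^ Suc j / real (Suc j)) *\<^sub>R y"]
  have "admissible T (\<lambda>t. (t ^ Suc j / real (Suc j)) *\<^sub>R y)"
    unfolding admissible_def by (auto simp: integral_power_scaleR simp del: of_nat_Suc intro!: continuous_intros)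
  from admissible_lincomb[OF this this, of "real (Suc j)" 0] show ?case
    by (simp del: of_nat_Suc power_Suc)
qed

lemma admissible_sum:
  assumes "finite I" "0 < T" "\<And>i. i \<in> I \<Longrightarrow> admissible T (F i)"
  shows "admissible T (\<lambda>t. \<Sum>i\<in>I. F i t)"
  using assms(1,3)
proof (induction I rule: finite_induct)
  case empty
  then show ?case using admissible_power[OF assms(2), of 0 0] by simp
next
  case (insert i I)
  then show ?case using admissible_lincomb[of T "F i" "\<lambda>t. \<Sum>i\<in>I. F i t" 1 1] by simp
qed

lemma admissible_scalar:
  assumes T: "0 < T" and a: "continuous_on {0..T} a"
  shows "admissible T (\<lambda>t. a t *\<^sub>R y)"
proof -
  have "\<exists>p. real_polynomial_function p \<and> (\<forall>t\<in>{0..T}. \<bar>a t - p t\<bar> < 1 / real (Suc n))" for n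
  proof -
    have "(0::real) < 1 / real (Suc n)" by simp
    from Stone_Weierstrass_real_polynomial_function[OF compact_Icc a this] show ?thesis by metis
  qed
  then obtain p where p: "\<And>n. real_polynomial_function (p n)"
      "\<And>n t. t \<in> {0..T} \<Longrightarrow> \<bar>a t - p n t\<bar> < 1 / real (Suc n)" by metis
  have "admissible T (\<lambda>t. p n t *\<^sub>R y)" for n
  proof -
    obtain b N where "p n = (\<lambda>t. \<Sum>i\<le>N. b i * t ^ i)"
      using p(1)[of n] unfolding real_polynomial_function_iff_sum by auto
    moreover have "admissible T (\<lambda>t. \<Sum>i\<le>N. t ^ i *\<^sub>R b i *\<^sub>R y)"
      by (intro admissible_sum T admissible_power) auto
    ultimately show ?thesis by (simp add: scaleR_left.sum mult.commute)
  qed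
  moreover have "uniform_limit {0..T} (\<lambda>n t. p n t *\<^sub>R y) (\<lambda>t. a t *\<^sub>R y) sequentially"
  proof (rule uniform_limitI)
    fix e :: real assume e: "0 < e"
    have "(\<lambda>n. norm y / real (Suc n)) \<longlonglongrightarrow> 0" by (rule LIMSEQ_Suc[OF lim_const_over_n])
    from order_tendstoD(2)[OF this e]
    show "\<forall>\<^sub>F n in sequentially. \<forall>t\<in>{0..T}. dist (p n t *\<^sub>R y) (a t *\<^sub>R y) < e"
    proof eventually_elim
      case (elim n)
      show ?case
      proof
        fix t assume t: "t \<in> {0..T}"
        have "dist (p n t *\<^sub>R y) (a t *\<^sub>R y) = \<bar>a t - p n t\<bar> * norm y"
          by (simp add: dist_norm abs_minus_commute flip: scaleR_diff_left)
        also have "\<dots> \<le> 1 / real (Suc n) * norm y"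
          using p(2)[OF t, of n] by (intro mult_right_mono) auto
        finally show "dist (p n t *\<^sub>R y) (a t *\<^sub>R y) < e" using elim by simp
      qed
    qed
  qed
  ultimately show ?thesis by (rule admissible_limit[OF _ T])
qed

text \<open>A continuous inhomogeneity is uniformly approximated by finite sums of scalar functions times
  constant vectors by means of a partition of unity into normalised hat functions.\<close>

lemma admissible_continuous:
  assumes T: "0 < T" and F: "continuous_on {0..T} F"
  shows "admissible T F"
proof -
  have approx: "\<exists>G. admissible T G \<and> (\<forall>t\<in>{0..T}. norm (G t - F t) \<le> e)" if e: "0 < e" for e
  proof -
    have "uniformly_continuous_on {0..T} F" by (rule compact_uniformly_continuous[OF F]) simp
    then obtain d where d: "0 < d" "\<And>s t. s \<in> {0..T} \<Longrightarrow> t \<in> {0..T} \<Longrightarrow> dist t s < d \<Longrightarrow> dist (F t) (F s) < e"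
      using e unfolding uniformly_continuous_on_def by metis
    obtain k where k: "finite k" "k \<subseteq> {0..T}" "{0..T} \<subseteq> (\<Union>c\<in>k. ball c d)"
      using seq_compact_imp_totally_bounded[of "{0..T}"] d(1) compact_imp_seq_compact[of "{0..T}"] by auto
    \<comment> \<open>A hat vanishes at distance \<open>d\<close> from its centre, so every
      \<open>F c\<close> that enters \<open>G t\<close> with nonzero weight is within
      \<open>e\<close> of \<open>F t\<close>.\<close>
    define w where "w c t = max 0 (d - \<bar>t - c\<bar>)" for c t :: real
    define W where "W t = (\<Sum>c\<in>k. w c t)" for t
    have w0: "0 \<le> w c t" for c t by (simp add: w_def)
    have W: "0 < W t" if t: "t \<in> {0..T}" for t
    proof -
      obtain c where c: "c \<in> k" "t \<in> ball c d" using k(3) t by blast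
      then have "0 < w c t" by (auto simp: w_def dist_real_def abs_minus_commute)
      then show ?thesis unfolding W_def using c(1) k(1) w0 by (intro sum_pos2[of k c]) auto
    qed
    have wc: "continuous_on {0..T} (w c)" for c unfolding w_def by (intro continuous_intros)
    define G where "G t = (\<Sum>c\<in>k. (w c t / W t) *\<^sub>R F c)" for t
    have "admissible T G"
      unfolding G_def W_def
    proof (intro admissible_sum[OF k(1) T] admissible_scalar[OF T])
      fix c show "continuous_on {0..T} (\<lambda>t. w c t / (\<Sum>c\<in>k. w c t))"
        by (intro continuous_intros wc) (use W in \<open>force simp: W_def\<close>)
    qed
    moreover have "norm (G t - F t) \<le> e" if t: "t \<in> {0..T}" for t
    proof -
      have sum1: "(\<Sum>c\<in>k. w c t / W t) = 1"
        using W[OF t] by (simp add: W_def flip: sum_divide_distrib)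
      have "F t = (\<Sum>c\<in>k. (w c t / W t) *\<^sub>R F t)" by (simp add: sum1 flip: scaleR_left.sum)
      then have "G t - F t = (\<Sum>c\<in>k. (w c t / W t) *\<^sub>R (F c - F t))"
        unfolding G_def by (simp add: sum_subtractf scaleR_diff_right)
      also have "norm \<dots> \<le> (\<Sum>c\<in>k. (w c t / W t) * e)"
      proof (rule sum_norm_le)
        fix c assume c: "c \<in> k"
        show "norm ((w c t / W t) *\<^sub>R (F c - F t)) \<le> (w c t / W t) * e"
        proof (cases "w c t = 0")
          case False
          then have "dist c t < d" by (auto simp: w_def dist_real_def abs_minus_commute split: if_splits)
          then have "norm (F c - F t) \<le> e" using d(2)[of t c] c k(2) t by (auto simp: dist_norm)
          then have "\<bar>w c t / W t\<bar> * norm (F c - F t) \<le> \<bar>w c t / W t\<bar> * e" by (rule mult_left_mono) simp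
          then show ?thesis using w0[of c t] W[OF t] by simp
        qed simp
      qed
      also have "\<dots> = (\<Sum>c\<in>k. w c t / W t) * e" by (rule sum_distrib_right[symmetric])
      also have "\<dots> = e" by (simp only: sum1 mult_1)
      finally show ?thesis .
    qed
    ultimately show ?thesis by blast
  qed
  then have "\<exists>G. admissible T G \<and> (\<forall>t\<in>{0..T}. norm (G t - F t) \<le> 1 / real (Suc n))" for n
    by simp
  then obtain G where G: "\<And>n. admissible T (G n)" "\<And>n t. t \<in> {0..T} \<Longrightarrow> norm (G n t - F t) \<le> 1 / real (Suc n)"
    by metis
  have "uniform_limit {0..T} G F sequentially"
  proof (rule uniform_limitI)
    fix e :: real assume e: "0 < e"
    have "(\<lambda>n. 1 / real (Suc n)) \<longlonglongrightarrow> 0" by (rule LIMSEQ_Suc[OF lim_const_over_n])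
    from order_tendstoD(2)[OF this e]
    show "\<forall>\<^sub>F n in sequentially. \<forall>t\<in>{0..T}. dist (G n t) (F t) < e"
    proof eventually_elim
      case (elim n)
      show ?case
      proof
        fix t assume t: "t \<in> {0..T}"
        show "dist (G n t) (F t) < e" using le_less_trans[OF G(2)[OF t] elim] by (simp only: dist_norm)
      qed
    qed
  qed
  then show ?thesis by (rule admissible_limit[OF G(1) T])
qed

lemma ex_mild_solution:
  assumes T: "0 < T" and F: "continuous_on {0..T} F"
  obtains \<phi> where "mild_solution D A T F x \<phi>"
proof -
  obtain \<phi> where \<phi>: "mild_solution D A T (\<lambda>_. 0) x \<phi>" by (rule ex_mild_solution_homogeneous[OF T])
  obtain \<psi> where \<psi>: "mild_solution D A T F 0 \<psi>"
    using admissible_continuous[OF T F] by (auto simp: admissible_def)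
  have "mild_solution D A T (\<lambda>t. 1 *\<^sub>R 0 + 1 *\<^sub>R F t) (1 *\<^sub>R x + 1 *\<^sub>R 0) (\<lambda>t. 1 *\<^sub>R \<phi> t + 1 *\<^sub>R \<psi> t)"
    by (rule mild_solution_lincomb[OF \<phi> \<psi> _ F]) simp
  then show thesis using that by simp
qed

text \<open>The scalar coefficient \<open>p\<close> is removed by the integrating factor \<open>exp (integral {0..t} p)\<close>.\<close>

lemma ex_mild_solution_scalar_coefficient:
  assumes T: "0 < T" and p: "continuous_on {0..T} p" and F: "continuous_on {0..T} F"
  obtains \<phi> where "mild_solution D A T (\<lambda>s. F s - p s *\<^sub>R \<phi> s) x \<phi>"
proof -
  define P where "P t = integral {0..t} p" for t
  have P': "(P has_vector_derivative p t) (at t within {0..T})" if "t \<in> {0..T}" for t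
    unfolding P_def by (rule integral_has_vector_derivative[OF p that])
  have contP: "continuous_on {0..T} P"
    unfolding P_def by (rule indefinite_integral_continuous_1[OF integrable_continuous_real[OF p]])
  define E where "E t = exp (- P t)" for t
  have contE: "continuous_on {0..T} E" unfolding E_def by (intro continuous_intros contP)
  have E': "(E has_vector_derivative - p t * E t) (at t within {0..T})" if "t \<in> {0..T}" for t
    unfolding E_def has_real_derivative_iff_has_vector_derivative[symmetric]
    by (rule derivative_eq_intros P'[OF that, unfolded has_real_derivative_iff_has_vector_derivative[symmetric]] refl)+ simp
  have E0: "E 0 = 1" by (simp add: E_def P_def)
  define G where "G t = exp (P t) *\<^sub>R F t" for t
  have contG: "continuous_on {0..T} G" unfolding G_def by (intro continuous_intros contP F)
  have EG: "E t *\<^sub>R G t = F t" for t by (simp add: E_def G_def flip: exp_add)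
  obtain \<zeta> where \<zeta>: "mild_solution D A T G x \<zeta>" by (rule ex_mild_solution[OF T contG])
  have cont\<zeta>: "continuous_on {0..T} \<zeta>" using \<zeta> by (simp add: mild_solution_def)
  \<comment> \<open>\<zeta> need not be differentiable in time, so the product rule with
    \<open>E\<close> is applied to the primitives \<open>Z\<close> and \<Gamma> instead.\<close>
  define Z where "Z t = integral {0..t} \<zeta>" for t
  define \<Gamma> where "\<Gamma> t = x + integral {0..t} G" for t
  have Z': "(Z has_vector_derivative \<zeta> t) (at t within {0..T})" 
    and \<Gamma>': "(\<Gamma> has_vector_derivative G t) (at t within {0..T})" if "t \<in> {0..T}" for t
  proof -
    show "(Z has_vector_derivative \<zeta> t) (at t within {0..T})"
      unfolding Z_def by (rule integral_has_vector_derivative[OF cont\<zeta> that])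
    show "(\<Gamma> has_vector_derivative G t) (at t within {0..T})"
      unfolding \<Gamma>_def
      using has_vector_derivative_add[OF has_vector_derivative_const integral_has_vector_derivative[OF contG that], of x]
      by simp
  qed
  have contZ: "continuous_on {0..T} Z" "continuous_on {0..T} \<Gamma>"
    unfolding Z_def \<Gamma>_def
    by (intro continuous_intros indefinite_integral_continuous_1 integrable_continuous_real cont\<zeta> contG)+
  have ZD: "Z t \<in> D" "A (Z t) = \<zeta> t - \<Gamma> t" if "t \<in> {0..T}" for t
    using \<zeta> that by (auto simp: mild_solution_def Z_def \<Gamma>_def)
  define \<phi> where "\<phi> t = E t *\<^sub>R \<zeta> t" for t
  have cont\<phi>: "continuous_on {0..T} \<phi>" unfolding \<phi>_def by (intro continuous_intros contE cont\<zeta>)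
  show thesis
  proof (rule that, unfold mild_solution_def, intro conjI ballI)
    show "continuous_on {0..T} \<phi>" by (rule cont\<phi>)
    fix t assume t: "t \<in> {0..T}"
    then have sub: "{0..t} \<subseteq> {0..T}" and t0: "0 \<le> t" by auto
    note cs = continuous_on_subset[OF _ sub]
    note conts = cs[OF contE] cs[OF cont\<zeta>] cs[OF contZ(1)] cs[OF contZ(2)] cs[OF p] cs[OF F] cs[OF cont\<phi>]
    have product: "((\<lambda>s. E s *\<^sub>R W' s + (- p s * E s) *\<^sub>R W s) has_integral E t *\<^sub>R W t - E 0 *\<^sub>R W 0) {0..t}"
      if W: "\<And>s. s \<in> {0..T} \<Longrightarrow> (W has_vector_derivative W' s) (at s within {0..T})" for W W' :: "real \<Rightarrow> 'z"
    proof (rule fundamental_theorem_of_calculus[OF t0])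
      fix s assume "s \<in> {0..t}"
      then have s: "s \<in> {0..T}" using sub by blast
      show "((\<lambda>s. E s *\<^sub>R W s) has_vector_derivative E s *\<^sub>R W' s + (- p s * E s) *\<^sub>R W s) (at s within {0..t})"
        by (rule has_vector_derivative_within_subset[OF
          bounded_bilinear.has_vector_derivative[OF bounded_bilinear_scaleR E'[OF s] W[OF s]] sub])
    qed
    have "integral {0..t} (\<lambda>s. E s *\<^sub>R \<zeta> s + (- p s * E s) *\<^sub>R Z s) = E t *\<^sub>R Z t"
      using integral_unique[OF product[OF Z']] by (simp add: Z_def)
    moreover have "integral {0..t} (\<lambda>s. E s *\<^sub>R \<zeta> s + (- p s * E s) *\<^sub>R Z s)
        = integral {0..t} \<phi> - integral {0..t} (\<lambda>s. (p s * E s) *\<^sub>R Z s)"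
      by (subst Henstock_Kurzweil_Integration.integral_diff[symmetric])
        (auto intro!: integrable_continuous_real continuous_intros conts simp: \<phi>_def)
    \<comment> \<open>Integration by parts expresses the integral of \<phi> through values of
      \<open>Z\<close>, which lie in \<open>D\<close>, so that \<open>A\<close> can be applied term
      by term.\<close>
    ultimately have int\<phi>: "integral {0..t} \<phi> = E t *\<^sub>R Z t + integral {0..t} (\<lambda>s. (p s * E s) *\<^sub>R Z s)"
      by (simp add: diff_eq_eq)
    have g1: "continuous_on {0..t} (\<lambda>s. (p s * E s) *\<^sub>R Z s)" by (intro continuous_intros conts)
    have g2: "(p s * E s) *\<^sub>R Z s \<in> D" "A ((p s * E s) *\<^sub>R Z s) = (p s * E s) *\<^sub>R (\<zeta> s - \<Gamma> s)" if "s \<in> {0..t}" for s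
    proof -
      have "s \<in> {0..T}" using that sub by blast
      note ZD[OF this]
      then show "(p s * E s) *\<^sub>R Z s \<in> D" "A ((p s * E s) *\<^sub>R Z s) = (p s * E s) *\<^sub>R (\<zeta> s - \<Gamma> s)"
        using D_closed(3) A_linear(3) by auto
    qed
    have "continuous_on {0..t} (\<lambda>s. (p s * E s) *\<^sub>R (\<zeta> s - \<Gamma> s))" by (intro continuous_intros conts)
    then have g3: "continuous_on {0..t} (\<lambda>s. A ((p s * E s) *\<^sub>R Z s))"
      by (rule continuous_on_eq) (simp add: g2(2))
    note I = A_integral[OF g1 g2(1) g3]
    note Zt = ZD[OF t]
    show "integral {0..t} \<phi> \<in> D"
      unfolding int\<phi> by (intro D_closed(1) D_closed(3)[OF Zt(1) Zt(1)] I(1))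
    have "A (integral {0..t} \<phi>) = E t *\<^sub>R (\<zeta> t - \<Gamma> t) + integral {0..t} (\<lambda>s. A ((p s * E s) *\<^sub>R Z s))"
      unfolding int\<phi> by (simp only: A_linear(1)[OF D_closed(3)[OF Zt(1) Zt(1)] I(1)] A_linear(3)[OF Zt(1)] Zt(2) I(2))
    also have "integral {0..t} (\<lambda>s. A ((p s * E s) *\<^sub>R Z s)) = integral {0..t} (\<lambda>s. (p s * E s) *\<^sub>R (\<zeta> s - \<Gamma> s))"
      by (rule integral_cong) (simp add: g2(2))
    finally have A\<phi>: "A (integral {0..t} \<phi>) = \<phi> t - E t *\<^sub>R \<Gamma> t + integral {0..t} (\<lambda>s. (p s * E s) *\<^sub>R (\<zeta> s - \<Gamma> s))"
      by (simp only: \<phi>_def[of t] scaleR_diff_right)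
    have int\<Gamma>: "integral {0..t} (\<lambda>s. F s + (- p s * E s) *\<^sub>R \<Gamma> s) = E t *\<^sub>R \<Gamma> t - x"
      using integral_unique[OF product[OF \<Gamma>']] by (simp add: EG E0 \<Gamma>_def)
    have "integral {0..t} (\<lambda>s. (p s * E s) *\<^sub>R (\<zeta> s - \<Gamma> s)) + integral {0..t} (\<lambda>s. F s - p s *\<^sub>R \<phi> s)
        = integral {0..t} (\<lambda>s. (p s * E s) *\<^sub>R (\<zeta> s - \<Gamma> s) + (F s - p s *\<^sub>R \<phi> s))"
      by (intro Henstock_Kurzweil_Integration.integral_add[symmetric] integrable_continuous_real continuous_intros conts)
    also have "\<dots> = integral {0..t} (\<lambda>s. F s + (- p s * E s) *\<^sub>R \<Gamma> s)"
      by (rule integral_cong) (simp add: \<phi>_def algebra_simps)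
    finally show "\<phi> t = x + A (integral {0..t} \<phi>) + integral {0..t} (\<lambda>s. F s - p s *\<^sub>R \<phi> s)"
      unfolding A\<phi> int\<Gamma> by (simp add: algebra_simps)
  qed
qed

end

subsection \<open>The inverse of \<open>g_fun\<close>\<close>

lemma sinh_ge_self: "0 \<le> x \<Longrightarrow> x \<le> sinh (x::real)"
proof -
  assume x: "0 \<le> x"
  have "sinh 0 - 0 \<le> sinh x - x"
  proof (rule DERIV_nonneg_imp_nondecreasing[OF x])
    fix y :: real
    show "\<exists>d. ((\<lambda>y. sinh y - y) has_real_derivative d) (at y) \<and> 0 \<le> d"
      by (intro exI[of _ "cosh y - 1"] conjI) (auto intro!: derivative_eq_intros simp: cosh_real_ge_1)
  qed
  then show "x \<le> sinh x" by simp
qed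

text \<open>In terms of \<open>s = sqrt (a / lam)\<close> the function is \<open>s * tanh s\<close>,
  which behaves like the square of \<open>s\<close> near 0; so the inverse stays Lipschitz at 0
  despite the roots. Quantitatively \<open>t \<le> tanh t * (cosh t)\<^sup>2\<close>, and
  \<open>M\<close> serves to bound \<open>cosh t\<close>.\<close>

lemma g_fun_inverse_lipschitz:
  assumes lam: "0 < lam" and ab: "0 \<le> a" "a \<le> b" and M: "g_fun lam b \<le> M"
  shows "b - a \<le> 2 * lam * (cosh (max 1 (M / tanh 1)))\<^sup>2 * (g_fun lam b - g_fun lam a)"
proof -
  define s t S where "s = sqrt (a / lam)" and "t = sqrt (b / lam)" and "S = max 1 (M / tanh 1)"
  have st: "0 \<le> s" "s \<le> t" using lam ab by (auto simp: s_def t_def divide_right_mono)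
  have sq: "a = lam * s\<^sup>2" "b = lam * t\<^sup>2" using lam ab by (auto simp: s_def t_def)
  have g: "g_fun lam a = s * tanh s" "g_fun lam b = t * tanh t" by (auto simp: g_fun_def s_def t_def)
  \<comment> \<open>Origin of \<open>S\<close>: for \<open>t > 1\<close> the value
    \<open>t * tanh t\<close> is at least \<open>t * tanh 1\<close>, so \<open>M\<close> bounds
    \<open>t\<close>.\<close>
  have "t \<le> S"
  proof (cases "t \<le> 1")
    case False
    have "t * tanh 1 \<le> t * tanh t" using False by (intro mult_left_mono) auto
    then have "t * tanh 1 \<le> M" using M g by simp
    then have "t \<le> M / tanh 1" by (simp add: pos_le_divide_eq)
    then show ?thesis by (simp add: S_def)
  qed (simp add: S_def)
  then have cS: "cosh t \<le> cosh S" using st cosh_real_nonneg_le_iff[of t S] by simp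
  have "t \<le> sinh t * cosh t"
    using sinh_ge_self[of t] st mult_left_mono[OF cosh_real_ge_1, of "sinh t" t] by simp
  also have "\<dots> = tanh t * (cosh t)\<^sup>2" by (simp add: tanh_def power2_eq_square)
  also have "\<dots> \<le> tanh t * (cosh S)\<^sup>2"
    using cS st by (intro mult_left_mono power_mono) auto
  finally have tt: "t \<le> tanh t * (cosh S)\<^sup>2" .
  have "tanh t * (t - s) \<le> t * tanh t - s * tanh s"
    using st mult_left_mono[of "tanh s" "tanh t" s] by (simp add: algebra_simps)
  from mult_right_mono[OF this, of "(cosh S)\<^sup>2"]
  have 1: "(tanh t * (cosh S)\<^sup>2) * (t - s) \<le> (cosh S)\<^sup>2 * (t * tanh t - s * tanh s)"
    by (simp add: algebra_simps)
  have 2: "t * (t - s) \<le> (tanh t * (cosh S)\<^sup>2) * (t - s)" using tt st by (intro mult_right_mono) auto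
  have "t\<^sup>2 - s\<^sup>2 = 2 * (t * (t - s)) - (t - s)\<^sup>2" by (simp add: power2_eq_square algebra_simps)
  moreover have "0 \<le> (t - s)\<^sup>2" by simp
  ultimately have "t\<^sup>2 - s\<^sup>2 \<le> 2 * ((cosh S)\<^sup>2 * (t * tanh t - s * tanh s))" using 1 2 by linarith
  from mult_left_mono[OF this, of lam] show ?thesis
    using lam unfolding g S_def[symmetric] by (simp add: sq algebra_simps)
qed

lemma g_fun_surj:
  assumes lam: "0 < lam" and y: "0 \<le> y"
  obtains a where "0 \<le> a" "g_fun lam a = y"
proof -
  \<comment> \<open>As \<open>S\<close> is at least 1, \<open>S * tanh S\<close> is at least
    \<open>S * tanh 1\<close>, hence at least \<open>y\<close>; this is the right end for the
    intermediate value theorem.\<close>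
  define S where "S = max 1 (y / tanh 1)"
  have "y \<le> S * tanh 1" by (simp add: S_def pos_divide_le_eq[symmetric])
  also have "\<dots> \<le> S * tanh S" by (intro mult_left_mono) (auto simp: S_def)
  also have "\<dots> = g_fun lam (lam * S\<^sup>2)"
  proof -
    have "lam * S\<^sup>2 / lam = S\<^sup>2" using lam by simp
    then show ?thesis by (simp add: g_fun_def S_def)
  qed
  finally have "y \<le> g_fun lam (lam * S\<^sup>2)" .
  moreover have "g_fun lam 0 \<le> y" using y by (simp add: g_fun_def)
  moreover have "continuous_on {0..lam * S\<^sup>2} (g_fun lam)"
    unfolding g_fun_def by (intro continuous_intros) (use lam in auto)
  ultimately obtain a where "0 \<le> a" "g_fun lam a = y"
    using IVT'[of "g_fun lam" 0 y "lam * S\<^sup>2"] lam by auto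
  then show thesis by (rule that)
qed

lemma g_inv:
  assumes lam: "0 < lam" and y: "0 \<le> y"
  shows "0 \<le> g_inv lam y" "g_fun lam (g_inv lam y) = y"
proof -
  obtain a where a: "0 \<le> a" "g_fun lam a = y" by (rule g_fun_surj[OF assms])
  then have "g_inv lam y = a"
    unfolding g_inv_def using inj_on_g_fun[OF lam] by (auto intro: the_inv_into_f_eq)
  then show "0 \<le> g_inv lam y" "g_fun lam (g_inv lam y) = y" using a by auto
qed

lemma g_inv_lipschitz:
  assumes lam: "0 < lam" and y: "0 \<le> y" "y \<le> M" "0 \<le> z" "z \<le> M"
  shows "\<bar>g_inv lam y - g_inv lam z\<bar> \<le> 2 * lam * (cosh (max 1 (M / tanh 1)))\<^sup>2 * \<bar>y - z\<bar>"
proof -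
  define L where "L = 2 * lam * (cosh (max 1 (M / tanh 1)))\<^sup>2"
  have L: "0 \<le> L" using lam by (simp add: L_def)
  have *: "\<bar>g_inv lam y - g_inv lam z\<bar> \<le> L * \<bar>y - z\<bar>"
    if "g_inv lam y \<le> g_inv lam z" "0 \<le> y" "0 \<le> z" "z \<le> M" for y z
  proof -
    have "g_inv lam z - g_inv lam y \<le> L * (z - y)"
      using g_fun_inverse_lipschitz[OF lam _ that(1), of M] g_inv[OF lam that(2)] g_inv[OF lam that(3)] that(4)
      by (simp add: L_def)
    also have "\<dots> \<le> L * \<bar>y - z\<bar>" using L by (intro mult_left_mono) auto
    finally show ?thesis using that(1) by simp
  qed
  show ?thesis
    using *[of y z] *[of z y] y unfolding L_def[symmetric]
    by (cases "g_inv lam y \<le> g_inv lam z") (auto simp: abs_minus_commute)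
qed

lemma Psi_nonneg: "0 < lam \<Longrightarrow> 0 \<le> Psi lam k y_r \<xi>"
  unfolding Psi_def by (rule g_inv) auto

lemma Psi_lipschitz:
  assumes lam: "0 < lam" and y_r: "y_r \<noteq> 0"
  obtains L where "0 \<le> L" "\<And>\<xi> \<zeta>. \<bar>\<xi>\<bar> \<le> R \<Longrightarrow> \<bar>\<zeta>\<bar> \<le> R \<Longrightarrow>
    \<bar>Psi lam k y_r \<xi> - Psi lam k y_r \<zeta>\<bar> \<le> L * \<bar>\<xi> - \<zeta>\<bar>"
proof
  \<comment> \<open>Bounds the argument of \<open>g_inv\<close> on the ball of radius
    \<open>R\<close>; the cut-off at 0 does not increase distances.\<close>
  define M where "M = R / \<bar>y_r\<bar> + \<bar>chi_bar lam k y_r / y_r\<bar>"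
  define L where "L = 2 * lam * (cosh (max 1 (M / tanh 1)))\<^sup>2"
  show "0 \<le> L / \<bar>y_r\<bar>" using lam by (simp add: L_def)
  fix \<xi> \<zeta> :: real assume R: "\<bar>\<xi>\<bar> \<le> R" "\<bar>\<zeta>\<bar> \<le> R"
  define a where "a \<xi> = max 0 (\<xi> / y_r + chi_bar lam k y_r / y_r)" for \<xi>
  have aM: "0 \<le> a \<xi> \<and> a \<xi> \<le> M" if "\<bar>\<xi>\<bar> \<le> R" for \<xi>
  proof -
    have "\<bar>\<xi> / y_r\<bar> \<le> R / \<bar>y_r\<bar>" using that by (simp add: divide_right_mono)
    then have "\<xi> / y_r + chi_bar lam k y_r / y_r \<le> M" "0 \<le> M" unfolding M_def by linarith+
    then show ?thesis by (simp add: a_def)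
  qed
  have "\<bar>Psi lam k y_r \<xi> - Psi lam k y_r \<zeta>\<bar> \<le> L * \<bar>a \<xi> - a \<zeta>\<bar>"
    unfolding Psi_def a_def[symmetric] L_def using aM[OF R(1)] aM[OF R(2)] by (intro g_inv_lipschitz[OF lam]) auto
  also have "\<bar>a \<xi> - a \<zeta>\<bar> \<le> \<bar>\<xi> / y_r - \<zeta> / y_r\<bar>" unfolding a_def by linarith
  also have "\<bar>\<xi> / y_r - \<zeta> / y_r\<bar> = \<bar>\<xi> - \<zeta>\<bar> / \<bar>y_r\<bar>" by (simp flip: diff_divide_distrib)
  finally show "\<bar>Psi lam k y_r \<xi> - Psi lam k y_r \<zeta>\<bar> \<le> L / \<bar>y_r\<bar> * \<bar>\<xi> - \<zeta>\<bar>"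
    using lam by (simp add: L_def mult_left_mono)
qed

lemma Psi_continuous:
  assumes "0 < lam" "y_r \<noteq> 0"
  shows "continuous_on UNIV (Psi lam k y_r)"
  unfolding continuous_on_eq_continuous_at[OF open_UNIV]
proof
  fix \<xi> :: real
  obtain L where L: "\<And>\<xi>' \<zeta>. \<bar>\<xi>'\<bar> \<le> \<bar>\<xi>\<bar> + 1 \<Longrightarrow> \<bar>\<zeta>\<bar> \<le> \<bar>\<xi>\<bar> + 1 \<Longrightarrow>
    \<bar>Psi lam k y_r \<xi>' - Psi lam k y_r \<zeta>\<bar> \<le> L * \<bar>\<xi>' - \<zeta>\<bar>" and L0: "0 \<le> L"
    using Psi_lipschitz[OF assms, of "\<bar>\<xi>\<bar> + 1" k] by metis
  have "continuous_on (ball \<xi> 1) (Psi lam k y_r)"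
  proof (rule lipschitz_on_continuous_on[of L], rule lipschitz_onI[OF _ L0])
    fix x y assume "x \<in> ball \<xi> 1" "y \<in> ball \<xi> 1"
    then show "dist (Psi lam k y_r x) (Psi lam k y_r y) \<le> L * dist x y"
      using L[of x y] by (auto simp: dist_real_def)
  qed
  then show "isCont (Psi lam k y_r) \<xi>" by (simp add: continuous_on_eq_continuous_at)
qed

subsection \<open>The two diagonal blocks\<close>

locale error_system =
  fixes lam k \<rho> \<gamma> \<alpha> y_r :: real and u_r :: L2
  assumes pos: "lam > 0" "k > 0" "\<rho> > 0" "\<gamma> > 0" "\<alpha> > 0" and y_r: "y_r \<noteq> 0"
begin

lemma zero_in_H2: "0 \<in> H2" "x \<in> {0..1} \<Longrightarrow> pt_val 0 x = 0" "x \<in> {0..1} \<Longrightarrow> pt_val (L2_dx 0) x = 0"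
proof -
  have j: "H2_jet 0 (\<lambda>_. 0) (\<lambda>_. 0) (\<lambda>_. 0)"
    by (rule H2_jetI) (auto intro: abs_cont_on_const sq_integrable_zero simp: zero_L2_def)
  then show "0 \<in> H2" by (auto simp: H2_def)
  show "x \<in> {0..1} \<Longrightarrow> pt_val 0 x = 0" "x \<in> {0..1} \<Longrightarrow> pt_val (L2_dx 0) x = 0"
    using H2_jet_values[OF j] by auto
qed

text \<open>The Robin condition contributes \<alpha> times the squared value at 1, integration by
  parts the squared norm of the derivative. The trace inequality asks for both with equal weight,
  hence \<open>min \<alpha> 1\<close>, and its factor 2 gives the half.\<close>

lemma A_eta_dissipation:
  assumes "\<eta> \<in> D_eta \<alpha>"
  shows "inner \<eta> (A_eta lam \<eta>) \<le> - (lam * min \<alpha> 1 / 2) * inner \<eta> \<eta>"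
proof -
  have h: "\<eta> \<in> H2" and bc: "pt_val (L2_dx \<eta>) 0 = 0" "pt_val (L2_dx \<eta>) 1 = - \<alpha> * pt_val \<eta> 1"
    using assms by (auto simp: D_eta_def)
  define p G where "p = (pt_val \<eta> 1)\<^sup>2" and "G = (norm (L2_dx \<eta>))\<^sup>2"
  have "inner \<eta> (A_eta lam \<eta>) = lam * (- \<alpha> * p - G)"
    using H2_integration_by_parts(1)[OF h] unfolding A_eta_def bc p_def G_def
    by (simp add: inner_commute power2_eq_square)
  also have "\<dots> \<le> lam * (- min \<alpha> 1 * (p + G))"
  proof (intro mult_left_mono)
    have "min \<alpha> 1 * p \<le> \<alpha> * p" "min \<alpha> 1 * G \<le> 1 * G"
      by (intro mult_right_mono; simp add: p_def G_def)+
    then show "- \<alpha> * p - G \<le> - min \<alpha> 1 * (p + G)" by (simp add: distrib_left)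
  qed (use pos in simp)
  also have "\<dots> \<le> - (lam * min \<alpha> 1 / 2) * inner \<eta> \<eta>"
  proof -
    have "inner \<eta> \<eta> / 2 \<le> p + G"
      using H2_integration_by_parts(3)[OF h] by (simp add: p_def G_def power2_norm_eq_inner)
    from mult_left_mono[OF this, of "lam * min \<alpha> 1"] pos show ?thesis by simp
  qed
  finally show ?thesis .
qed

sublocale eta: m_dissipative "D_eta \<alpha>" "A_eta lam" inner 1 1
proof (intro m_dissipative.intro linear_operator.intro m_dissipative_axioms.intro)
  show "0 \<in> D_eta \<alpha>" by (simp add: D_eta_def zero_in_H2)
  fix x y :: L2 and c d :: real
  assume xy: "x \<in> D_eta \<alpha>" "y \<in> D_eta \<alpha>"
  then have h: "x \<in> H2" "y \<in> H2" by (auto simp: D_eta_def)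
  show "c *\<^sub>R x + d *\<^sub>R y \<in> D_eta \<alpha>"
    using xy by (simp add: D_eta_def H2_linear_comb[OF h] algebra_simps)
  show "A_eta lam (c *\<^sub>R x + d *\<^sub>R y) = c *\<^sub>R A_eta lam x + d *\<^sub>R A_eta lam y"
    by (simp add: A_eta_def H2_linear_comb[OF h] algebra_simps)
next
  fix x :: L2 assume x: "x \<in> D_eta \<alpha>"
  have "0 \<le> (lam * min \<alpha> 1 / 2) * inner x x" using pos by simp
  then show "inner x (A_eta lam x) \<le> 0" using A_eta_dissipation[OF x] by linarith
next
  fix h :: real and y :: L2 assume h: "0 < h"
  have h': "0 < h * lam" using h pos by simp
  obtain v where v: "v \<in> H2" "1 *\<^sub>R v - (h * lam) *\<^sub>R L2_dx (L2_dx v) = y"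
    "pt_val (L2_dx v) 0 = 0" "pt_val (L2_dx v) 1 = - \<alpha> * pt_val v 1 + 0"
    by (rule boundary_value_problem[OF zero_less_one h' pos(5), of y 0], rule that)
  then show "\<exists>x\<in>D_eta \<alpha>. x - h *\<^sub>R A_eta lam x = y"
    by (intro bexI[of _ v]) (auto simp: D_eta_def A_eta_def)
qed (auto simp: bounded_bilinear_inner inner_commute power2_norm_eq_inner)

definition one :: L2 where "one = abs_L2 (\<lambda>_. 1)"

lemma inner_one_le: "\<bar>inner u one\<bar> \<le> norm u"
  using Cauchy_Schwarz_ineq2[of u one] norm_abs_L2_one by (simp add: one_def)

text \<open>\<open>B_e 0\<close> is the natural energy, for which \<open>A_e\<close> is only dissipative; the cross term with
  small \<open>\<epsilon>\<close> makes the dissipation strict in \<open>\<xi>\<close>.\<close>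

definition B_e :: "real \<Rightarrow> L2 \<times> real \<Rightarrow> L2 \<times> real \<Rightarrow> real" where
  "B_e \<epsilon> = (\<lambda>(u, \<xi>) (v, \<zeta>). \<rho> * inner u v + lam * (\<xi> * \<zeta>) -
     (\<epsilon> / 2) * (\<xi> * inner v one + \<zeta> * inner u one))"

lemma B_e_sym: "B_e \<epsilon> y z = B_e \<epsilon> z y"
  by (auto simp: B_e_def inner_commute algebra_simps split: prod.splits)

lemma B_e_bilinear: "bounded_bilinear (B_e \<epsilon>)"
proof
  fix a b c :: "L2 \<times> real" and r :: real
  show "B_e \<epsilon> (a + b) c = B_e \<epsilon> a c + B_e \<epsilon> b c" "B_e \<epsilon> a (b + c) = B_e \<epsilon> a b + B_e \<epsilon> a c"
    "B_e \<epsilon> (r *\<^sub>R a) b = r *\<^sub>R B_e \<epsilon> a b" "B_e \<epsilon> a (r *\<^sub>R b) = r *\<^sub>R B_e \<epsilon> a b"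
    by (auto simp: B_e_def inner_add_left inner_add_right add_divide_distrib algebra_simps split: prod.splits)
next
  have "norm (B_e \<epsilon> a b) \<le> norm a * norm b * (\<rho> + lam + \<bar>\<epsilon>\<bar>)" for a b
  proof -
    obtain u \<xi> v \<zeta> where ab: "a = (u, \<xi>)" "b = (v, \<zeta>)" by (cases a, cases b)
    have n: "norm u \<le> norm a" "\<bar>\<xi>\<bar> \<le> norm a" "norm v \<le> norm b" "\<bar>\<zeta>\<bar> \<le> norm b"
      using norm_fst_le[of u \<xi>] norm_snd_le[of \<xi> u] norm_fst_le[of v \<zeta>] norm_snd_le[of \<zeta> v] by (auto simp: ab)
    have 1: "\<bar>inner u v\<bar> \<le> norm a * norm b"
      using Cauchy_Schwarz_ineq2[of u v] n by (meson mult_mono norm_ge_zero order_trans)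
    have 2: "\<bar>\<xi> * \<zeta>\<bar> \<le> norm a * norm b" unfolding abs_mult using n by (intro mult_mono) auto
    have 3: "\<bar>\<xi> * inner v one\<bar> \<le> norm a * norm b" "\<bar>\<zeta> * inner u one\<bar> \<le> norm b * norm a"
      unfolding abs_mult using n inner_one_le[of v] inner_one_le[of u] by (intro mult_mono; simp)+
    have "\<bar>B_e \<epsilon> a b\<bar> \<le> \<rho> * \<bar>inner u v\<bar> + lam * \<bar>\<xi> * \<zeta>\<bar> + \<bar>\<epsilon>\<bar> / 2 * (\<bar>\<xi> * inner v one\<bar> + \<bar>\<zeta> * inner u one\<bar>)"
    proof -
      have "\<bar>\<epsilon> / 2 * (\<xi> * inner v one + \<zeta> * inner u one)\<bar> \<le> \<bar>\<epsilon>\<bar> / 2 * (\<bar>\<xi> * inner v one\<bar> + \<bar>\<zeta> * inner u one\<bar>)"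
        unfolding abs_mult[of "\<epsilon> / 2"] by (simp add: mult_left_mono abs_triangle_ineq)
      moreover have "\<bar>\<rho> * inner u v\<bar> = \<rho> * \<bar>inner u v\<bar>" "\<bar>lam * (\<xi> * \<zeta>)\<bar> = lam * \<bar>\<xi> * \<zeta>\<bar>"
        using pos by (auto simp: abs_mult)
      ultimately show ?thesis unfolding ab B_e_def prod.case by linarith
    qed
    also have "\<dots> \<le> \<rho> * (norm a * norm b) + lam * (norm a * norm b) + \<bar>\<epsilon>\<bar> / 2 * (norm a * norm b + norm b * norm a)"
      using pos 1 2 3 by (intro add_mono mult_left_mono) auto
    finally show ?thesis by (simp add: algebra_simps)
  qed
  then show "\<exists>K. \<forall>a b. norm (B_e \<epsilon> a b) \<le> norm a * norm b * K" by blast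
qed

text \<open>The weights \<rho> and \<open>lam\<close> make the boundary term
  \<open>\<rho> * lam * \<xi> * u(1)\<close> from integration by parts cancel against the
  contribution of \<open>\<xi>' = - \<rho> * u(1)\<close>. The cross term brings in the mean of the
  second derivative, whose boundary value contains \<xi> and thus yields the dissipation of
  \<open>\<xi>\<^sup>2\<close>.\<close>

lemma B_e_A_e:
  assumes "(u, \<xi>) \<in> D_e \<gamma>"
  shows "B_e \<epsilon> (u, \<xi>) (A_e lam k \<rho> (u, \<xi>)) = - \<rho> * lam * \<gamma> * (pt_val u 1)\<^sup>2 - \<rho> * lam * (norm (L2_dx u))\<^sup>2
    - \<rho> * k * (norm u)\<^sup>2 - (\<epsilon> / 2) * (lam * \<xi>\<^sup>2 - lam * \<gamma> * (pt_val u 1 * \<xi>) - k * (inner u one * \<xi>)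
      - \<rho> * (pt_val u 1 * inner u one))"
proof -
  have h: "u \<in> H2" and bc: "pt_val (L2_dx u) 0 = 0" "pt_val (L2_dx u) 1 = - \<gamma> * pt_val u 1 + \<xi>"
    using assms by (auto simp: D_e_def)
  have 1: "inner u (L2_dx (L2_dx u)) = (- \<gamma> * pt_val u 1 + \<xi>) * pt_val u 1 - (norm (L2_dx u))\<^sup>2"
    using H2_integration_by_parts(1)[OF h] by (simp add: bc inner_commute)
  have 2: "inner (L2_dx (L2_dx u)) one = - \<gamma> * pt_val u 1 + \<xi>"
    using H2_integration_by_parts(2)[OF h] by (simp add: bc one_def)
  have 3: "inner u u = (norm u)\<^sup>2" by (simp add: power2_norm_eq_inner)
  show ?thesis
    by (simp add: B_e_def A_e_def inner_diff_left inner_diff_right 1 2 3)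
      (simp add: power2_eq_square algebra_simps)
qed

sublocale e: m_dissipative "D_e \<gamma>" "A_e lam k \<rho>" "B_e 0" "min \<rho> lam" "max \<rho> lam"
proof (intro m_dissipative.intro linear_operator.intro m_dissipative_axioms.intro)
  show "0 \<in> D_e \<gamma>" by (simp add: D_e_def zero_in_H2 zero_prod_def)
  fix x y :: "L2 \<times> real" and c d :: real
  assume xy: "x \<in> D_e \<gamma>" "y \<in> D_e \<gamma>"
  obtain u \<xi> v \<zeta> where eq: "x = (u, \<xi>)" "y = (v, \<zeta>)" by (cases x, cases y)
  have h: "u \<in> H2" "v \<in> H2" using xy by (auto simp: D_e_def eq)
  show "c *\<^sub>R x + d *\<^sub>R y \<in> D_e \<gamma>"
    using xy by (auto simp: eq D_e_def H2_linear_comb[OF h] algebra_simps)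
  show "A_e lam k \<rho> (c *\<^sub>R x + d *\<^sub>R y) = c *\<^sub>R A_e lam k \<rho> x + d *\<^sub>R A_e lam k \<rho> y"
    by (simp add: eq A_e_def H2_linear_comb[OF h] algebra_simps)
next
  show "bounded_bilinear (B_e 0)" by (rule B_e_bilinear)
  show "B_e 0 x y = B_e 0 y x" for x y by (rule B_e_sym)
  show "0 < min \<rho> lam" using pos by simp
  fix x :: "L2 \<times> real"
  obtain u \<xi> where x: "x = (u, \<xi>)" by (cases x)
  have n: "(norm x)\<^sup>2 = (norm u)\<^sup>2 + \<xi>\<^sup>2" by (simp add: x norm_Pair)
  have B: "B_e 0 x x = \<rho> * (norm u)\<^sup>2 + lam * \<xi>\<^sup>2"
    by (simp add: x B_e_def power2_norm_eq_inner) (simp add: power2_eq_square)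
  show "min \<rho> lam * (norm x)\<^sup>2 \<le> B_e 0 x x" "B_e 0 x x \<le> max \<rho> lam * (norm x)\<^sup>2"
    unfolding n B distrib_left by (intro add_mono mult_right_mono; simp)+
next
  fix x assume x: "x \<in> D_e \<gamma>"
  obtain u \<xi> where x_eq: "x = (u, \<xi>)" by (cases x)
  have "0 \<le> \<rho> * lam * \<gamma> * (pt_val u 1)\<^sup>2 + \<rho> * lam * (norm (L2_dx u))\<^sup>2 + \<rho> * k * (norm u)\<^sup>2"
    using pos by (intro add_nonneg_nonneg) auto
  then show "B_e 0 x (A_e lam k \<rho> x) \<le> 0" using B_e_A_e[of u \<xi> 0] x by (simp add: x_eq)
next
  fix h :: real and y :: "L2 \<times> real" assume h: "0 < h"
  \<comment> \<open>The scalar line of the resolvent equation gives \<xi> as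
    \<open>snd y - h * \<rho> * v(1)\<close>. Inserting this into the boundary condition raises the
    Robin coefficient to \<open>\<gamma> + h * \<rho>\<close>.\<close>
  have a: "0 < 1 + h * k" "0 < h * lam" "0 < \<gamma> + h * \<rho>" using h pos by (auto intro: add_pos_pos)
  obtain v where v: "v \<in> H2" "(1 + h * k) *\<^sub>R v - (h * lam) *\<^sub>R L2_dx (L2_dx v) = fst y"
    "pt_val (L2_dx v) 0 = 0" "pt_val (L2_dx v) 1 = - (\<gamma> + h * \<rho>) * pt_val v 1 + snd y"
    by (rule boundary_value_problem[OF a, of "fst y" "snd y"], rule that)
  show "\<exists>x\<in>D_e \<gamma>. x - h *\<^sub>R A_e lam k \<rho> x = y"
  proof (rule bexI[of _ "(v, snd y - h * \<rho> * pt_val v 1)"])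
    show "(v, snd y - h * \<rho> * pt_val v 1) \<in> D_e \<gamma>" using v by (simp add: D_e_def algebra_simps)
    show "(v, snd y - h * \<rho> * pt_val v 1) - h *\<^sub>R A_e lam k \<rho> (v, snd y - h * \<rho> * pt_val v 1) = y"
      using v(2) by (cases y) (simp add: A_e_def algebra_simps)
  qed
qed

text \<open>The cross term gains a multiple of \<open>\<xi>\<^sup>2\<close> and costs multiples of
  \<open>u(1)\<^sup>2\<close> and of the squared norm of \<open>u\<close>, which existing
  dissipation absorbs if \<epsilon> is small. The products of \<xi> with \<open>u(1)\<close> and
  with the mean may each use a quarter of the gain.\<close>

lemma lyapunov:
  obtains \<epsilon> c m M where "0 < c" "0 < m" "0 \<le> M"
    "\<And>z. m * (norm z)\<^sup>2 \<le> B_e \<epsilon> z z" "\<And>z. B_e \<epsilon> z z \<le> M * (norm z)\<^sup>2"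
    "\<And>z. z \<in> D_e \<gamma> \<Longrightarrow> B_e \<epsilon> z (A_e lam k \<rho> z) \<le> - c * B_e \<epsilon> z z"
proof
  \<comment> \<open>\<open>e1\<close> and \<open>e2\<close> are the largest \<epsilon> for which
    \<open>c1\<close> and \<open>c2\<close> below hold: the first may use up the boundary
    dissipation, the second half of \<open>\<rho> * k\<close>. The bounds by \<rho> and
    \<open>lam\<close> keep the cross term below half of the natural energy.\<close>
  define e1 where "e1 = 2 * (\<rho> * lam * \<gamma>) / (lam * \<gamma>\<^sup>2 + \<rho> / 2)"
  define e2 where "e2 = \<rho> * k / (k\<^sup>2 / lam + \<rho> / 2)"
  define \<epsilon> where "\<epsilon> = min (min \<rho> lam) (min e1 e2)"
  have d: "0 < lam * \<gamma>\<^sup>2 + \<rho> / 2" "0 < k\<^sup>2 / lam + \<rho> / 2" using pos by (auto intro: add_pos_pos)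
  have \<epsilon>: "0 < \<epsilon>" "\<epsilon> \<le> \<rho>" "\<epsilon> \<le> lam" "\<epsilon> \<le> e1" "\<epsilon> \<le> e2"
    using pos d by (auto simp: \<epsilon>_def e1_def e2_def)
  have c1: "\<epsilon> / 2 * (lam * \<gamma>\<^sup>2 + \<rho> / 2) \<le> \<rho> * lam * \<gamma>" and c2: "\<epsilon> / 2 * (k\<^sup>2 / lam + \<rho> / 2) \<le> \<rho> * k / 2"
    using \<epsilon>(4,5) d unfolding e1_def e2_def by (auto simp: pos_le_divide_eq)
  \<comment> \<open>What remains is dissipation \<open>\<rho> * k / 2\<close> and
    \<open>\<epsilon> / 4 * lam\<close>, against at most \<open>3 / 2\<close> times the natural
    energy; comparing coefficients gives \<open>k / 3\<close> and
    \<open>\<epsilon> / 6\<close>.\<close>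
  define c where "c = min (k / 3) (\<epsilon> / 6)"
  show "0 < c" using pos \<epsilon> by (simp add: c_def)
  show "0 < min \<rho> lam / 2" "0 \<le> 3 / 2 * max \<rho> lam" using pos by auto
  have cross: "\<bar>\<epsilon> * (\<xi> * inner u one)\<bar> \<le> \<rho> / 2 * (norm u)\<^sup>2 + lam / 2 * \<xi>\<^sup>2" for u \<xi>
  proof -
    have "\<bar>\<xi> * inner u one\<bar> \<le> \<bar>\<xi>\<bar> * norm u"
      unfolding abs_mult by (intro mult_left_mono inner_one_le) simp
    also have "\<dots> \<le> ((norm u)\<^sup>2 + \<xi>\<^sup>2) / 2"
      using sum_squares_bound[of "\<bar>\<xi>\<bar>" "norm u"] by simp
    finally have "\<bar>\<epsilon> * (\<xi> * inner u one)\<bar> \<le> \<epsilon> * (((norm u)\<^sup>2 + \<xi>\<^sup>2) / 2)"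
      using \<epsilon> unfolding abs_mult[of \<epsilon>] by simp
    also have "\<dots> = \<epsilon> / 2 * (norm u)\<^sup>2 + \<epsilon> / 2 * \<xi>\<^sup>2" by (simp add: algebra_simps)
    also have "\<dots> \<le> \<rho> / 2 * (norm u)\<^sup>2 + lam / 2 * \<xi>\<^sup>2"
      using \<epsilon> by (intro add_mono mult_right_mono) auto
    finally show ?thesis .
  qed
  have B: "B_e \<epsilon> (u, \<xi>) (u, \<xi>) = \<rho> * (norm u)\<^sup>2 + lam * \<xi>\<^sup>2 - \<epsilon> * (\<xi> * inner u one)" for u \<xi>
    by (simp add: B_e_def power2_norm_eq_inner) (simp add: power2_eq_square)
  have lower: "\<rho> / 2 * (norm u)\<^sup>2 + lam / 2 * \<xi>\<^sup>2 \<le> B_e \<epsilon> (u, \<xi>) (u, \<xi>)"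
    and upper: "B_e \<epsilon> (u, \<xi>) (u, \<xi>) \<le> 3 / 2 * (\<rho> * (norm u)\<^sup>2 + lam * \<xi>\<^sup>2)" for u \<xi>
    using cross[of \<xi> u] unfolding B by (simp_all add: abs_le_iff algebra_simps)
  fix z :: "L2 \<times> real"
  obtain u \<xi> where z: "z = (u, \<xi>)" by (cases z)
  have n: "(norm z)\<^sup>2 = (norm u)\<^sup>2 + \<xi>\<^sup>2" by (simp add: z norm_Pair)
  show "min \<rho> lam / 2 * (norm z)\<^sup>2 \<le> B_e \<epsilon> z z"
  proof -
    have "min \<rho> lam / 2 * (norm z)\<^sup>2 \<le> \<rho> / 2 * (norm u)\<^sup>2 + lam / 2 * \<xi>\<^sup>2"
      unfolding n distrib_left by (intro add_mono mult_right_mono) auto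
    then show ?thesis using lower[of u \<xi>] by (simp add: z)
  qed
  show "B_e \<epsilon> z z \<le> 3 / 2 * max \<rho> lam * (norm z)\<^sup>2"
  proof -
    have "\<rho> * (norm u)\<^sup>2 + lam * \<xi>\<^sup>2 \<le> max \<rho> lam * (norm z)\<^sup>2"
      unfolding n distrib_left by (intro add_mono mult_right_mono) auto
    then show ?thesis using upper[of u \<xi>] by (simp add: z)
  qed
  assume zD: "z \<in> D_e \<gamma>"
  define p I N where "p = pt_val u 1" and "I = inner u one" and "N = (norm u)\<^sup>2"
  have I2: "I\<^sup>2 \<le> N" unfolding I_def N_def using inner_one_le[of u] by (simp add: power2_le_iff_abs_le)
  have t1: "lam * \<gamma> * (p * \<xi>) \<le> lam * \<xi>\<^sup>2 / 4 + lam * \<gamma>\<^sup>2 * p\<^sup>2"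
  proof -
    have "0 \<le> lam * (\<xi> / 2 - \<gamma> * p)\<^sup>2" using pos by simp
    then show ?thesis by (simp add: power2_eq_square algebra_simps)
  qed
  have t2: "k * (I * \<xi>) \<le> lam * \<xi>\<^sup>2 / 4 + k\<^sup>2 / lam * N"
  proof -
    have "0 \<le> lam * (\<xi> / 2 - k / lam * I)\<^sup>2" using pos by simp
    also have "\<dots> = lam * \<xi>\<^sup>2 / 4 - k * (I * \<xi>) + k\<^sup>2 / lam * I\<^sup>2"
      using pos by (simp add: power2_eq_square field_simps)
    finally have "k * (I * \<xi>) \<le> lam * \<xi>\<^sup>2 / 4 + k\<^sup>2 / lam * I\<^sup>2" by simp
    moreover have "k\<^sup>2 / lam * I\<^sup>2 \<le> k\<^sup>2 / lam * N" using I2 pos by (intro mult_left_mono) auto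
    ultimately show ?thesis by linarith
  qed
  have t3: "\<rho> * (p * I) \<le> \<rho> / 2 * p\<^sup>2 + \<rho> / 2 * N"
  proof -
    have "p * I \<le> (p\<^sup>2 + N) / 2" using sum_squares_bound[of p I] I2 by simp
    from mult_left_mono[OF this, of \<rho>] pos show ?thesis by (simp add: algebra_simps)
  qed
  have "B_e \<epsilon> z (A_e lam k \<rho> z) = - \<rho> * lam * \<gamma> * p\<^sup>2 - \<rho> * lam * (norm (L2_dx u))\<^sup>2 - \<rho> * k * N
      - \<epsilon> / 2 * (lam * \<xi>\<^sup>2 - lam * \<gamma> * (p * \<xi>) - k * (I * \<xi>) - \<rho> * (p * I))"
    using B_e_A_e[of u \<xi> \<epsilon>] zD by (simp add: z p_def I_def N_def)
  also have "\<dots> \<le> - \<rho> * lam * \<gamma> * p\<^sup>2 - \<rho> * k * N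
      - \<epsilon> / 2 * (lam * \<xi>\<^sup>2 / 2 - (lam * \<gamma>\<^sup>2 + \<rho> / 2) * p\<^sup>2 - (k\<^sup>2 / lam + \<rho> / 2) * N)"
  proof -
    have "lam * \<xi>\<^sup>2 / 2 - (lam * \<gamma>\<^sup>2 + \<rho> / 2) * p\<^sup>2 - (k\<^sup>2 / lam + \<rho> / 2) * N
        \<le> lam * \<xi>\<^sup>2 - lam * \<gamma> * (p * \<xi>) - k * (I * \<xi>) - \<rho> * (p * I)"
      using t1 t2 t3 unfolding distrib_right by linarith
    from mult_left_mono[OF this, of "\<epsilon> / 2"] \<epsilon>(1) have
      "\<epsilon> / 2 * (lam * \<xi>\<^sup>2 / 2 - (lam * \<gamma>\<^sup>2 + \<rho> / 2) * p\<^sup>2 - (k\<^sup>2 / lam + \<rho> / 2) * N)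
        \<le> \<epsilon> / 2 * (lam * \<xi>\<^sup>2 - lam * \<gamma> * (p * \<xi>) - k * (I * \<xi>) - \<rho> * (p * I))" by simp
    moreover have "0 \<le> \<rho> * lam * (norm (L2_dx u))\<^sup>2" using pos by simp
    ultimately show ?thesis by linarith
  qed
  also have "\<dots> = (\<epsilon> / 2 * (lam * \<gamma>\<^sup>2 + \<rho> / 2) - \<rho> * lam * \<gamma>) * p\<^sup>2
      + (\<epsilon> / 2 * (k\<^sup>2 / lam + \<rho> / 2) - \<rho> * k) * N - \<epsilon> / 4 * (lam * \<xi>\<^sup>2)"
    by (simp add: algebra_simps)
  also have "\<dots> \<le> 0 * p\<^sup>2 + (- \<rho> * k / 2) * N - \<epsilon> / 4 * (lam * \<xi>\<^sup>2)"
  proof (intro add_mono diff_right_mono mult_right_mono)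
    show "\<epsilon> / 2 * (k\<^sup>2 / lam + \<rho> / 2) - \<rho> * k \<le> - \<rho> * k / 2" using c2 by linarith
  qed (use c1 in \<open>auto simp: N_def\<close>)
  also have "\<dots> \<le> - c * (3 / 2 * (\<rho> * N + lam * \<xi>\<^sup>2))"
  proof -
    have "c * (3 / 2 * (\<rho> * N)) \<le> k / 3 * (3 / 2 * (\<rho> * N))"
      "c * (3 / 2 * (lam * \<xi>\<^sup>2)) \<le> \<epsilon> / 6 * (3 / 2 * (lam * \<xi>\<^sup>2))"
      using pos by (intro mult_right_mono; simp add: c_def N_def)+
    then show ?thesis by (simp add: algebra_simps)
  qed
  also have "\<dots> \<le> - c * B_e \<epsilon> z z"
    using mult_left_mono[OF upper[of u \<xi>], of c] \<open>0 < c\<close> by (simp add: z N_def)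
  finally show "B_e \<epsilon> z (A_e lam k \<rho> z) \<le> - c * B_e \<epsilon> z z" .
qed

end

section \<open>Solutions of the total system\<close>

lemma fst_snd_integral:
  fixes g :: "real \<Rightarrow> 'a::banach \<times> 'b::banach"
  assumes "continuous_on {a..b} g"
  shows "fst (integral {a..b} g) = integral {a..b} (\<lambda>s. fst (g s))"
    and "snd (integral {a..b} g) = integral {a..b} (\<lambda>s. snd (g s))"
proof -
  have i: "g integrable_on {a..b}" by (rule integrable_continuous_real[OF assms])
  show "fst (integral {a..b} g) = integral {a..b} (\<lambda>s. fst (g s))"
    using integral_linear[OF i bounded_linear_fst] by (simp add: o_def)
  show "snd (integral {a..b} g) = integral {a..b} (\<lambda>s. snd (g s))"
    using integral_linear[OF i bounded_linear_snd] by (simp add: o_def)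
qed

context error_system
begin

abbreviation "Dt \<equiv> D_tot \<alpha> \<gamma>"
abbreviation "At \<equiv> A_tot lam k \<rho>"
abbreviation "ft \<equiv> f_tot lam k y_r u_r"
abbreviation "solution \<equiv> is_solution Dt At ft"
abbreviation "maximal \<equiv> is_maximal_solution Dt At ft"
abbreviation "mild_e \<equiv> mild_solution (D_e \<gamma>) (A_e lam k \<rho>)"
abbreviation "mild_eta \<equiv> mild_solution (D_eta \<alpha>) (A_eta lam)"
abbreviation "\<Psi> \<equiv> Psi lam k y_r"

text \<open>The part of the first equation that depends on \<open>(u, \<xi>)\<close> alone and acts
  as forcing.\<close>

definition F_eta :: "L2 \<times> real \<Rightarrow> L2" where
  "F_eta z = - ((k - \<Psi> (snd z)) *\<^sub>R (fst z + u_r))"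

lemma ft_eq: "ft z = (F_eta (snd z) - \<Psi> (snd (snd z)) *\<^sub>R fst z, 0, 0)"
  by (simp add: f_tot_def F_eta_def split: prod.splits)

lemma continuous_on_Psi:
  assumes "continuous_on S g"
  shows "continuous_on S (\<lambda>s. \<Psi> (g s))"
  using continuous_on_compose2[OF Psi_continuous[OF pos(1) y_r] assms] by simp

lemma continuous_on_ft:
  assumes "continuous_on S \<phi>"
  shows "continuous_on S (\<lambda>s. F_eta (snd (\<phi> s)))" "continuous_on S (\<lambda>s. \<Psi> (snd (snd (\<phi> s))))"
    "continuous_on S (\<lambda>s. ft (\<phi> s))"
  unfolding ft_eq F_eta_def by (intro continuous_intros continuous_on_Psi assms)+

text \<open>The second block is autonomous, and the first is an equation forced by a function of
  time. Restriction to a compact interval inside the lifetime brings both into the linear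
  setting.\<close>

lemma solution_components:
  assumes sol: "solution T \<phi>" and S: "ereal S < T"
  shows "continuous_on {0..S} \<phi>"
    and "mild_e S (\<lambda>_. 0) (snd (\<phi> 0)) (\<lambda>s. snd (\<phi> s))"
    and "mild_eta S
      (\<lambda>s. F_eta (snd (\<phi> s)) - \<Psi> (snd (snd (\<phi> s))) *\<^sub>R fst (\<phi> s)) (fst (\<phi> 0)) (\<lambda>s. fst (\<phi> s))"
proof -
  have dom: "t \<in> time_dom T" if "t \<in> {0..S}" for t
    using that le_less_trans[OF _ S, of "ereal t"] by (auto simp: time_dom_def)
  then have sub: "{0..S} \<subseteq> time_dom T" by blast
  show cont: "continuous_on {0..S} \<phi>"
    using sol sub by (auto simp: is_solution_def intro: continuous_on_subset)
  have *: "integral {0..t} \<phi> \<in> Dt" "\<phi> t = \<phi> 0 + At (integral {0..t} \<phi>) + integral {0..t} (\<lambda>s. ft (\<phi> s))"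
    if "t \<in> {0..S}" for t
    using sol dom[OF that] unfolding is_solution_def by blast+
  have c: "continuous_on {0..t} \<phi>" "continuous_on {0..t} (\<lambda>s. ft (\<phi> s))" if "t \<in> {0..S}" for t
    using that by (auto intro!: continuous_on_subset[OF cont] continuous_on_ft)
  have eqs: "integral {0..t} (\<lambda>s. fst (\<phi> s)) \<in> D_eta \<alpha>" "integral {0..t} (\<lambda>s. snd (\<phi> s)) \<in> D_e \<gamma>"
    "fst (\<phi> t) = fst (\<phi> 0) + A_eta lam (integral {0..t} (\<lambda>s. fst (\<phi> s))) +
      integral {0..t} (\<lambda>s. F_eta (snd (\<phi> s)) - \<Psi> (snd (snd (\<phi> s))) *\<^sub>R fst (\<phi> s))"
    "snd (\<phi> t) = snd (\<phi> 0) + A_e lam k \<rho> (integral {0..t} (\<lambda>s. snd (\<phi> s)))"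
    if t: "t \<in> {0..S}" for t
  proof -
    note i = fst_snd_integral[OF c(1)[OF t]] fst_snd_integral[OF c(2)[OF t]]
    show "integral {0..t} (\<lambda>s. fst (\<phi> s)) \<in> D_eta \<alpha>" "integral {0..t} (\<lambda>s. snd (\<phi> s)) \<in> D_e \<gamma>"
      using *(1)[OF t] unfolding i(1,2)[symmetric] D_tot_def by auto
    have A1: "fst (At z) = A_eta lam (fst z)" "snd (At z) = A_e lam k \<rho> (snd z)" for z
      by (auto simp: A_tot_def split: prod.splits)
    show "fst (\<phi> t) = fst (\<phi> 0) + A_eta lam (integral {0..t} (\<lambda>s. fst (\<phi> s))) +
      integral {0..t} (\<lambda>s. F_eta (snd (\<phi> s)) - \<Psi> (snd (snd (\<phi> s))) *\<^sub>R fst (\<phi> s))"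
      using arg_cong[OF *(2)[OF t], of fst] by (simp only: fst_add A1 i) (simp add: ft_eq)
    have "snd (integral {0..t} (\<lambda>s. ft (\<phi> s))) = 0" unfolding i by (simp add: ft_eq zero_prod_def)
    then show "snd (\<phi> t) = snd (\<phi> 0) + A_e lam k \<rho> (integral {0..t} (\<lambda>s. snd (\<phi> s)))"
      using arg_cong[OF *(2)[OF t], of snd] by (simp only: snd_add A1 i(1,2)) simp
  qed
  show "mild_e S (\<lambda>_. 0) (snd (\<phi> 0)) (\<lambda>s. snd (\<phi> s))"
    unfolding mild_solution_def
  proof (intro conjI ballI)
    show "continuous_on {0..S} (\<lambda>s. snd (\<phi> s))" by (intro continuous_intros cont)
    fix t assume t: "t \<in> {0..S}"
    show "integral {0..t} (\<lambda>s. snd (\<phi> s)) \<in> D_e \<gamma>" by (rule eqs(2)[OF t])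
    show "snd (\<phi> t) = snd (\<phi> 0) + A_e lam k \<rho> (integral {0..t} (\<lambda>s. snd (\<phi> s))) + integral {0..t} (\<lambda>_. 0)"
      by (subst eqs(4)[OF t]) simp
  qed
  show "mild_eta S
      (\<lambda>s. F_eta (snd (\<phi> s)) - \<Psi> (snd (snd (\<phi> s))) *\<^sub>R fst (\<phi> s)) (fst (\<phi> 0)) (\<lambda>s. fst (\<phi> s))"
    unfolding mild_solution_def using eqs(1,3) by (intro conjI ballI continuous_intros cont)
qed

lemma ex_solution:
  assumes S: "0 < S"
  obtains \<psi> where "solution (ereal S) \<psi>" "\<psi> 0 = x"
proof -
  obtain z where z: "mild_e S (\<lambda>_. 0) (snd x) z"
    by (rule e.ex_mild_solution_homogeneous[OF S])
  have cz: "continuous_on {0..S} z" using z by (simp add: mild_solution_def)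
  have "continuous_on {0..S} (\<lambda>s. \<Psi> (snd (z s)))" "continuous_on {0..S} (\<lambda>s. F_eta (z s))"
    unfolding F_eta_def by (intro continuous_intros continuous_on_Psi cz)+
  then obtain \<eta> where \<eta>: "mild_eta S (\<lambda>s. F_eta (z s) - \<Psi> (snd (z s)) *\<^sub>R \<eta> s) (fst x) \<eta>"
    using eta.ex_mild_solution_scalar_coefficient[OF S] by blast
  have c\<eta>: "continuous_on {0..S} \<eta>" using \<eta> by (simp add: mild_solution_def)
  define \<psi> where "\<psi> s = (\<eta> s, z s)" for s
  have c: "continuous_on {0..S} \<psi>" unfolding \<psi>_def by (intro continuous_intros cz c\<eta>)
  have \<psi>0: "\<psi> 0 = x"
    using eta.mild_solution_0[OF \<eta>] e.mild_solution_0[OF z] S by (simp add: \<psi>_def)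
  have "solution (ereal S) \<psi>"
    unfolding is_solution_def
  proof (intro conjI ballI)
    show "0 \<le> ereal S" using S by simp
    have sub: "time_dom (ereal S) \<subseteq> {0..S}" by (auto simp: time_dom_def)
    then show "continuous_on (time_dom (ereal S)) \<psi>" by (rule continuous_on_subset[OF c])
    fix t assume "t \<in> time_dom (ereal S)"
    then have t: "t \<in> {0..S}" using sub by blast
    have ct: "continuous_on {0..t} \<psi>" using t by (auto intro: continuous_on_subset[OF c])
    note i = fst_snd_integral[OF ct] fst_snd_integral[OF continuous_on_ft(3)[OF ct]]
    have I: "integral {0..t} \<psi> = (integral {0..t} \<eta>, integral {0..t} z)"
      using i(1,2) by (intro prod_eqI) (simp_all add: \<psi>_def)
    have "snd (integral {0..t} (\<lambda>s. ft (\<psi> s))) = 0" unfolding i(4) by (simp add: ft_eq zero_prod_def)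
    then have If: "integral {0..t} (\<lambda>s. ft (\<psi> s)) = (integral {0..t} (\<lambda>s. F_eta (z s) - \<Psi> (snd (z s)) *\<^sub>R \<eta> s), 0)"
      using i(3) by (intro prod_eqI) (simp_all add: \<psi>_def ft_eq)
    have m: "integral {0..t} \<eta> \<in> D_eta \<alpha>" "integral {0..t} z \<in> D_e \<gamma>"
      "\<eta> t = fst x + A_eta lam (integral {0..t} \<eta>) + integral {0..t} (\<lambda>s. F_eta (z s) - \<Psi> (snd (z s)) *\<^sub>R \<eta> s)"
      "z t = snd x + A_e lam k \<rho> (integral {0..t} z)"
      using \<eta> z t by (auto simp: mild_solution_def)
    show "integral {0..t} \<psi> \<in> Dt" using m by (simp add: I D_tot_def)
    show "\<psi> t = \<psi> 0 + At (integral {0..t} \<psi>) + integral {0..t} (\<lambda>s. ft (\<psi> s))"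
      unfolding I If \<psi>0 by (rule prod_eqI) (simp_all add: \<psi>_def A_tot_def m(3) m(4))
  qed
  then show thesis using \<psi>0 by (rule that)
qed

text \<open>The \<open>(u, \<xi>)\<close> parts agree by linearity. The forcing then cancels in the
  difference \<open>d\<close> of the first components, and the remaining term
  \<open>- (p s *\<^sub>R d s)\<close> cannot increase the norm of \<open>d\<close> since \<Psi> is
  nonnegative.\<close>

lemma solution_unique:
  assumes \<phi>: "solution T \<phi>" and \<psi>: "solution T' \<psi>"
    and init: "\<phi> 0 = \<psi> 0" and t: "0 \<le> t" "ereal t < T" "ereal t < T'"
  shows "\<phi> t = \<psi> t"
proof -
  obtain S where S: "t < S" "ereal S < T" "ereal S < T'"
  proof -
    have "ereal t < min T T'" using t by simp
    then obtain S where "ereal t < S" "S < min T T'" using dense by blast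
    then have "\<bar>S\<bar> \<noteq> \<infinity>" by auto
    then obtain s where "S = ereal s" by auto
    then show thesis using that[of s] \<open>ereal t < S\<close> \<open>S < min T T'\<close> by auto
  qed
  note C = solution_components[OF \<phi> S(2)] and C' = solution_components[OF \<psi> S(3)]
  have S0: "0 < S" using t S by simp
  have "mild_e S (\<lambda>t. 1 *\<^sub>R 0 + (-1) *\<^sub>R 0) (1 *\<^sub>R snd (\<phi> 0) + (-1) *\<^sub>R snd (\<psi> 0))
      (\<lambda>s. 1 *\<^sub>R snd (\<phi> s) + (-1) *\<^sub>R snd (\<psi> s))"
    by (rule e.mild_solution_lincomb[OF C(2) C'(2)]) auto
  then have e0: "mild_e S (\<lambda>t. 0) 0 (\<lambda>s. snd (\<phi> s) - snd (\<psi> s))"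
    using init by simp
  have snd_eq: "snd (\<phi> s) = snd (\<psi> s)" if s: "s \<in> {0..S}" for s
    using e.mild_solution_bound[OF e0 _ S0 _ s, of 0] by simp
  define p where "p s = \<Psi> (snd (snd (\<phi> s)))" for s
  define d where "d s = fst (\<phi> s) - fst (\<psi> s)" for s
  have cF: "continuous_on {0..S} (\<lambda>s. F_eta (snd (\<phi> s)) - \<Psi> (snd (snd (\<phi> s))) *\<^sub>R fst (\<phi> s))"
    "continuous_on {0..S} (\<lambda>s. F_eta (snd (\<psi> s)) - \<Psi> (snd (snd (\<psi> s))) *\<^sub>R fst (\<psi> s))"
    by (intro continuous_intros continuous_on_ft(1,2) C(1) C'(1))+
  have "mild_eta S (\<lambda>s. 1 *\<^sub>R (F_eta (snd (\<phi> s)) - \<Psi> (snd (snd (\<phi> s))) *\<^sub>R fst (\<phi> s))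
      + (-1) *\<^sub>R (F_eta (snd (\<psi> s)) - \<Psi> (snd (snd (\<psi> s))) *\<^sub>R fst (\<psi> s)))
      (1 *\<^sub>R fst (\<phi> 0) + (-1) *\<^sub>R fst (\<psi> 0)) (\<lambda>s. 1 *\<^sub>R fst (\<phi> s) + (-1) *\<^sub>R fst (\<psi> s))"
    by (rule eta.mild_solution_lincomb[OF C(3) C'(3) cF])
  then have "mild_eta S (\<lambda>s. - (p s *\<^sub>R d s)) (1 *\<^sub>R fst (\<phi> 0) + (-1) *\<^sub>R fst (\<psi> 0))
      (\<lambda>s. 1 *\<^sub>R fst (\<phi> s) + (-1) *\<^sub>R fst (\<psi> s))"
    by (rule mild_solution_cong) (simp add: snd_eq p_def d_def algebra_simps)
  then have m: "mild_eta S (\<lambda>s. - (p s *\<^sub>R d s)) 0 d"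
    unfolding d_def using init by simp
  have cd: "continuous_on {0..S} d" "continuous_on {0..S} p"
    unfolding d_def p_def by (intro continuous_intros continuous_on_ft(2) C(1) C'(1))+
  have "exp (2 * 0 * t) * inner (d t) (d t) \<le> inner 0 (0::L2) +
    integral {0..t} (\<lambda>s. exp (2 * 0 * s) * (2 * (0 - 0) * inner (d s) (d s) + 2 * inner (d s) (- (p s *\<^sub>R d s))))"
    by (rule eta.mild_solution_energy[OF m _ bounded_bilinear_inner inner_commute _ t(1) S(1)])
      (use eta.dissipative in \<open>auto intro!: continuous_intros cd\<close>)
  also have "\<dots> \<le> inner 0 (0::L2) + integral {0..t} (\<lambda>s. 0)"
  proof (intro add_left_mono integral_le)
    show "(\<lambda>s. exp (2 * 0 * s) * (2 * (0 - 0) * inner (d s) (d s) + 2 * inner (d s) (- (p s *\<^sub>R d s)))) integrable_on {0..t}"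
      using S by (intro integrable_continuous_real continuous_intros continuous_on_subset[OF cd(1)] continuous_on_subset[OF cd(2)]) auto
    fix s
    show "exp (2 * 0 * s) * (2 * (0 - 0) * inner (d s) (d s) + 2 * inner (d s) (- (p s *\<^sub>R d s))) \<le> 0"
      using Psi_nonneg[OF pos(1)] by (simp add: p_def)
  qed (rule integrable_const_ivl)
  finally have "d t = 0" using inner_ge_zero[of "d t"] by (simp add: order_antisym_conv)
  then show ?thesis using snd_eq[of t] t S by (intro prod_eqI) (auto simp: d_def)
qed

text \<open>A solution on a time interval longer by 1 agrees with the given one by uniqueness, which
  contradicts maximality. The case \<open>T = 0\<close> is included: there are no times to
  compare.\<close>

lemma maximal_solution_global:
  assumes "maximal T \<phi>"
  shows "T = \<infinity>"
proof (rule ccontr)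
  assume "T \<noteq> \<infinity>"
  have sol: "solution T \<phi>" and max: "\<And>T' \<psi>. T < T' \<Longrightarrow> solution T' \<psi> \<Longrightarrow>
      \<not> (\<forall>t\<in>time_dom T. \<psi> t = \<phi> t)"
    using assms unfolding is_maximal_solution_def by blast+
  have "0 \<le> T" using sol by (simp add: is_solution_def)
  then obtain r where r: "T = ereal r" "0 \<le> r" using \<open>T \<noteq> \<infinity>\<close> by (cases T) auto
  obtain \<psi> where \<psi>: "solution (ereal (r + 1)) \<psi>" "\<psi> 0 = \<phi> 0"
    by (rule ex_solution[of "r + 1" "\<phi> 0"]) (use r in simp, rule that)
  have "\<psi> t = \<phi> t" if "t \<in> time_dom T" for t
    using solution_unique[OF \<psi>(1) sol \<psi>(2), of t] that r by (auto simp: time_dom_def)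
  then show False using max[OF _ \<psi>(1)] r by simp
qed

text \<open>The last two components decay exponentially. In the first component
  \<open>k - \<Psi>\<close> inherits this decay, and \<open>- \<Psi> \<eta>\<close> is dissipative.\<close>

lemma exponential_decay:
  obtains \<mu> where "0 < \<mu>"
    "\<And>R. 0 \<le> R \<Longrightarrow> \<exists>\<kappa>\<ge>0. \<forall>T \<phi> t. solution T \<phi> \<and> norm (\<phi> 0) \<le> R \<and> 0 \<le> t \<and> ereal t < T \<longrightarrow>
      norm (\<phi> t) \<le> \<kappa> * exp (- \<mu> * t) * norm (\<phi> 0)"
proof -
  obtain \<epsilon> c m M where c: "0 < c" and m: "0 < m" and M: "0 \<le> M"
    and lo: "\<And>z. m * (norm z)\<^sup>2 \<le> B_e \<epsilon> z z" and up: "\<And>z. B_e \<epsilon> z z \<le> M * (norm z)\<^sup>2"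
    and diss: "\<And>z. z \<in> D_e \<gamma> \<Longrightarrow> B_e \<epsilon> z (A_e lam k \<rho> z) \<le> - c * B_e \<epsilon> z z"
    by (rule lyapunov, rule that)
  define b where "b = lam * min \<alpha> 1 / 2"
  have b: "0 < b" using pos by (simp add: b_def)
  \<comment> \<open>With \<open>a \<le> c\<close> the decay of the forcing compensates the weight
    \<open>exp (2 * a * s)\<close>; with \<open>2 * a \<le> b\<close> a dissipation of size
    \<open>b\<close> is left to absorb the mixed product of \<eta> and the forcing.\<close>
  define a where "a = min c (b / 2)"
  have a: "0 < a" "a \<le> c" "2 * a \<le> b" using b c by (auto simp: a_def)
  define q where "q = sqrt (M / m)"
  have q: "0 \<le> q" "q\<^sup>2 = M / m" using m M by (auto simp: q_def)
  show thesis
  \<comment> \<open>The bound for the weighted squared norm of \<eta> still grows linearly in time.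
    Estimating \<open>t\<close> by \<open>exp (a * t) / a\<close> costs half of the rate.\<close>
  proof (rule that[of "a / 2"])
    show "0 < a / 2" using a by simp
    fix R :: real assume R: "0 \<le> R"
    obtain L where L: "0 \<le> L" "\<And>\<xi> \<zeta>. \<bar>\<xi>\<bar> \<le> q * R \<Longrightarrow> \<bar>\<zeta>\<bar> \<le> q * R \<Longrightarrow> \<bar>\<Psi> \<xi> - \<Psi> \<zeta>\<bar> \<le> L * \<bar>\<xi> - \<zeta>\<bar>"
      by (rule Psi_lipschitz[OF pos(1) y_r, of "q * R" k], rule that)
    \<comment> \<open>A Lipschitz bound for \<open>k - \<Psi>\<close> times a bound for
      \<open>u + u_r\<close>. The radius \<open>R\<close> affects the final constant only through
      \<open>Q\<close>.\<close>
    define Q where "Q = L * q * (q * R + norm u_r)"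
    have Q: "0 \<le> Q" using L q R by (simp add: Q_def)
    define C where "C = 1 + Q\<^sup>2 / (b * a)"
    have C: "0 \<le> C" using a b by (simp add: C_def)
    show "\<exists>\<kappa>\<ge>0. \<forall>T \<phi> t. solution T \<phi> \<and> norm (\<phi> 0) \<le> R \<and> 0 \<le> t \<and> ereal t < T \<longrightarrow>
      norm (\<phi> t) \<le> \<kappa> * exp (- (a / 2) * t) * norm (\<phi> 0)"
    proof (intro exI[of _ "sqrt (C + q\<^sup>2)"] conjI allI impI)
      show "0 \<le> sqrt (C + q\<^sup>2)" using C by simp
      fix T :: ereal and \<phi> :: "real \<Rightarrow> L2 \<times> L2 \<times> real" and t :: real
      assume "solution T \<phi> \<and> norm (\<phi> 0) \<le> R \<and> 0 \<le> t \<and> ereal t < T"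
      then have sol: "solution T \<phi>" and \<phi>R: "norm (\<phi> 0) \<le> R" and t: "0 \<le> t" "ereal t < T" by auto
      obtain S where S: "t < S" "ereal S < T"
      proof -
        obtain S where S': "ereal t < S" "S < T" using dense[OF t(2)] by blast
        then have "\<bar>S\<bar> \<noteq> \<infinity>" by auto
        then obtain s where "S = ereal s" by auto
        then show thesis using that[of s] S' by auto
      qed
      note comp = solution_components[OF sol S(2)]
      define N where "N = norm (\<phi> 0)"
      have N: "0 \<le> N" "N \<le> R" "norm (fst (\<phi> 0)) \<le> N" "norm (snd (\<phi> 0)) \<le> N"
        using \<phi>R by (auto simp: N_def norm_fst_le norm_snd_le)
           (metis norm_fst_le norm_snd_le prod.collapse)+
      define z where "z s = snd (\<phi> s)" for s
      have z: "norm (z s) \<le> q * exp (- c * s) * N" if s: "0 \<le> s" "s \<le> t" for s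
      proof -
        have sS: "s < S" using s S by simp
        \<comment> \<open>The energy estimate accepts any symmetric bounded form, here the strict
          Lyapunov function. With the weight rate equal to the dissipation rate and no forcing, its
          integrand vanishes.\<close>
        have "exp (2 * c * s) * B_e \<epsilon> (z s) (z s) \<le> B_e \<epsilon> (snd (\<phi> 0)) (snd (\<phi> 0)) +
          integral {0..s} (\<lambda>r. exp (2 * c * r) * (2 * (c - c) * B_e \<epsilon> (z r) (z r) + 2 * B_e \<epsilon> (z r) 0))"
          unfolding z_def
          by (rule e.mild_solution_energy[OF comp(2) _ B_e_bilinear B_e_sym diss s(1) sS]) auto
        also have "\<dots> = B_e \<epsilon> (snd (\<phi> 0)) (snd (\<phi> 0))"
          by (simp add: bounded_bilinear.zero_right[OF B_e_bilinear])
        also have "\<dots> \<le> M * N\<^sup>2"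
          using N M by (intro order_trans[OF up] mult_left_mono power_mono) auto
        finally have 1: "exp (2 * c * s) * B_e \<epsilon> (z s) (z s) \<le> M * N\<^sup>2" .
        have "exp (2 * c * s) * (m * (norm (z s))\<^sup>2) \<le> M * N\<^sup>2"
          by (rule order_trans[OF mult_left_mono[OF lo] 1]) simp
        then have "(norm (z s))\<^sup>2 \<le> M * N\<^sup>2 / (exp (2 * c * s) * m)"
          using m by (simp add: pos_le_divide_eq mult_ac)
        also have "\<dots> = (q * exp (- c * s) * N)\<^sup>2"
        proof -
          have "(exp (- c * s))\<^sup>2 = inverse (exp (2 * c * s))"
            by (simp add: power2_eq_square flip: exp_add exp_minus)
          then show ?thesis by (simp add: power_mult_distrib q(2) divide_inverse mult_ac)
        qed
        finally show ?thesis by (rule power2_le_imp_le) (use q N in simp)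
      qed
      have z1: "\<bar>snd (z s)\<bar> \<le> q * exp (- c * s) * N" "norm (fst (z s)) \<le> q * R" "\<bar>snd (z s)\<bar> \<le> q * R"
        if s: "0 \<le> s" "s \<le> t" for s
      proof -
        have e1: "exp (- c * s) \<le> 1" using c s by simp
        have "q * exp (- c * s) * N \<le> q * 1 * R" 
          using q N e1 by (intro mult_mono) auto
        moreover have "norm (fst (z s)) \<le> norm (z s)" "\<bar>snd (z s)\<bar> \<le> norm (z s)"
          by (metis norm_fst_le prod.collapse, metis norm_snd_le prod.collapse real_norm_def)
        ultimately show "\<bar>snd (z s)\<bar> \<le> q * exp (- c * s) * N" "norm (fst (z s)) \<le> q * R" "\<bar>snd (z s)\<bar> \<le> q * R"
          using z[OF s] by auto
      qed
      define \<eta> where "\<eta> s = fst (\<phi> s)" for s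
      have c\<eta>: "continuous_on {0..S} \<eta>" "continuous_on {0..S} (\<lambda>s. F_eta (z s) - \<Psi> (snd (z s)) *\<^sub>R \<eta> s)"
        unfolding \<eta>_def z_def by (intro continuous_intros continuous_on_ft(1,2) comp(1))+
      have "exp (2 * a * t) * inner (\<eta> t) (\<eta> t) \<le> inner (fst (\<phi> 0)) (fst (\<phi> 0)) +
        integral {0..t} (\<lambda>s. exp (2 * a * s) * (2 * (a - b) * inner (\<eta> s) (\<eta> s) +
          2 * inner (\<eta> s) (F_eta (z s) - \<Psi> (snd (z s)) *\<^sub>R \<eta> s)))"
        using A_eta_dissipation c\<eta>(2) unfolding \<eta>_def z_def b_def
        by (intro eta.mild_solution_energy[OF comp(3) _ bounded_bilinear_inner inner_commute _ t(1) S(1)])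
      also have "\<dots> \<le> N\<^sup>2 + integral {0..t} (\<lambda>s. Q\<^sup>2 * N\<^sup>2 / b)"
      proof (intro add_mono integral_le)
        show "inner (fst (\<phi> 0)) (fst (\<phi> 0)) \<le> N\<^sup>2"
          using N by (simp add: power2_norm_eq_inner[symmetric] power_mono)
        show "(\<lambda>s. exp (2 * a * s) * (2 * (a - b) * inner (\<eta> s) (\<eta> s) +
          2 * inner (\<eta> s) (F_eta (z s) - \<Psi> (snd (z s)) *\<^sub>R \<eta> s))) integrable_on {0..t}"
          using S by (intro integrable_continuous_real continuous_intros continuous_on_subset[OF c\<eta>(1)] continuous_on_subset[OF c\<eta>(2)]) auto
        show "(\<lambda>s. Q\<^sup>2 * N\<^sup>2 / b) integrable_on {0..t}" by (rule integrable_const_ivl)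
        fix s assume "s \<in> {0..t}"
        then have s: "0 \<le> s" "s \<le> t" by auto
        define y where "y = norm (F_eta (z s))"
        have "y = \<bar>\<Psi> 0 - \<Psi> (snd (z s))\<bar> * norm (fst (z s) + u_r)"
          by (simp add: y_def F_eta_def Psi_zero[OF pos(1,2) y_r])
        also have "\<dots> \<le> (L * (q * exp (- c * s) * N)) * (q * R + norm u_r)"
        proof (intro mult_mono)
          have "\<bar>\<Psi> 0 - \<Psi> (snd (z s))\<bar> \<le> L * \<bar>0 - snd (z s)\<bar>"
            using q R z1(3)[OF s] by (intro L(2)) auto
          also have "\<dots> \<le> L * (q * exp (- c * s) * N)"
            using z1(1)[OF s] L(1) by (intro mult_left_mono) auto
          finally show "\<bar>\<Psi> 0 - \<Psi> (snd (z s))\<bar> \<le> L * (q * exp (- c * s) * N)" .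
          show "norm (fst (z s) + u_r) \<le> q * R + norm u_r"
            using z1(2)[OF s] norm_triangle_ineq[of "fst (z s)" u_r] by linarith
        qed (use L q N in auto)
        also have "\<dots> = Q * exp (- c * s) * N" by (simp add: Q_def)
        finally have y: "y \<le> Q * exp (- c * s) * N" .
        have y0: "0 \<le> y" by (simp add: y_def)
        define n where "n = norm (\<eta> s)"
        have "inner (\<eta> s) (F_eta (z s)) \<le> n * y" unfolding n_def y_def by (rule norm_cauchy_schwarz)
        moreover have "2 * (n * y) \<le> b * n\<^sup>2 + y\<^sup>2 / b"
        proof -
          have "0 \<le> (b * n - y)\<^sup>2 / b" using b by simp
          also have "\<dots> = b * n\<^sup>2 + y\<^sup>2 / b - 2 * (n * y)" using b by (simp add: power2_eq_square field_simps)
          finally show ?thesis by simp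
        qed
        moreover have "0 \<le> \<Psi> (snd (z s)) * n\<^sup>2" using Psi_nonneg[OF pos(1)] by simp
        moreover have "inner (\<eta> s) (F_eta (z s) - \<Psi> (snd (z s)) *\<^sub>R \<eta> s) = inner (\<eta> s) (F_eta (z s)) - \<Psi> (snd (z s)) * n\<^sup>2"
          by (simp add: inner_diff_right n_def power2_norm_eq_inner)
        moreover have "(2 * a - b) * n\<^sup>2 \<le> 0" using a by (simp add: mult_le_0_iff)
        moreover have "2 * (a - b) * n\<^sup>2 = (2 * a - b) * n\<^sup>2 - b * n\<^sup>2" by (simp add: algebra_simps)
        ultimately have "2 * (a - b) * n\<^sup>2 + 2 * inner (\<eta> s) (F_eta (z s) - \<Psi> (snd (z s)) *\<^sub>R \<eta> s) \<le> y\<^sup>2 / b"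
          by linarith
        then have "2 * (a - b) * inner (\<eta> s) (\<eta> s) +
            2 * inner (\<eta> s) (F_eta (z s) - \<Psi> (snd (z s)) *\<^sub>R \<eta> s) \<le> y\<^sup>2 / b"
          by (simp only: n_def power2_norm_eq_inner)
        then have "exp (2 * a * s) * (2 * (a - b) * inner (\<eta> s) (\<eta> s) +
            2 * inner (\<eta> s) (F_eta (z s) - \<Psi> (snd (z s)) *\<^sub>R \<eta> s)) \<le> exp (2 * a * s) * (y\<^sup>2 / b)"
          by (rule mult_left_mono) simp
        also have "\<dots> = (exp (a * s) * y)\<^sup>2 / b"
          by (simp add: power_mult_distrib power2_eq_square flip: exp_add)
        also have "\<dots> \<le> (Q * N)\<^sup>2 / b"
        proof (intro divide_right_mono power_mono)
          have "exp (a * s) * y \<le> exp (c * s) * (Q * exp (- c * s) * N)"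
            using y y0 a s by (intro mult_mono) (auto intro: mult_right_mono)
          also have "\<dots> = Q * N" by (simp add: exp_minus)
          finally show "exp (a * s) * y \<le> Q * N" .
        qed (use b y0 in auto)
        finally show "exp (2 * a * s) * (2 * (a - b) * inner (\<eta> s) (\<eta> s) +
          2 * inner (\<eta> s) (F_eta (z s) - \<Psi> (snd (z s)) *\<^sub>R \<eta> s)) \<le> Q\<^sup>2 * N\<^sup>2 / b"
          by (simp add: power_mult_distrib)
      qed
      also have "\<dots> = N\<^sup>2 * (1 + Q\<^sup>2 / b * t)" using t by (simp add: algebra_simps)
      also have "\<dots> \<le> N\<^sup>2 * (C * exp (a * t))"
      proof (intro mult_left_mono)
        have e1: "1 \<le> exp (a * t)" "t \<le> exp (a * t) / a"
        proof -
          have "a * t \<le> exp (a * t)" using exp_ge_add_one_self[of "a * t"] by linarith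
          then show "t \<le> exp (a * t) / a" using a(1) by (simp add: pos_le_divide_eq mult.commute)
          show "1 \<le> exp (a * t)" using a(1) t(1) by simp
        qed
        have "Q\<^sup>2 / b * t \<le> Q\<^sup>2 / b * (exp (a * t) / a)" using e1 b by (intro mult_left_mono) auto
        moreover have "C * exp (a * t) = exp (a * t) + Q\<^sup>2 / b * (exp (a * t) / a)"
          by (simp add: C_def distrib_right)
        ultimately show "1 + Q\<^sup>2 / b * t \<le> C * exp (a * t)" using e1(1) by linarith
      qed simp
      finally have "exp (2 * a * t) * (norm (\<eta> t))\<^sup>2 \<le> N\<^sup>2 * (C * exp (a * t))"
        by (simp add: power2_norm_eq_inner)
      then have n1': "exp (- (2 * a * t)) * (exp (2 * a * t) * (norm (\<eta> t))\<^sup>2)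
          \<le> exp (- (2 * a * t)) * (N\<^sup>2 * (C * exp (a * t)))"
        by (rule mult_left_mono) simp
      have ex: "exp (- (2 * a * t)) * exp (2 * a * t) = 1" "exp (- (2 * a * t)) * exp (a * t) = exp (- (a * t))"
        unfolding exp_add[symmetric] by simp_all
      have "exp (- (2 * a * t)) * (exp (2 * a * t) * (norm (\<eta> t))\<^sup>2) = (norm (\<eta> t))\<^sup>2"
        unfolding mult.assoc[symmetric] ex by simp
      moreover have "exp (- (2 * a * t)) * (N\<^sup>2 * (C * exp (a * t))) = C * exp (- (a * t)) * N\<^sup>2"
        unfolding ex(2)[symmetric] by (simp only: mult_ac)
      ultimately have n1: "(norm (\<eta> t))\<^sup>2 \<le> C * exp (- (a * t)) * N\<^sup>2" using n1' by linarith
      have "(norm (z t))\<^sup>2 \<le> (q * exp (- c * t) * N)\<^sup>2" using z[of t] t by (intro power_mono) auto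
      also have "\<dots> = q\<^sup>2 * exp (- (2 * c * t)) * N\<^sup>2"
      proof -
        have "(exp (- c * t))\<^sup>2 = exp (- (2 * c * t))"
          unfolding power2_eq_square exp_add[symmetric] by simp
        then show ?thesis by (simp only: power_mult_distrib)
      qed
      also have "\<dots> \<le> q\<^sup>2 * exp (- (a * t)) * N\<^sup>2"
      proof (intro mult_right_mono mult_left_mono)
        have "a * t \<le> 2 * c * t" using a c t by (intro mult_right_mono) auto
        then show "exp (- (2 * c * t)) \<le> exp (- (a * t))" by simp
      qed auto
      finally have n2: "(norm (z t))\<^sup>2 \<le> q\<^sup>2 * exp (- (a * t)) * N\<^sup>2" .
      have "(norm (\<phi> t))\<^sup>2 = (norm (\<eta> t))\<^sup>2 + (norm (z t))\<^sup>2"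
        using norm_Pair[of "\<eta> t" "z t"] by (simp add: \<eta>_def z_def)
      also have "\<dots> \<le> (C + q\<^sup>2) * exp (- (a * t)) * N\<^sup>2"
        using n1 n2 by (simp add: distrib_right)
      also have "\<dots> = (sqrt (C + q\<^sup>2) * exp (- (a / 2) * t) * N)\<^sup>2"
      proof -
        have "(exp (- (a / 2) * t))\<^sup>2 = exp (- (a * t))"
          unfolding power2_eq_square exp_add[symmetric] by simp
        moreover have "(sqrt (C + q\<^sup>2))\<^sup>2 = C + q\<^sup>2" using C by simp
        ultimately show ?thesis by (simp only: power_mult_distrib)
      qed
      finally show "norm (\<phi> t) \<le> sqrt (C + q\<^sup>2) * exp (- (a / 2) * t) * norm (\<phi> 0)"
        unfolding N_def[symmetric] by (rule power2_le_imp_le) (use C N in simp)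
    qed
  qed
qed

text \<open>One decay estimate serves all notions: with radius 1 for stability and exponential
  stability, the prescribed radius for attractivity, and the norm of the initial value for
  boundedness, which is demanded of every solution and not just of maximal ones.\<close>

lemma GAS_LES: "origin_GAS Dt At ft \<and> origin_LES Dt At ft"
proof -
  obtain \<mu> where \<mu>: "0 < \<mu>" and decay: "\<And>R. 0 \<le> R \<Longrightarrow>
      \<exists>\<kappa>\<ge>0. \<forall>T \<phi> t. solution T \<phi> \<and> norm (\<phi> 0) \<le> R \<and> 0 \<le> t \<and> ereal t < T \<longrightarrow>
      norm (\<phi> t) \<le> \<kappa> * exp (- \<mu> * t) * norm (\<phi> 0)"
    by (rule exponential_decay, rule that)
  have max: "\<exists>\<kappa>>0. \<forall>T \<phi>. maximal T \<phi> \<and> norm (\<phi> 0) \<le> R \<longrightarrow>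
      T = \<infinity> \<and> (\<forall>t\<ge>0. norm (\<phi> t) \<le> \<kappa> * exp (- \<mu> * t) * norm (\<phi> 0))" if R: "0 \<le> R" for R
  proof -
    obtain \<kappa> where \<kappa>: "0 \<le> \<kappa>" "\<And>T \<phi> t. solution T \<phi> \<Longrightarrow> norm (\<phi> 0) \<le> R \<Longrightarrow> 0 \<le> t \<Longrightarrow> ereal t < T \<Longrightarrow>
      norm (\<phi> t) \<le> \<kappa> * exp (- \<mu> * t) * norm (\<phi> 0)" using decay[OF R] by blast
    show ?thesis
    \<comment> \<open>Adding 1 makes the constant strictly positive, as exponential stability
      demands.\<close>
    proof (intro exI[of _ "\<kappa> + 1"] conjI allI impI; (elim conjE)?)
      show "0 < \<kappa> + 1" using \<kappa> by simp
      fix T \<phi> assume ms: "maximal T \<phi>" and R: "norm (\<phi> 0) \<le> R"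
      show T: "T = \<infinity>" by (rule maximal_solution_global[OF ms])
      fix t :: real assume t: "0 \<le> t"
      have "norm (\<phi> t) \<le> \<kappa> * (exp (- \<mu> * t) * norm (\<phi> 0))"
        using \<kappa>(2)[of T \<phi> t] ms R t by (simp add: is_maximal_solution_def T mult.assoc)
      also have "\<dots> \<le> (\<kappa> + 1) * (exp (- \<mu> * t) * norm (\<phi> 0))" by (intro mult_right_mono) auto
      finally show "norm (\<phi> t) \<le> (\<kappa> + 1) * exp (- \<mu> * t) * norm (\<phi> 0)" by (simp add: mult.assoc)
    qed
  qed
  have LES: "origin_LES Dt At ft"
  proof -
    obtain \<kappa> where "0 < \<kappa>" "\<forall>T \<phi>. maximal T \<phi> \<and> norm (\<phi> 0) \<le> 1 \<longrightarrow>
      T = \<infinity> \<and> (\<forall>t\<ge>0. norm (\<phi> t) \<le> \<kappa> * exp (- \<mu> * t) * norm (\<phi> 0))"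
      using max[OF zero_le_one] by (elim exE conjE) (rule that)
    then show ?thesis
      unfolding origin_LES_def
      by (intro exI[of _ 1] exI[of _ \<mu>] exI[of _ \<kappa>] conjI zero_less_one \<mu>)
  qed
  have stable: "origin_stable Dt At ft"
    unfolding origin_stable_def
  proof (intro allI impI)
    fix \<epsilon> :: real assume \<epsilon>: "0 < \<epsilon>"
    obtain \<kappa> where \<kappa>: "0 < \<kappa>" "\<And>T \<phi>. maximal T \<phi> \<Longrightarrow> norm (\<phi> 0) \<le> 1 \<Longrightarrow>
      T = \<infinity> \<and> (\<forall>t\<ge>0. norm (\<phi> t) \<le> \<kappa> * exp (- \<mu> * t) * norm (\<phi> 0))" using max[of 1] by auto
    show "\<exists>\<delta>>0. \<forall>T \<phi>. maximal T \<phi> \<and> norm (\<phi> 0) \<le> \<delta> \<longrightarrow>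
      T = \<infinity> \<and> (\<forall>t\<ge>0. norm (\<phi> t) \<le> \<epsilon>)"
    proof (intro exI[of _ "min 1 (\<epsilon> / \<kappa>)"] conjI allI impI; (elim conjE)?)
      show "0 < min 1 (\<epsilon> / \<kappa>)" using \<epsilon> \<kappa> by simp
      fix T \<phi> assume ms: "maximal T \<phi>" and d: "norm (\<phi> 0) \<le> min 1 (\<epsilon> / \<kappa>)"
      note b = \<kappa>(2)[OF ms]
      show "T = \<infinity>" using b d by simp
      fix t :: real assume t: "0 \<le> t"
      have "norm (\<phi> t) \<le> \<kappa> * exp (- \<mu> * t) * norm (\<phi> 0)" using b d t by simp
      also have "\<dots> \<le> \<kappa> * 1 * (\<epsilon> / \<kappa>)" using \<kappa> \<mu> t d by (intro mult_mono) auto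
      finally show "norm (\<phi> t) \<le> \<epsilon>" using \<kappa> by simp
    qed
  qed
  have "origin_glob_unif_attractive Dt At ft"
    unfolding origin_glob_unif_attractive_def
  proof (intro conjI allI impI)
    fix T \<phi> assume sol: "solution T \<phi>"
    obtain \<kappa> where \<kappa>: "0 \<le> \<kappa>" "\<And>T \<psi> t. solution T \<psi> \<Longrightarrow> norm (\<psi> 0) \<le> norm (\<phi> 0) \<Longrightarrow> 0 \<le> t \<Longrightarrow> ereal t < T \<Longrightarrow>
      norm (\<psi> t) \<le> \<kappa> * exp (- \<mu> * t) * norm (\<psi> 0)" using decay[of "norm (\<phi> 0)"] by auto
    show "bounded (\<phi> ` time_dom T)"
      unfolding bounded_iff
    proof (intro exI[of _ "\<kappa> * 1 * norm (\<phi> 0)"] ballI)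
      fix y assume "y \<in> \<phi> ` time_dom T"
      then obtain t where t: "y = \<phi> t" "0 \<le> t" "ereal t < T" by (auto simp: time_dom_def)
      have "norm y \<le> \<kappa> * exp (- \<mu> * t) * norm (\<phi> 0)" using \<kappa>(2)[OF sol] t by simp
      also have "\<dots> \<le> \<kappa> * 1 * norm (\<phi> 0)"
        using \<kappa> \<mu> t by (intro mult_right_mono mult_left_mono) auto
      finally show "norm y \<le> \<kappa> * 1 * norm (\<phi> 0)" .
    qed
  next
    fix T \<phi> assume "maximal T \<phi>"
    then show "T = \<infinity>" by (rule maximal_solution_global)
  next
    fix \<epsilon> R :: real assume \<epsilon>: "0 < \<epsilon>" and R: "0 < R"
    obtain \<kappa> where \<kappa>: "0 < \<kappa>" "\<And>T \<phi>. maximal T \<phi> \<Longrightarrow> norm (\<phi> 0) \<le> R \<Longrightarrow>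
      T = \<infinity> \<and> (\<forall>t\<ge>0. norm (\<phi> t) \<le> \<kappa> * exp (- \<mu> * t) * norm (\<phi> 0))" using max[of R] R by auto
    \<comment> \<open>The time at which \<open>\<kappa> * R * exp (- \<mu> * t)\<close> has fallen
      to \<epsilon>; the maximum with 1 keeps it positive if the logarithm is not.\<close>
    define \<tau> where "\<tau> = max 1 (ln (\<kappa> * R / \<epsilon>) / \<mu>)"
    show "\<exists>\<tau>>0. \<forall>T \<phi>. maximal T \<phi> \<and> norm (\<phi> 0) \<le> R \<longrightarrow> (\<forall>t\<ge>\<tau>. norm (\<phi> t) \<le> \<epsilon>)"
    proof (intro exI[of _ \<tau>] conjI allI impI; (elim conjE)?)
      show "0 < \<tau>" by (simp add: \<tau>_def)
      fix T \<phi> t assume ms: "maximal T \<phi>" and d: "norm (\<phi> 0) \<le> R" and t: "\<tau> \<le> t"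
      have t0: "0 \<le> t" using t by (simp add: \<tau>_def)
      have "ln (\<kappa> * R / \<epsilon>) / \<mu> \<le> t" using t by (simp add: \<tau>_def)
      then have "ln (\<kappa> * R / \<epsilon>) \<le> \<mu> * t" using \<mu> by (simp add: pos_divide_le_eq mult.commute)
      then have "\<kappa> * R / \<epsilon> \<le> exp (\<mu> * t)"
        using exp_le_cancel_iff[of "ln (\<kappa> * R / \<epsilon>)" "\<mu> * t"] \<kappa>(1) R \<epsilon> by simp
      then have "\<kappa> * R * exp (- \<mu> * t) \<le> \<epsilon>" using \<epsilon> by (simp add: exp_minus field_simps)
      moreover have "norm (\<phi> t) \<le> \<kappa> * exp (- \<mu> * t) * norm (\<phi> 0)" using \<kappa>(2)[OF ms d] t0 by blast
      moreover have "\<kappa> * exp (- \<mu> * t) * norm (\<phi> 0) \<le> \<kappa> * exp (- \<mu> * t) * R"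
        using d \<kappa> by (intro mult_left_mono) auto
      ultimately show "norm (\<phi> t) \<le> \<epsilon>" by (simp add: mult_ac)
    qed
  qed
  then show ?thesis using LES stable by (simp add: origin_GAS_def)
qed

end

theorem theorem4:
  fixes lam k \<rho> \<gamma> \<alpha> y_r :: real and u_r :: L2
  assumes "lam > 0" "k > 0" "\<rho> > 0" "\<gamma> > 0" "\<alpha> > 0" "y_r \<noteq> 0"
  shows "origin_GAS (D_tot \<alpha> \<gamma>) (A_tot lam k \<rho>) (f_tot lam k y_r u_r) \<and>
    origin_LES (D_tot \<alpha> \<gamma>) (A_tot lam k \<rho>) (f_tot lam k y_r u_r)"
proof -
  interpret error_system lam k \<rho> \<gamma> \<alpha> y_r u_r
    by unfold_locales (use assms in auto)
  show ?thesis by (rule GAS_LES)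
qed

end
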